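(* For every program $\langle C,Q\rangle$, every $\rho\in\mathcal D^Q$ and every $a\in\mathcal A^Q$: if $(\rho,a)\in\sigma$ then $(\llbracket C\rrbracket(\rho),\ \llbracket C\rrbracket^\natural(a))\in\sigma$. That is, if $\rho$ is $\pi$-separable and $\beta(\rho)\le b$, then writing $(b',\pi')=\llbracket C\rrbracket^\natural(b,\pi)$, the matrix $\llbracket C\rrbracket(\rho)$ is $\pi'$-separable and $\beta(\llbracket C\rrbracket(\rho))\le b'$.
   Context: Quantum states. Qubits are indexed by a finite set $Q$; $\mathcal D^Q$ is the set of $2^{|Q|}\times2^{|Q|}$ complex self-adjoint positive-semidefinite matrices of trace at most $1$ on $\bigotimes_{q\in Q}\mathbb C^2$. For a matrix $M$ on one (resp. two) qubits, $M_q$ (resp. $M_{q_1,q_2}$) denotes $M$ acting on qubit $q$ (resp. on $q_1,q_2$ in that order), identity elsewhere. Let $P^{\mathsf{true}}=\begin{pmatrix}1&0\\0&0\end{pmatrix}$, $P^{\mathsf{false}}=\begin{pmatrix}0&0\\0&1\end{pmatrix}$, $H=\frac1{\sqrt2}\begin{pmatrix}1&1\\1&-1\end{pmatrix}$, $T=\begin{pmatrix}1&0\\0&e^{i\pi/4}\end{pmatrix}$, $\sigma_x=\begin{pmatrix}0&1\\1&0\end{pmatrix}$, $\sigma_y=\begin{pmatrix}0&-i\\i&0\end{pmatrix}$, $\sigma_z=\begin{pmatrix}1&0\\0&-1\end{pmatrix}$, and $CNot$ the $4\times4$ permutation matrix swapping the last two basis vectors of $\mathbb C^2\otimes\mathbb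 C^2$ (first qubit control, second target). $F_M=\lambda\rho.\,M\rho M^\dagger$. Programs. A program is a pair $\langle C,Q\rangle$ with $C$ generated by $C::=\mathsf{skip}\mid C_1;C_2\mid \mathsf{if}\ q\ \mathsf{then}\ C_1\ \mathsf{else}\ C_2\mid \mathsf{while}\ q\ \mathsf{do}\ C\mid \mathsf H(q)\mid \mathsf T(q)\mid \sigma(q)\mid \mathsf{CNot}(q_1,q_2)$, where $q,q_1,q_2\in Q$, $q_1\ne q_2$, and $\sigma\in\{\sigma_x,\sigma_y,\sigma_z\}$. Concrete semantics $\llbracket C\rrbracket:\mathcal D^Q\to\mathcal D^Q$: $\llbracket\mathsf{skip}\rrbracket=\mathrm{id}$; $\llbracket C_1;C_2\rrbracket=\llbracket C_2\rrbracket\circ\llbracket C_1\rrbracket$; $\llbracket U(q)\rrbracket=\lambda\rho.\,U_q\rho U_q^\dagger$ for $U\in\{H,T,\sigma_x,\sigma_y,\sigma_z\}$; $\llbracket\mathsf{CNot}(q_1,q_2)\rrbracket=\lambda\rho.\,CNot_{q_1,q_2}\rho\, CNot_{q_1,q_2}^\dagger$; $\llbracket\mathsf{if}\ q\ \mathsf{then}\ C_1\ \mathsf{else}\ C_2\rrbracket=\lambda\rho.\,\llbracket C_1\rrbracket(P^{\mathsf{true}}_q\rho P^{\mathsf{true}}_q)+\llbracket C_2\rrbracket(P^{\mathsf{false}}_q\rho P^{\mathsf{false}}_q)$; $\llbracket\mathsf{while}\ q\ \mathsf{do}\ C\rrbracket=\sum_{n\in\mathbb N}F_{P^{\mathsf{false}}_q}\circ(\llbracket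 C\rrbracket\circ F_{P^{\mathsf{true}}_q})^n$ (pointwise convergent sum). Separability and bases. For a partition $\pi=\{Q_j:j\in J\}$ of $Q$, $\rho$ is $\pi$-separable iff $\rho=\sum_{k\in K}p_k\bigotimes_{j\in J}\rho_k^{Q_j}$ for some finite $K$, $p_k\ge0$, and density matrices $\rho_k^{Q_j}$ on the qubits $Q_j$. Qubit $q$ is in the standard basis in $\rho$ iff $P^{\mathsf{true}}_q\rho P^{\mathsf{false}}_q=P^{\mathsf{false}}_q\rho P^{\mathsf{true}}_q=0$, and in the diagonal basis iff it is in the standard basis in $H_q\rho H_q$. Abstract domain. $L=\{\mathbf s,\mathbf d,\top,\bot\}$ with $\bot\le\mathbf s\le\top$, $\bot\le\mathbf d\le\top$; $B^Q=(Q\to L)$ ordered pointwise. $\beta:\mathcal D^Q\to B^Q$: $\beta(\rho)_q=\bot$ if $q$ is in both the standard and diagonal basis in $\rho$, $\mathbf s$ if only in the standard basis, $\mathbf d$ if only in the diagonal basis, $\top$ otherwise. $\Pi^Q$ = partitions of $Q$ ordered by refinement; $\mathcal A^Q=B^Q\times\Pi^Q$ ordered componentwise, with join $\vee$ (pointwise join in $L$; finest common coarsening of partitions). For $\pi=\{Q_i\}$, $\pi\setminus q=\{Q_i\setminus\{q\}\}\cup\{\{q\}\}$ (empty blocks discarded); $[q_1,q_2]$ is the partition with block $\{q_1,q_2\}$ and all other blocks singletons; $b^{q_0\mapsto k}$ equals $b$ except that it maps $q_0$ to $k$ (similarly for several qubits). Soundness relation: $\sigma=\{(\rho,(b,\pi))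 : \rho$ is $\pi$-separable and $\beta(\rho)\le b\}$. Abstract semantics $\llbracket C\rrbracket^\natural:\mathcal A^Q\to\mathcal A^Q$: $\llbracket\mathsf{skip}\rrbracket^\natural(b,\pi)=(b,\pi)$; $\llbracket C_1;C_2\rrbracket^\natural=\llbracket C_2\rrbracket^\natural\circ\llbracket C_1\rrbracket^\natural$; $\llbracket\sigma(q)\rrbracket^\natural(b,\pi)=(b,\pi)$; $\llbracket\mathsf H(q)\rrbracket^\natural(b,\pi)$ is $(b^{q\mapsto\mathbf d},\pi)$ if $b_q=\mathbf s$, $(b^{q\mapsto\mathbf s},\pi)$ if $b_q=\mathbf d$, $(b,\pi)$ otherwise; $\llbracket\mathsf T(q)\rrbracket^\natural(b,\pi)$ is $(b^{q\mapsto\top},\pi)$ if $b_q=\mathbf d$, $(b^{q\mapsto\mathbf s},\pi)$ if $b_q=\bot$, $(b,\pi)$ otherwise; $\llbracket\mathsf{CNot}(q_1,q_2)\rrbracket^\natural(b,\pi)$ is, checking cases in order: $(b,\pi)$ if $b_{q_1}=\mathbf s$ or $b_{q_2}=\mathbf d$; $(b^{q_1\mapsto\mathbf s},\pi)$ if $b_{q_1}=\bot$ and $b_{q_2}>\bot$; $(b^{q_2\mapsto\mathbf d},\pi)$ if $b_{q_1}>\bot$ and $b_{q_2}=\bot$; $(b^{q_1\mapsto\mathbf s,q_2\mapsto\mathbf d},\pi)$ if $b_{q_1}=b_{q_2}=\bot$; $(b^{q_1,q_2\mapsto\top},\pi\vee[q_1,q_2])$ otherwise. With $F^\natural_q=\lambda(b,\pi).(b^{q\mapsto\mathbf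 s},\pi\setminus q)$: $\llbracket\mathsf{if}\ q\ \mathsf{then}\ C_1\ \mathsf{else}\ C_2\rrbracket^\natural(b,\pi)=\llbracket C_1\rrbracket^\natural(F^\natural_q(b,\pi))\vee\llbracket C_2\rrbracket^\natural(F^\natural_q(b,\pi))$, and $\llbracket\mathsf{while}\ q\ \mathsf{do}\ C\rrbracket^\natural=\bigvee_{n\in\mathbb N}F^\natural_q\circ(\llbracket C\rrbracket^\natural\circ F^\natural_q)^n$ (pointwise join). *)

theory Defs
  imports Complex_Main "HOL-Library.Disjoint_Sets" "Jordan_Normal_Form.Matrix"
begin

section \<open>Matrices on a finite set of qubits\<close>

text \<open>
  The computational basis vectors of the space of the qubits in \<open>Q\<close> are indexed by the subsets of
  \<open>Q\<close>: the subset \<open>x\<close> stands for the tensor product having the second basis vector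
  (index 1, value \<open>false\<close>) at the qubits in \<open>x\<close> and the first one (index 0, value \<open>true\<close>)
  at the qubits in \<open>Q - x\<close>.  A matrix on \<open>Q\<close> has rows and columns indexed by \<open>Pow Q\<close> and
  is represented by a function that vanishes outside \<open>Pow Q \<times> Pow Q\<close>, so that equality of
  matrices is equality of functions.
\<close>

type_synonym 'q qmat = "'q set \<Rightarrow> 'q set \<Rightarrow> complex"

definition qmats :: "'q set \<Rightarrow> 'q qmat set" where
  "qmats Q = {M. \<forall>x y. \<not> (x \<subseteq> Q \<and> y \<subseteq> Q) \<longrightarrow> M x y = 0}"

definition zero_qmat :: "'q qmat" where
  "zero_qmat = (\<lambda>x y. 0)"

definition times_qmat :: "'q set \<Rightarrow> 'q qmat \<Rightarrow> 'q qmat \<Rightarrow> 'q qmat" where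
  "times_qmat Q A B = (\<lambda>x y. \<Sum>z\<in>Pow Q. A x z * B z y)"

definition adjoint_qmat :: "'q qmat \<Rightarrow> 'q qmat" where
  "adjoint_qmat A = (\<lambda>x y. cnj (A y x))"

definition trace_qmat :: "'q set \<Rightarrow> 'q qmat \<Rightarrow> complex" where
  "trace_qmat Q A = (\<Sum>x\<in>Pow Q. A x x)"

definition pos_semidef :: "'q set \<Rightarrow> 'q qmat \<Rightarrow> bool" where
  "pos_semidef Q A \<longleftrightarrow>
     (\<forall>v :: 'q set \<Rightarrow> complex. 0 \<le> Re (\<Sum>x\<in>Pow Q. \<Sum>y\<in>Pow Q. cnj (v x) * A x y * v y))"

text \<open>The set \<open>\<D>\<^sup>Q\<close>; the trace of a self-adjoint matrix is real.\<close>

definition states :: "'q set \<Rightarrow> 'q qmat set" where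
  "states Q = {\<rho> \<in> qmats Q. adjoint_qmat \<rho> = \<rho> \<and> pos_semidef Q \<rho> \<and> Re (trace_qmat Q \<rho>) \<le> 1}"


section \<open>Gates and projections\<close>

definition P_true :: "complex mat" where
  "P_true = mat_of_rows_list 2 [[1, 0], [0, 0]]"

definition P_false :: "complex mat" where
  "P_false = mat_of_rows_list 2 [[0, 0], [0, 1]]"

definition H_mat :: "complex mat" where
  "H_mat = complex_of_real (1 / sqrt 2) \<cdot>\<^sub>m mat_of_rows_list 2 [[1, 1], [1, -1]]"

definition T_mat :: "complex mat" where
  "T_mat = mat_of_rows_list 2 [[1, 0], [0, exp (\<i> * complex_of_real (pi / 4))]]"

definition CNot_mat :: "complex mat" where
  "CNot_mat = mat_of_rows_list 4
     [[1, 0, 0, 0],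
      [0, 1, 0, 0],
      [0, 0, 0, 1],
      [0, 0, 1, 0]]"

datatype pauli = Sigma_x | Sigma_y | Sigma_z

fun pauli_mat :: "pauli \<Rightarrow> complex mat" where
  "pauli_mat Sigma_x = mat_of_rows_list 2 [[0, 1], [1, 0]]"
| "pauli_mat Sigma_y = mat_of_rows_list 2 [[0, -\<i>], [\<i>, 0]]"
| "pauli_mat Sigma_z = mat_of_rows_list 2 [[1, 0], [0, -1]]"

definition qbit :: "'q set \<Rightarrow> 'q \<Rightarrow> nat" where
  "qbit x q = (if q \<in> x then 1 else 0)"

text \<open>\<open>M\<^sub>q\<close> and \<open>M\<^bsub>q1,q2\<^esub>\<close>: the given matrix at the named qubits, identity elsewhere.\<close>

definition on1 :: "'q set \<Rightarrow> complex mat \<Rightarrow> 'q \<Rightarrow> 'q qmat" where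
  "on1 Q M q = (\<lambda>x y. if x \<subseteq> Q \<and> y \<subseteq> Q \<and> x - {q} = y - {q}
     then M $$ (qbit x q, qbit y q) else 0)"

definition on2 :: "'q set \<Rightarrow> complex mat \<Rightarrow> 'q \<Rightarrow> 'q \<Rightarrow> 'q qmat" where
  "on2 Q M q1 q2 = (\<lambda>x y. if x \<subseteq> Q \<and> y \<subseteq> Q \<and> x - {q1, q2} = y - {q1, q2}
     then M $$ (2 * qbit x q1 + qbit x q2, 2 * qbit y q1 + qbit y q2) else 0)"

text \<open>\<open>F\<^sub>M\<close> maps \<open>\<rho>\<close> to \<open>M \<rho> M\<^sup>\<dagger>\<close>.\<close>

definition conj_by :: "'q set \<Rightarrow> 'q qmat \<Rightarrow> 'q qmat \<Rightarrow> 'q qmat" where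
  "conj_by Q M \<rho> = times_qmat Q (times_qmat Q M \<rho>) (adjoint_qmat M)"


section \<open>Programs and their concrete semantics\<close>

datatype 'q com =
    Skip
  | Seq "'q com" "'q com"
  | Cond 'q "'q com" "'q com"
  | While 'q "'q com"
  | HGate 'q
  | TGate 'q
  | Pauli pauli 'q
  | CNot 'q 'q

fun is_program :: "'q com \<Rightarrow> 'q set \<Rightarrow> bool" where
  "is_program Skip Q \<longleftrightarrow> True"
| "is_program (Seq C1 C2) Q \<longleftrightarrow> is_program C1 Q \<and> is_program C2 Q"
| "is_program (Cond q C1 C2) Q \<longleftrightarrow> q \<in> Q \<and> is_program C1 Q \<and> is_program C2 Q"
| "is_program (While q C) Q \<longleftrightarrow> q \<in> Q \<and> is_program C Q"
| "is_program (HGate q) Q \<longleftrightarrow> q \<in> Q"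
| "is_program (TGate q) Q \<longleftrightarrow> q \<in> Q"
| "is_program (Pauli s q) Q \<longleftrightarrow> q \<in> Q"
| "is_program (CNot q1 q2) Q \<longleftrightarrow> q1 \<in> Q \<and> q2 \<in> Q \<and> q1 \<noteq> q2"

text \<open>The series for a loop is summed entrywise; the matrices are finite, so this is convergence in
  any norm.\<close>

primrec sem :: "'q set \<Rightarrow> 'q com \<Rightarrow> 'q qmat \<Rightarrow> 'q qmat" where
  "sem Q Skip = id"
| "sem Q (Seq C1 C2) = sem Q C2 \<circ> sem Q C1"
| "sem Q (Cond q C1 C2) = (\<lambda>\<rho> x y.
     sem Q C1 (times_qmat Q (times_qmat Q (on1 Q P_true q) \<rho>) (on1 Q P_true q)) x y +
     sem Q C2 (times_qmat Q (times_qmat Q (on1 Q P_false q) \<rho>) (on1 Q P_false q)) x y)"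
| "sem Q (While q C) = (\<lambda>\<rho> x y. \<Sum>n.
     (conj_by Q (on1 Q P_false q) \<circ> (sem Q C \<circ> conj_by Q (on1 Q P_true q)) ^^ n) \<rho> x y)"
| "sem Q (HGate q) = conj_by Q (on1 Q H_mat q)"
| "sem Q (TGate q) = conj_by Q (on1 Q T_mat q)"
| "sem Q (Pauli s q) = conj_by Q (on1 Q (pauli_mat s) q)"
| "sem Q (CNot q1 q2) = conj_by Q (on2 Q CNot_mat q1 q2)"


section \<open>Separability and bases\<close>

definition tensor :: "'q set \<Rightarrow> 'q set set \<Rightarrow> ('q set \<Rightarrow> 'q qmat) \<Rightarrow> 'q qmat" where
  "tensor Q \<pi> r = (\<lambda>x y. if x \<subseteq> Q \<and> y \<subseteq> Q then \<Prod>B\<in>\<pi>. r B (x \<inter> B) (y \<inter> B) else 0)"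

text \<open>The factors range over \<open>\<D>\<^sup>B\<close> (trace at most 1).  As the weights \<open>p k\<close> need not sum to 1,
  demanding trace 1 gives the same notion.\<close>

definition separable :: "'q set \<Rightarrow> 'q set set \<Rightarrow> 'q qmat \<Rightarrow> bool" where
  "separable Q \<pi> \<rho> \<longleftrightarrow>
     (\<exists>(K :: nat set) (p :: nat \<Rightarrow> real) (r :: nat \<Rightarrow> 'q set \<Rightarrow> 'q qmat).
        finite K \<and> (\<forall>k\<in>K. 0 \<le> p k \<and> (\<forall>B\<in>\<pi>. r k B \<in> states B)) \<and>
        \<rho> = (\<lambda>x y. \<Sum>k\<in>K. complex_of_real (p k) * tensor Q \<pi> (r k) x y))"

definition in_standard_basis :: "'q set \<Rightarrow> 'q \<Rightarrow> 'q qmat \<Rightarrow> bool" where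
  "in_standard_basis Q q \<rho> \<longleftrightarrow>
     times_qmat Q (times_qmat Q (on1 Q P_true q) \<rho>) (on1 Q P_false q) = zero_qmat \<and>
     times_qmat Q (times_qmat Q (on1 Q P_false q) \<rho>) (on1 Q P_true q) = zero_qmat"

definition in_diagonal_basis :: "'q set \<Rightarrow> 'q \<Rightarrow> 'q qmat \<Rightarrow> bool" where
  "in_diagonal_basis Q q \<rho> \<longleftrightarrow>
     in_standard_basis Q q (times_qmat Q (times_qmat Q (on1 Q H_mat q) \<rho>) (on1 Q H_mat q))"


section \<open>Abstract domain\<close>

datatype basis = Bot_b | Std | Diag | Top_b

instantiation basis :: complete_lattice
begin

definition "bot_basis = Bot_b"
definition "top_basis = Top_b"
definition "a \<le> b \<longleftrightarrow> a = Bot_b \<or> a = b \<or> b = Top_b" for a b :: basis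
definition "a < b \<longleftrightarrow> a \<le> b \<and> a \<noteq> b" for a b :: basis
definition "sup_basis a b = (if a \<le> b then b else if b \<le> a then a else Top_b)" for a b :: basis
definition "inf_basis a b = (if a \<le> b then a else if b \<le> a then b else Bot_b)" for a b :: basis
definition "Sup_basis A =
  (if A \<subseteq> {Bot_b} then Bot_b else if A \<subseteq> {Bot_b, Std} then Std
   else if A \<subseteq> {Bot_b, Diag} then Diag else Top_b)"
definition "Inf_basis A =
  (if A \<subseteq> {Top_b} then Top_b else if A \<subseteq> {Top_b, Std} then Std
   else if A \<subseteq> {Top_b, Diag} then Diag else Bot_b)"

instance
proof
  fix a b :: basis and A :: "basis set"
  note defs = less_eq_basis_def less_basis_def sup_basis_def inf_basis_def bot_basis_def
    top_basis_def Sup_basis_def Inf_basis_def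
  show "(a < b) = (a \<le> b \<and> \<not> b \<le> a)" by (auto simp: defs)
  show "a \<le> Sup A" if "a \<in> A" using that by (cases a) (auto simp: defs)
  show "Inf A \<le> a" if "a \<in> A" using that by (cases a) (auto simp: defs)
  show "Sup A \<le> b" if "\<And>a. a \<in> A \<Longrightarrow> a \<le> b"
    using that by (cases b) (fastforce simp: defs)+
  show "b \<le> Inf A" if "\<And>a. a \<in> A \<Longrightarrow> b \<le> a"
    using that by (cases b) (fastforce simp: defs)+
qed (auto simp: less_eq_basis_def less_basis_def sup_basis_def inf_basis_def bot_basis_def
    top_basis_def Sup_basis_def Inf_basis_def)

end

text \<open>An element of \<open>B\<^sup>Q\<close> is a total function whose values outside \<open>Q\<close> are irrelevant.\<close>

type_synonym 'q astate = "('q \<Rightarrow> basis) \<times> 'q set set"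

definition \<beta> :: "'q set \<Rightarrow> 'q qmat \<Rightarrow> 'q \<Rightarrow> basis" where
  "\<beta> Q \<rho> q =
     (if in_standard_basis Q q \<rho> \<and> in_diagonal_basis Q q \<rho> then Bot_b
      else if in_standard_basis Q q \<rho> then Std
      else if in_diagonal_basis Q q \<rho> then Diag
      else Top_b)"

definition astates :: "'q set \<Rightarrow> 'q astate set" where
  "astates Q = {(b, \<pi>). partition_on Q \<pi>}"

text \<open>The join of a set of partitions: their finest common coarsening, that is, their least upper
  bound for refinement.\<close>

definition part_Join :: "'q set \<Rightarrow> 'q set set set \<Rightarrow> 'q set set" where
  "part_Join Q S = (THE \<pi>.
     partition_on Q \<pi> \<and> (\<forall>\<tau>\<in>S. refines Q \<tau> \<pi>) \<and>
     (\<forall>\<pi>'. partition_on Q \<pi>' \<and> (\<forall>\<tau>\<in>S. refines Q \<tau> \<pi>') \<longrightarrow> refines Q \<pi> \<pi>'))"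

lemma part_Join_unique_existence:
  assumes "\<And>\<tau>. \<tau> \<in> S \<Longrightarrow> partition_on Q \<tau>"
  shows "\<exists>!\<pi>. partition_on Q \<pi> \<and> (\<forall>\<tau>\<in>S. refines Q \<tau> \<pi>) \<and>
     (\<forall>\<pi>'. partition_on Q \<pi>' \<and> (\<forall>\<tau>\<in>S. refines Q \<tau> \<pi>') \<longrightarrow> refines Q \<pi> \<pi>')"
proof -
  define U where "U = {\<pi>'. partition_on Q \<pi>' \<and> (\<forall>\<tau>\<in>S. refines Q \<tau> \<pi>')}"
  have part: "\<And>\<pi>'. \<pi>' \<in> U \<Longrightarrow> partition_on Q \<pi>'" by (simp add: U_def)
  have "(if Q = {} then {} else {Q}) \<in> U"
  proof (cases "Q = {}")
    case True
    then show ?thesis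
      using assms by (auto simp: U_def refines_def partition_on_empty)
  next
    case False
    moreover have "X \<subseteq> Q" if "X \<in> \<tau>" "\<tau> \<in> S" for X \<tau>
      using assms[OF that(2)] that(1) by (auto simp: partition_on_def)
    ultimately show ?thesis
      using assms partition_on_space[OF False] by (auto simp: U_def refines_def)
  qed
  then have ne: "U \<noteq> {}" by blast
  have up: "refines Q \<tau> (common_refinement U)" if "\<tau> \<in> S" for \<tau>
    using that part assms ne by (intro common_refinement_coarsest) (auto simp: U_def)
  have low: "refines Q (common_refinement U) \<pi>'" if "\<pi>' \<in> U" for \<pi>'
    using part that by (rule refines_common_refinement)
  have "partition_on Q (common_refinement U)"
    using part ne by (rule partition_on_common_refinement)
  then have cr: "common_refinement U \<in> U" using up by (simp add: U_def)
  show ?thesis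
  proof (rule ex1I[of _ "common_refinement U"])
    show "partition_on Q (common_refinement U) \<and> (\<forall>\<tau>\<in>S. refines Q \<tau> (common_refinement U)) \<and>
      (\<forall>\<pi>'. partition_on Q \<pi>' \<and> (\<forall>\<tau>\<in>S. refines Q \<tau> \<pi>') \<longrightarrow> refines Q (common_refinement U) \<pi>')"
      using cr low by (simp add: U_def)
  next
    fix \<pi>
    assume a: "partition_on Q \<pi> \<and> (\<forall>\<tau>\<in>S. refines Q \<tau> \<pi>) \<and>
      (\<forall>\<pi>'. partition_on Q \<pi>' \<and> (\<forall>\<tau>\<in>S. refines Q \<tau> \<pi>') \<longrightarrow> refines Q \<pi> \<pi>')"
    then have "refines Q \<pi> (common_refinement U)" using cr by (simp add: U_def)
    moreover have "refines Q (common_refinement U) \<pi>" using a low by (simp add: U_def)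
    ultimately show "\<pi> = common_refinement U" by (rule refines_asym)
  qed
qed

definition aJoin :: "'q set \<Rightarrow> 'q astate set \<Rightarrow> 'q astate" where
  "aJoin Q X = ((SUP a\<in>X. fst a), part_Join Q (snd ` X))"

definition part_minus :: "'q set set \<Rightarrow> 'q \<Rightarrow> 'q set set" where
  "part_minus \<pi> q = (((\<lambda>B. B - {q}) ` \<pi>) \<union> {{q}}) - {{}}"

definition part_pair :: "'q set \<Rightarrow> 'q \<Rightarrow> 'q \<Rightarrow> 'q set set" where
  "part_pair Q q1 q2 = insert {q1, q2} ((\<lambda>q. {q}) ` (Q - {q1, q2}))"

definition soundness :: "'q set \<Rightarrow> ('q qmat \<times> 'q astate) set" where
  "soundness Q = {(\<rho>, (b, \<pi>)).
     \<rho> \<in> states Q \<and> (b, \<pi>) \<in> astates Q \<and> separable Q \<pi> \<rho> \<and> (\<forall>q\<in>Q. \<beta> Q \<rho> q \<le> b q)}"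


section \<open>Abstract semantics\<close>

fun aF :: "'q \<Rightarrow> 'q astate \<Rightarrow> 'q astate" where
  "aF q (b, \<pi>) = (b(q := Std), part_minus \<pi> q)"

fun aH :: "'q \<Rightarrow> 'q astate \<Rightarrow> 'q astate" where
  "aH q (b, \<pi>) =
     (if b q = Std then (b(q := Diag), \<pi>)
      else if b q = Diag then (b(q := Std), \<pi>)
      else (b, \<pi>))"

fun aT :: "'q \<Rightarrow> 'q astate \<Rightarrow> 'q astate" where
  "aT q (b, \<pi>) =
     (if b q = Diag then (b(q := Top_b), \<pi>)
      else if b q = Bot_b then (b(q := Std), \<pi>)
      else (b, \<pi>))"

fun aCNot :: "'q set \<Rightarrow> 'q \<Rightarrow> 'q \<Rightarrow> 'q astate \<Rightarrow> 'q astate" where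
  "aCNot Q q1 q2 (b, \<pi>) =
     (if b q1 = Std \<or> b q2 = Diag then (b, \<pi>)
      else if b q1 = Bot_b \<and> b q2 > Bot_b then (b(q1 := Std), \<pi>)
      else if b q1 > Bot_b \<and> b q2 = Bot_b then (b(q2 := Diag), \<pi>)
      else if b q1 = Bot_b \<and> b q2 = Bot_b then (b(q1 := Std, q2 := Diag), \<pi>)
      else (b(q1 := Top_b, q2 := Top_b), part_Join Q {\<pi>, part_pair Q q1 q2}))"

primrec asem :: "'q set \<Rightarrow> 'q com \<Rightarrow> 'q astate \<Rightarrow> 'q astate" where
  "asem Q Skip = id"
| "asem Q (Seq C1 C2) = asem Q C2 \<circ> asem Q C1"
| "asem Q (Cond q C1 C2) = (\<lambda>a. aJoin Q {asem Q C1 (aF q a), asem Q C2 (aF q a)})"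
| "asem Q (While q C) = (\<lambda>a. aJoin Q (range (\<lambda>n. (aF q \<circ> (asem Q C \<circ> aF q) ^^ n) a)))"
| "asem Q (HGate q) = aH q"
| "asem Q (TGate q) = aT q"
| "asem Q (Pauli s q) = id"
| "asem Q (CNot q1 q2) = aCNot Q q1 q2"

end

theory Submission
  imports Defs
begin

text \<open>
  A qubit is in the standard basis iff the entries between indices that differ at it vanish, and in
  the diagonal basis iff the entries are invariant under flipping it in both indices; with this the
  basis part of every gate is a computation on entries.  For separability, only the convex cone
  generated by products of positive semidefinite blocks matters.  Single-qubit operations act on one
  block; a controlled negation whose control is standard, or whose target is diagonal, is a sum of two
  products of single-qubit operations; otherwise the blocks of its two qubits have been merged.
  A loop needs the cone to be closed: by Caratheodory's theorem the number of product terms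
  is bounded, and so are their weights by the trace, so that decompositions of the partial sums have a
  convergent subsequence.  The series itself
  converges because the entries of a positive semidefinite matrix are dominated by its trace and the
  traces telescope.
\<close>


section \<open>Positive semidefinite kernels\<close>

text \<open>Positivity is handled throughout by Gram factorisations: on a finite index set a kernel
  is positive semidefinite iff it is a finite sum of rank-one kernels
  \<open>w x * cnj (w y)\<close>. Conjugation, restriction of indices and entrywise products then
  act on the vectors \<open>w\<close>; a tensor in particular is an entrywise product of blocks
  pulled back along \<open>x \<inter> B\<close>. Separability demands finitely many terms but gives
  no bound on them, and this is the obstacle for loops: without a bound depending only on the
  dimension, decompositions of the partial sums have no common index set along which to pass to the
  limit. Every factor is normalised to trace one for the same reason: its entries are then at most 1
  in modulus, and the weights sum to the trace. Soundness alone is too weak for an induction on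
  programs, since a sum of two outcomes might have trace above 1; the induction also carries that
  traces do not increase. Joins are handled by first moving each summand up to the join, soundness
  being upward closed, so that sums are only formed at one common abstract value.\<close>

definition psd_on :: "'a set \<Rightarrow> ('a \<Rightarrow> 'a \<Rightarrow> complex) \<Rightarrow> bool" where
  "psd_on S A \<longleftrightarrow> (\<forall>x\<in>S. \<forall>y\<in>S. A y x = cnj (A x y)) \<and>
     (\<forall>v. 0 \<le> Re (\<Sum>x\<in>S. \<Sum>y\<in>S. cnj (v x) * A x y * v y))"

lemma psd_on_herm: "psd_on S A \<Longrightarrow> x \<in> S \<Longrightarrow> y \<in> S \<Longrightarrow> A y x = cnj (A x y)"
  unfolding psd_on_def by blast

lemma psd_on_form:
  assumes "psd_on S A"
  shows "0 \<le> Re (\<Sum>x\<in>S. \<Sum>y\<in>S. cnj (v x) * A x y * v y)"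
  by (rule spec[OF conjunct2[OF assms[unfolded psd_on_def]], of v])

lemma psd_on_cong:
  assumes "\<And>x y. x \<in> S \<Longrightarrow> y \<in> S \<Longrightarrow> A x y = B x y"
  shows "psd_on S A \<longleftrightarrow> psd_on S B"
  unfolding psd_on_def using assms by (simp cong: sum.cong)

text \<open>After substitution the form at \<open>v\<close> is the sum over \<open>i\<close> of
  \<open>c i * cnj (c i)\<close>, where \<open>c i\<close> pairs \<open>v\<close> with the vector
  \<open>w i\<close>.\<close>

lemma psd_on_gramI:
  assumes "finite I"
    and A: "\<And>x y. x \<in> S \<Longrightarrow> y \<in> S \<Longrightarrow> A x y = (\<Sum>i\<in>I. w i x * cnj (w i y))"
  shows "psd_on S A"
  unfolding psd_on_def
proof (intro conjI ballI allI)
  fix x y assume "x \<in> S" "y \<in> S"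
  then show "A y x = cnj (A x y)" by (simp add: A mult.commute)
next
  fix v
  define c where "c i = (\<Sum>x\<in>S. cnj (v x) * w i x)" for i
  have "(\<Sum>x\<in>S. \<Sum>y\<in>S. cnj (v x) * A x y * v y)
      = (\<Sum>x\<in>S. \<Sum>y\<in>S. \<Sum>i\<in>I. (cnj (v x) * w i x) * (v y * cnj (w i y)))"
    by (simp add: A sum_distrib_left sum_distrib_right mult_ac cong: sum.cong)
  also have "\<dots> = (\<Sum>i\<in>I. \<Sum>x\<in>S. \<Sum>y\<in>S. (cnj (v x) * w i x) * (v y * cnj (w i y)))"
    by (subst sum.swap[of _ I S]) (intro sum.cong refl sum.swap)
  also have "\<dots> = (\<Sum>i\<in>I. c i * cnj (c i))"
    by (simp add: c_def sum_product)
  also have "Re \<dots> \<ge> 0"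
    by (simp add: Re_sum complex_mult_cnj sum_nonneg)
  finally show "0 \<le> Re (\<Sum>x\<in>S. \<Sum>y\<in>S. cnj (v x) * A x y * v y)" .
qed

text \<open>A test vector on \<open>T\<close> is extended by zero to \<open>S\<close>.\<close>

lemma psd_on_subset:
  assumes "psd_on S A" "T \<subseteq> S" "finite S"
  shows "psd_on T A"
  unfolding psd_on_def
proof (intro conjI ballI allI)
  fix x y assume "x \<in> T" "y \<in> T"
  then show "A y x = cnj (A x y)" using assms unfolding psd_on_def by blast
next
  fix v :: "'a \<Rightarrow> complex"
  define u where "u x = (if x \<in> T then v x else 0)" for x
  have "(\<Sum>x\<in>S. \<Sum>y\<in>S. cnj (u x) * A x y * u y) = (\<Sum>x\<in>T. \<Sum>y\<in>S. cnj (u x) * A x y * u y)"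
    using assms by (intro sum.mono_neutral_right) (auto simp: u_def)
  also have "\<dots> = (\<Sum>x\<in>T. \<Sum>y\<in>T. cnj (u x) * A x y * u y)"
    using assms by (intro sum.cong refl sum.mono_neutral_right) (auto simp: u_def)
  also have "\<dots> = (\<Sum>x\<in>T. \<Sum>y\<in>T. cnj (v x) * A x y * v y)"
    by (intro sum.cong refl) (auto simp: u_def)
  finally show "0 \<le> Re (\<Sum>x\<in>T. \<Sum>y\<in>T. cnj (v x) * A x y * v y)"
    using psd_on_form[OF assms(1), of u] by simp
qed

lemma psd_on_diag:
  assumes "psd_on S A" "x \<in> S" "finite S"
  shows "0 \<le> Re (A x x)" "Im (A x x) = 0"
proof -
  show "0 \<le> Re (A x x)"
    using psd_on_form[of "{x}" A "\<lambda>_. 1"] psd_on_subset[OF assms(1), of "{x}"] assms by simp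
  have "A x x = cnj (A x x)" using psd_on_herm[OF assms(1,2,2)] .
  then show "Im (A x x) = 0" by (metis Reals_cnj_iff complex_is_Real_iff)
qed

lemma psd_on_null_row:
  assumes "psd_on S A" "x \<in> S" "y \<in> S" "finite S" "A x x = 0"
  shows "A x y = 0"
proof (rule ccontr)
  assume nz: "A x y \<noteq> 0"
  then have ne: "x \<noteq> y" using assms by auto
  have P: "psd_on {x, y} A" using assms psd_on_subset[of S A "{x, y}"] by auto
  have yx: "A y x = cnj (A x y)" using P unfolding psd_on_def by blast
  \<comment> \<open>With \<open>A x x = 0\<close> the form at the vector with entries
    \<open>- t * A x y\<close> and 1 is \<open>A y y\<close> minus 2 t times the squared modulus of
    \<open>A x y\<close>; this \<open>t\<close> makes it exactly -1.\<close>
  define t where "t = (Re (A y y) + 1) / (2 * (cmod (A x y))\<^sup>2)"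
  define v where "v z = (if z = x then - of_real t * A x y else 1)" for z
  have "0 \<le> Re (\<Sum>a\<in>{x,y}. \<Sum>b\<in>{x,y}. cnj (v a) * A a b * v b)"
    using P unfolding psd_on_def by blast
  also have "(\<Sum>a\<in>{x,y}. \<Sum>b\<in>{x,y}. cnj (v a) * A a b * v b) =
     - 2 * of_real t * (A x y * cnj (A x y)) + A y y"
    using ne assms(5) by (simp add: v_def yx algebra_simps)
  also have "Re \<dots> = - 2 * t * (cmod (A x y))\<^sup>2 + Re (A y y)"
    by (simp add: complex_mult_cnj cmod_power2)
  also have "\<dots> = -1" using nz by (simp add: t_def field_simps)
  finally show False by simp
qed

text \<open>Cholesky factorisation: induction on \<open>S\<close> by Schur complements.\<close>

lemma psd_on_gramE:
  assumes "finite S" "psd_on S A"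
  shows "\<exists>w. \<forall>x\<in>S. \<forall>y\<in>S. A x y = (\<Sum>i\<in>S. w i x * cnj (w i y))"
  using assms
proof (induction S arbitrary: A rule: finite_induct)
  case empty
  then show ?case by simp
next
  case (insert s S)
  have fin: "finite (insert s S)" using insert by simp
  have herm: "A y x = cnj (A x y)" if "x \<in> insert s S" "y \<in> insert s S" for x y
    using psd_on_herm[OF insert.prems that] .
  have d: "0 \<le> Re (A s s)" "Im (A s s) = 0"
    using psd_on_diag[OF insert.prems _ fin] by auto
  define a where "a = Re (A s s)"
  have As: "A s s = of_real a" using d by (simp add: a_def complex_eq_iff)
  have a0: "a \<ge> 0" using d by (simp add: a_def)
  \<comment> \<open>Schur complement of the entry at \<open>s\<close>. If that entry is 0, division
    by zero yields 0 and \<open>A'\<close> is just \<open>A\<close>, as it should be because the row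
    of \<open>s\<close> then vanishes.\<close>
  define A' where "A' x y = A x y - A x s * A s y / of_real a" for x y
  have psd': "psd_on S A'"
  proof (cases "a = 0")
    case True
    then have "A' = A" by (simp add: A'_def fun_eq_iff)
    then show ?thesis using psd_on_subset[OF insert.prems _ fin] by auto
  next
    case False
    show ?thesis unfolding psd_on_def
    proof (intro conjI ballI allI)
      fix x y assume "x \<in> S" "y \<in> S"
      then show "A' y x = cnj (A' x y)"
        using herm[of x y] herm[of x s] herm[of s y] by (simp add: A'_def mult.commute)
    next
      fix v :: "'a \<Rightarrow> complex"
      define c where "c = (\<Sum>y\<in>S. A s y * v y)"
      \<comment> \<open>The value at \<open>s\<close> minimises the form in that coordinate;
        completing the square leaves the form of the Schur complement at \<open>v\<close>.\<close>
      define u where "u x = (if x = s then - c / of_real a else v x)" for x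
      have us: "u x = v x" if "x \<in> S" for x using insert.hyps that by (auto simp: u_def)
      have c': "(\<Sum>x\<in>S. cnj (v x) * A x s) = cnj c"
        by (simp add: c_def, rule sum.cong) (auto simp: herm[of s] mult.commute)
      have "(\<Sum>x\<in>insert s S. \<Sum>y\<in>insert s S. cnj (u x) * A x y * u y)
        = cnj (u s) * A s s * u s + cnj (u s) * c + cnj c * u s
          + (\<Sum>x\<in>S. \<Sum>y\<in>S. cnj (v x) * A x y * v y)"
      proof -
        have "(\<Sum>y\<in>S. cnj (u s) * A s y * u y) = cnj (u s) * c"
          by (simp add: c_def sum_distrib_left us mult.assoc)
        moreover have "(\<Sum>x\<in>S. cnj (u x) * A x s * u s) = cnj c * u s"
          by (simp add: c'[symmetric] sum_distrib_right us)
        ultimately show ?thesis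
          using insert.hyps by (simp add: us sum.distrib cong: sum.cong)
      qed
      also have "cnj (u s) * A s s * u s + cnj (u s) * c + cnj c * u s = - (cnj c * c / of_real a)"
        using False by (simp add: u_def As field_simps)
      also have "cnj c * c / of_real a = (\<Sum>x\<in>S. \<Sum>y\<in>S. cnj (v x) * (A x s * A s y / of_real a) * v y)"
        unfolding c'[symmetric] unfolding c_def
        by (simp add: sum_product sum_divide_distrib mult.assoc)
      also have "- (\<Sum>x\<in>S. \<Sum>y\<in>S. cnj (v x) * (A x s * A s y / of_real a) * v y)
          + (\<Sum>x\<in>S. \<Sum>y\<in>S. cnj (v x) * A x y * v y) = (\<Sum>x\<in>S. \<Sum>y\<in>S. cnj (v x) * A' x y * v y)"
        by (simp add: A'_def algebra_simps sum_subtractf)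
      finally show "0 \<le> Re (\<Sum>x\<in>S. \<Sum>y\<in>S. cnj (v x) * A' x y * v y)"
        using psd_on_form[OF insert.prems, of u] by simp
    qed
  qed
  from insert.IH[OF this] obtain w
    where w: "\<forall>x\<in>S. \<forall>y\<in>S. A' x y = (\<Sum>i\<in>S. w i x * cnj (w i y))" by blast
  \<comment> \<open>The new vector is the column of \<open>s\<close> divided by the square root of
    the pivot; the vectors of the complement are extended by 0 at \<open>s\<close>.\<close>
  define w' where "w' i x = (if i = s then A x s / of_real (sqrt a) else if x = s then 0 else w i x)" for i x
  have w's: "(\<Sum>i\<in>S. w' i x * cnj (w' i y)) = (if x = s \<or> y = s then 0 else \<Sum>i\<in>S. w i x * cnj (w i y))"
    for x y using insert.hyps by (auto simp: w'_def intro!: sum.cong sum.neutral)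
  have null: "A x s = 0" "A s x = 0" if "a = 0" "x \<in> insert s S" for x
    using psd_on_null_row[OF insert.prems _ that(2) fin, of s] that herm[of s x] by (auto simp: As)
  have "A x y = (\<Sum>i\<in>insert s S. w' i x * cnj (w' i y))"
    if x: "x \<in> insert s S" and y: "y \<in> insert s S" for x y
  proof -
    have sq: "complex_of_real (sqrt a) * complex_of_real (sqrt a) = of_real a"
      using a0 by (metis of_real_mult real_sqrt_mult_self abs_of_nonneg)
    have "w' s x * cnj (w' s y) = A x s * A s y / of_real a"
      using herm[of s y] herm[of y s] y by (simp add: w'_def sq)
    then have eq: "(\<Sum>i\<in>insert s S. w' i x * cnj (w' i y)) = A x s * A s y / of_real a +
        (if x = s \<or> y = s then 0 else \<Sum>i\<in>S. w i x * cnj (w i y))"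
      using insert.hyps w's by simp
    show ?thesis
    proof (cases "x = s \<or> y = s")
      case True
      then show ?thesis unfolding eq
        using null[of x] null[of y] x y by (cases "a = 0") (auto simp: As)
    next
      case False
      then have "A' x y = (\<Sum>i\<in>S. w i x * cnj (w i y))" using w x y by auto
      then show ?thesis unfolding eq using False by (simp add: A'_def diff_eq_eq)
    qed
  qed
  then show ?case by blast
qed

text \<open>The Gram vectors are composed with \<open>f\<close>, so \<open>f\<close> may identify
  indices, as the restriction \<open>x \<inter> B\<close> does.\<close>

lemma psd_on_pullback:
  assumes "psd_on T A" "finite T" "f ` S \<subseteq> T"
  shows "psd_on S (\<lambda>x y. A (f x) (f y))"
proof -
  obtain w where "\<forall>x\<in>T. \<forall>y\<in>T. A x y = (\<Sum>i\<in>T. w i x * cnj (w i y))"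
    using psd_on_gramE[OF assms(2,1)] by blast
  moreover have "f x \<in> T" if "x \<in> S" for x using assms(3) that by blast
  ultimately show ?thesis
    by (intro psd_on_gramI[OF assms(2), where w = "\<lambda>i x. w i (f x)"]) blast
qed

text \<open>Schur's product theorem: the pointwise products of Gram vectors, indexed by pairs, are
  Gram vectors of the entrywise product.\<close>

lemma psd_on_mult:
  assumes "psd_on S A" "psd_on S B" "finite S"
  shows "psd_on S (\<lambda>x y. A x y * B x y)"
proof -
  obtain w where w: "\<forall>x\<in>S. \<forall>y\<in>S. A x y = (\<Sum>i\<in>S. w i x * cnj (w i y))"
    using psd_on_gramE[OF assms(3,1)] by blast
  obtain u where u: "\<forall>x\<in>S. \<forall>y\<in>S. B x y = (\<Sum>i\<in>S. u i x * cnj (u i y))"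
    using psd_on_gramE[OF assms(3,2)] by blast
  show ?thesis
  proof (rule psd_on_gramI[where I = "S \<times> S" and w = "\<lambda>(i, j) x. w i x * u j x"])
    fix x y assume "x \<in> S" "y \<in> S"
    then have "A x y * B x y = (\<Sum>i\<in>S. \<Sum>j\<in>S. (w i x * cnj (w i y)) * (u j x * cnj (u j y)))"
      using w u by (simp add: sum_product)
    also have "\<dots> = (\<Sum>p\<in>S \<times> S. (case p of (i, j) \<Rightarrow> \<lambda>x. w i x * u j x) x *
        cnj ((case p of (i, j) \<Rightarrow> \<lambda>x. w i x * u j x) y))"
      by (subst sum.cartesian_product, rule sum.cong) auto
    finally show "A x y * B x y = \<dots>" .
  qed (use assms in auto)
qed

lemma psd_on_rank_one: "psd_on S (\<lambda>x y. w x * cnj (w y))"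
  by (rule psd_on_gramI[where I = "{()}" and w = "\<lambda>_. w"]) auto

lemma psd_on_prod:
  assumes "finite S" "\<And>i. i \<in> I \<Longrightarrow> psd_on S (A i)"
  shows "psd_on S (\<lambda>x y. \<Prod>i\<in>I. A i x y)"
  using assms(2)
proof (induction I rule: infinite_finite_induct)
  case (insert i I)
  then show ?case using psd_on_mult[OF _ _ assms(1)] by simp
\<comment> \<open>An empty product, and by convention an infinite one, is the all-ones
  kernel.\<close>
qed (use psd_on_rank_one[of S "\<lambda>_. 1"] in simp_all)

lemma psd_on_add:
  assumes "psd_on S A" "psd_on S B"
  shows "psd_on S (\<lambda>x y. A x y + B x y)"
  unfolding psd_on_def
proof (intro conjI ballI allI)
  fix x y assume "x \<in> S" "y \<in> S"
  then show "A y x + B y x = cnj (A x y + B x y)"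
    using psd_on_herm[OF assms(1)] psd_on_herm[OF assms(2)] by (metis complex_cnj_add)
next
  fix v :: "'a \<Rightarrow> complex"
  have "(\<Sum>x\<in>S. \<Sum>y\<in>S. cnj (v x) * (A x y + B x y) * v y) =
      (\<Sum>x\<in>S. \<Sum>y\<in>S. cnj (v x) * A x y * v y) + (\<Sum>x\<in>S. \<Sum>y\<in>S. cnj (v x) * B x y * v y)"
    by (simp add: algebra_simps sum.distrib)
  then show "0 \<le> Re (\<Sum>x\<in>S. \<Sum>y\<in>S. cnj (v x) * (A x y + B x y) * v y)"
    using psd_on_form[OF assms(1), of v] psd_on_form[OF assms(2), of v] by (simp only: plus_complex.sel)
qed

lemma psd_on_scale:
  assumes "psd_on S A" "c \<ge> 0"
  shows "psd_on S (\<lambda>x y. of_real c * A x y)"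
  unfolding psd_on_def
proof (intro conjI ballI allI)
  fix x y assume "x \<in> S" "y \<in> S"
  then show "of_real c * A y x = cnj (of_real c * A x y)"
    using psd_on_herm[OF assms(1)] by (metis complex_cnj_mult complex_cnj_complex_of_real)
next
  fix v :: "'a \<Rightarrow> complex"
  have "(\<Sum>x\<in>S. \<Sum>y\<in>S. cnj (v x) * (of_real c * A x y) * v y) =
      of_real c * (\<Sum>x\<in>S. \<Sum>y\<in>S. cnj (v x) * A x y * v y)"
    by (simp add: sum_distrib_left mult_ac)
  also have "Re \<dots> = c * Re (\<Sum>x\<in>S. \<Sum>y\<in>S. cnj (v x) * A x y * v y)"
    by (simp only: Re_complex_of_real Im_complex_of_real times_complex.sel)
  also have "\<dots> \<ge> 0" using psd_on_form[OF assms(1), of v] assms(2) by (rule mult_nonneg_nonneg[rotated])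
  finally show "0 \<le> Re (\<Sum>x\<in>S. \<Sum>y\<in>S. cnj (v x) * (of_real c * A x y) * v y)" .
qed

text \<open>Each Gram vector contributes a product of two moduli, which is at most half the sum of
  their squares; summed up, an entry is bounded by the mean of two diagonal entries. Taking the mean
  covers \<open>x = y\<close> as well.\<close>

lemma psd_on_entry_le_trace:
  assumes "psd_on S A" "finite S" "x \<in> S" "y \<in> S"
  shows "cmod (A x y) \<le> Re (\<Sum>z\<in>S. A z z)"
proof -
  obtain w where w: "\<forall>x\<in>S. \<forall>y\<in>S. A x y = (\<Sum>i\<in>S. w i x * cnj (w i y))"
    using psd_on_gramE[OF assms(2,1)] by blast
  have diag: "Re (A z z) = (\<Sum>i\<in>S. (cmod (w i z))\<^sup>2)" if "z \<in> S" for z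
    using w that by (simp add: complex_mult_cnj cmod_power2)
  have le: "Re (A z z) \<le> Re (\<Sum>z\<in>S. A z z)" if "z \<in> S" for z
    using assms that psd_on_diag[OF assms(1) _ assms(2)]
    by (auto simp: Re_sum intro!: member_le_sum)
  have "cmod (A x y) \<le> (\<Sum>i\<in>S. cmod (w i x) * cmod (w i y))"
    using w assms by (auto simp: norm_mult intro!: order.trans[OF norm_sum])
  also have "\<dots> \<le> (\<Sum>i\<in>S. ((cmod (w i x))\<^sup>2 + (cmod (w i y))\<^sup>2) / 2)"
  proof (rule sum_mono)
    fix i
    show "cmod (w i x) * cmod (w i y) \<le> ((cmod (w i x))\<^sup>2 + (cmod (w i y))\<^sup>2) / 2"
      using sum_squares_bound[of "cmod (w i x)" "cmod (w i y)"] by simp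
  qed
  also have "\<dots> = (Re (A x x) + Re (A y y)) / 2"
    using assms diag by (simp add: sum.distrib flip: sum_divide_distrib)
  also have "\<dots> \<le> Re (\<Sum>z\<in>S. A z z)" using le[of x] le[of y] assms by simp
  finally show ?thesis .
qed



section \<open>Entrywise form of the gates\<close>

text \<open>The states without the bound on the trace, which is the right home for the factors of a
  tensor.\<close>

definition psd_mats :: "'q set \<Rightarrow> 'q qmat set" where
  "psd_mats Q = {A \<in> qmats Q. psd_on (Pow Q) A}"

text \<open>The permutation of basis indices effected by negating \<open>q\<close>; membership in an
  index set encodes the bit 1.\<close>

definition flip :: "'q \<Rightarrow> 'q set \<Rightarrow> 'q set" where
  "flip q x = (if q \<in> x then x - {q} else insert q x)"

text \<open>\<open>adjoint_qmat\<close> is compared on all pairs of sets, \<open>psd_on\<close> only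
  on subsets of \<open>Q\<close>; the two agree because entries outside vanish.\<close>

lemma states_iff: "\<rho> \<in> states Q \<longleftrightarrow> \<rho> \<in> psd_mats Q \<and> Re (trace_qmat Q \<rho>) \<le> 1"
proof -
  have "adjoint_qmat \<rho> = \<rho> \<longleftrightarrow> (\<forall>x\<in>Pow Q. \<forall>y\<in>Pow Q. \<rho> y x = cnj (\<rho> x y))" if "\<rho> \<in> qmats Q"
  proof
    assume "adjoint_qmat \<rho> = \<rho>"
    then show "\<forall>x\<in>Pow Q. \<forall>y\<in>Pow Q. \<rho> y x = cnj (\<rho> x y)"
      by (metis adjoint_qmat_def)
  next
    assume a: "\<forall>x\<in>Pow Q. \<forall>y\<in>Pow Q. \<rho> y x = cnj (\<rho> x y)"
    show "adjoint_qmat \<rho> = \<rho>"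
    proof (intro ext)
      fix x y
      show "adjoint_qmat \<rho> x y = \<rho> x y"
      proof (cases "x \<subseteq> Q \<and> y \<subseteq> Q")
        case True
        then have "\<rho> x y = cnj (\<rho> y x)" using a by blast
        then show ?thesis by (simp add: adjoint_qmat_def)
      next
        case False
        then have "\<rho> x y = 0" "\<rho> y x = 0" using that unfolding qmats_def by blast+
        then show ?thesis by (simp add: adjoint_qmat_def)
      qed
    qed
  qed
  then show ?thesis
    unfolding states_def psd_mats_def psd_on_def pos_semidef_def by blast
qed

lemma qmats_outside: "A \<in> qmats Q \<Longrightarrow> \<not> (x \<subseteq> Q \<and> y \<subseteq> Q) \<Longrightarrow> A x y = 0"
  unfolding qmats_def by blast

lemma psd_mats_outside: "A \<in> psd_mats Q \<Longrightarrow> \<not> (x \<subseteq> Q \<and> y \<subseteq> Q) \<Longrightarrow> A x y = 0"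
  unfolding psd_mats_def qmats_def by blast

lemma conj_by_eq_sum:
  "conj_by Q M \<rho> x y = (\<Sum>w\<in>Pow Q. \<Sum>z\<in>Pow Q. M x z * \<rho> z w * cnj (M y w))"
  by (simp add: conj_by_def times_qmat_def adjoint_qmat_def sum_distrib_right)

text \<open>If the vectors \<open>w i\<close> factorise \<open>\<rho>\<close>, then their images
  under \<open>M\<close> factorise the conjugate.\<close>

lemma conj_by_psd:
  assumes "finite Q" "M \<in> qmats Q" "\<rho> \<in> psd_mats Q"
  shows "conj_by Q M \<rho> \<in> psd_mats Q"
proof -
  obtain w where "\<forall>x\<in>Pow Q. \<forall>y\<in>Pow Q. \<rho> x y = (\<Sum>i\<in>Pow Q. w i x * cnj (w i y))"
    using psd_on_gramE[of "Pow Q" \<rho>] assms unfolding psd_mats_def by auto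
  then have w: "\<rho> x y = (\<Sum>i\<in>Pow Q. w i x * cnj (w i y))" if "x \<subseteq> Q" "y \<subseteq> Q" for x y
    using that by blast
  have "psd_on (Pow Q) (conj_by Q M \<rho>)"
  proof (rule psd_on_gramI[where I = "Pow Q" and w = "\<lambda>i x. \<Sum>z\<in>Pow Q. M x z * w i z"])
    fix x y
    have "conj_by Q M \<rho> x y = (\<Sum>z'\<in>Pow Q. \<Sum>z\<in>Pow Q. \<Sum>i\<in>Pow Q. (M x z * w i z) * cnj (M y z' * w i z'))"
      unfolding conj_by_eq_sum
    proof (intro sum.cong refl)
      fix z' z assume "z' \<in> Pow Q" "z \<in> Pow Q"
      then have "\<rho> z z' = (\<Sum>i\<in>Pow Q. w i z * cnj (w i z'))" using w by blast
      then show "M x z * \<rho> z z' * cnj (M y z') = (\<Sum>i\<in>Pow Q. (M x z * w i z) * cnj (M y z' * w i z'))"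
        by (simp only: sum_distrib_left sum_distrib_right complex_cnj_mult mult_ac)
    qed
    also have "\<dots> = (\<Sum>z'\<in>Pow Q. \<Sum>i\<in>Pow Q. \<Sum>z\<in>Pow Q. (M x z * w i z) * cnj (M y z' * w i z'))"
      by (intro sum.cong refl sum.swap)
    also have "\<dots> = (\<Sum>i\<in>Pow Q. \<Sum>z'\<in>Pow Q. \<Sum>z\<in>Pow Q. (M x z * w i z) * cnj (M y z' * w i z'))"
      by (rule sum.swap)
    also have "\<dots> = (\<Sum>i\<in>Pow Q. (\<Sum>z\<in>Pow Q. M x z * w i z) * cnj (\<Sum>z\<in>Pow Q. M y z * w i z))"
      by (simp only: cnj_sum sum_product sum.swap[of "\<lambda>z z'. M x z * w _ z * cnj (M y z' * w _ z')"])
    finally show "conj_by Q M \<rho> x y = \<dots>" .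
  qed (use assms in auto)
  moreover have "conj_by Q M \<rho> \<in> qmats Q"
  proof -
    have "M x z * \<rho> z w * cnj (M y w) = 0" if "\<not> (x \<subseteq> Q \<and> y \<subseteq> Q)" for x y z w
    proof (cases "x \<subseteq> Q")
      case True
      then have "M y w = 0" using that qmats_outside[OF assms(2), of y w] by simp
      then show ?thesis by simp
    next
      case False
      then have "M x z = 0" using qmats_outside[OF assms(2), of x z] by simp
      then show ?thesis by simp
    qed
    then have "conj_by Q M \<rho> x y = 0" if "\<not> (x \<subseteq> Q \<and> y \<subseteq> Q)" for x y
      using that by (simp only: conj_by_eq_sum sum.neutral_const simp_thms)
    then show ?thesis by (simp add: qmats_def)
  qed
  ultimately show ?thesis by (simp add: psd_mats_def)
qed

lemma on1_qmats: "on1 Q M q \<in> qmats Q"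
  by (simp add: on1_def qmats_def)

lemma on2_qmats: "on2 Q M q1 q2 \<in> qmats Q"
  by (simp add: on2_def qmats_def)

text \<open>A row of \<open>on1\<close> is supported on the two indices that agree with
  \<open>x\<close> away from \<open>q\<close>; one of them is \<open>x\<close> itself.\<close>

lemma sum_on1:
  assumes "finite Q" "q \<in> Q" "x \<subseteq> Q"
  shows "(\<Sum>z\<in>Pow Q. on1 Q M q x z * f z) = M $$ (qbit x q, 0) * f (x - {q}) + M $$ (qbit x q, 1) * f (insert q x)"
proof -
  have "(\<Sum>z\<in>Pow Q. on1 Q M q x z * f z) = (\<Sum>z\<in>{x - {q}, insert q x}. on1 Q M q x z * f z)"
  proof (intro sum.mono_neutral_right ballI)
    fix z assume z: "z \<in> Pow Q - {x - {q}, insert q x}"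
    have "z = x - {q} \<or> z = insert q x" if "x - {q} = z - {q}"
      using that by (cases "q \<in> z") blast+
    then show "on1 Q M q x z * f z = 0" using z by (auto simp: on1_def)
  qed (use assms in auto)
  also have "\<dots> = on1 Q M q x (x - {q}) * f (x - {q}) + on1 Q M q x (insert q x) * f (insert q x)"
    by (subst sum.insert) auto
  also have "on1 Q M q x (x - {q}) = M $$ (qbit x q, 0)"
    using assms by (auto simp: on1_def qbit_def)
  also have "on1 Q M q x (insert q x) = M $$ (qbit x q, 1)"
    using assms by (auto simp: on1_def qbit_def)
  finally show ?thesis .
qed

text \<open>The transpose is rebuilt from entries because \<open>M\<close> comes without a dimension
  and \<open>on1\<close> reads only these four entries.\<close>

lemma on1_transpose:
  "on1 Q M q x y = on1 Q (mat 2 2 (\<lambda>(i, j). M $$ (j, i))) q y x"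
  by (auto simp: on1_def qbit_def)

lemma sum_on1_right:
  assumes "finite Q" "q \<in> Q" "y \<subseteq> Q"
  shows "(\<Sum>z\<in>Pow Q. f z * on1 Q M q z y) = f (y - {q}) * M $$ (0, qbit y q) + f (insert q y) * M $$ (1, qbit y q)"
proof -
  have "(\<Sum>z\<in>Pow Q. f z * on1 Q M q z y) =
      (\<Sum>z\<in>Pow Q. on1 Q (mat 2 2 (\<lambda>(i, j). M $$ (j, i))) q y z * f z)"
    by (simp only: on1_transpose[of Q M q _ y] mult.commute)
  also have "\<dots> = f (y - {q}) * M $$ (0, qbit y q) + f (insert q y) * M $$ (1, qbit y q)"
    using assms by (subst sum_on1) (auto simp: qbit_def)
  finally show ?thesis .
qed

lemma times_on1_left:
  assumes "finite Q" "q \<in> Q"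
  shows "times_qmat Q (on1 Q M q) A x y =
    (if x \<subseteq> Q then M $$ (qbit x q, 0) * A (x - {q}) y + M $$ (qbit x q, 1) * A (insert q x) y else 0)"
proof (cases "x \<subseteq> Q")
  case True
  then show ?thesis using assms by (simp add: times_qmat_def sum_on1)
next
  case False
  then show ?thesis by (simp add: times_qmat_def on1_def)
qed

lemma times_on1_right:
  assumes "finite Q" "q \<in> Q"
  shows "times_qmat Q A (on1 Q M q) x y =
    (if y \<subseteq> Q then A x (y - {q}) * M $$ (0, qbit y q) + A x (insert q y) * M $$ (1, qbit y q) else 0)"
proof (cases "y \<subseteq> Q")
  case True
  then show ?thesis using assms by (simp add: times_qmat_def sum_on1_right)
next
  case False
  then show ?thesis by (simp add: times_qmat_def on1_def)
qed

lemma adjoint_on1: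
  "adjoint_qmat (on1 Q M q) = on1 Q (mat 2 2 (\<lambda>(i, j). cnj (M $$ (j, i)))) q"
  by (intro ext) (auto simp: adjoint_qmat_def on1_def qbit_def)

text \<open>All later computations with single-qubit operations start here: the entry at
  \<open>x\<close>, \<open>y\<close> is a two-by-two product involving only the four entries of
  \<open>\<rho>\<close> whose indices agree with \<open>x\<close> and \<open>y\<close> away from
  \<open>q\<close>.\<close>

lemma conj_by_on1:
  assumes "finite Q" "q \<in> Q"
  shows "conj_by Q (on1 Q M q) \<rho> x y =
    (if x \<subseteq> Q \<and> y \<subseteq> Q then
      M $$ (qbit x q, 0) * \<rho> (x - {q}) (y - {q}) * cnj (M $$ (qbit y q, 0)) +
      M $$ (qbit x q, 1) * \<rho> (insert q x) (y - {q}) * cnj (M $$ (qbit y q, 0)) +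
      M $$ (qbit x q, 0) * \<rho> (x - {q}) (insert q y) * cnj (M $$ (qbit y q, 1)) +
      M $$ (qbit x q, 1) * \<rho> (insert q x) (insert q y) * cnj (M $$ (qbit y q, 1)) else 0)"
  using assms
  by (auto simp: conj_by_def adjoint_on1 times_on1_left times_on1_right algebra_simps qbit_def)

lemma P_true_index [simp]:
  "P_true $$ (0, 0) = 1" "P_true $$ (0, Suc 0) = 0" "P_true $$ (Suc 0, 0) = 0" "P_true $$ (Suc 0, Suc 0) = 0"
  by (simp_all add: P_true_def mat_of_rows_list_def)

lemma P_false_index [simp]:
  "P_false $$ (0, 0) = 0" "P_false $$ (0, Suc 0) = 0" "P_false $$ (Suc 0, 0) = 0" "P_false $$ (Suc 0, Suc 0) = 1"
  by (simp_all add: P_false_def mat_of_rows_list_def)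

text \<open>Kept folded, so that square roots enter computations only through the rule for its
  square.\<close>

definition inv_sqrt2 :: complex where
  "inv_sqrt2 = of_real (1 / sqrt 2)"

lemma inv_sqrt2_square: "inv_sqrt2 * inv_sqrt2 = 1 / 2"
  unfolding inv_sqrt2_def by (simp flip: of_real_mult)

lemma cnj_inv_sqrt2 [simp]: "cnj inv_sqrt2 = inv_sqrt2"
  by (simp add: inv_sqrt2_def)

lemma H_mat_index [simp]:
  "H_mat $$ (0, 0) = inv_sqrt2" "H_mat $$ (0, Suc 0) = inv_sqrt2"
  "H_mat $$ (Suc 0, 0) = inv_sqrt2" "H_mat $$ (Suc 0, Suc 0) = - inv_sqrt2"
  by (simp_all add: H_mat_def mat_of_rows_list_def inv_sqrt2_def)

lemma T_mat_index [simp]: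
  "T_mat $$ (0, 0) = 1" "T_mat $$ (0, Suc 0) = 0" "T_mat $$ (Suc 0, 0) = 0"
  "T_mat $$ (Suc 0, Suc 0) = cis (pi / 4)"
  by (simp_all add: T_mat_def mat_of_rows_list_def cis_conv_exp)

lemma pauli_mat_index [simp]:
  "pauli_mat s $$ (0, 0) = (if s = Sigma_z then 1 else 0)"
  "pauli_mat s $$ (0, Suc 0) = (case s of Sigma_x \<Rightarrow> 1 | Sigma_y \<Rightarrow> - \<i> | Sigma_z \<Rightarrow> 0)"
  "pauli_mat s $$ (Suc 0, 0) = (case s of Sigma_x \<Rightarrow> 1 | Sigma_y \<Rightarrow> \<i> | Sigma_z \<Rightarrow> 0)"
  "pauli_mat s $$ (Suc 0, Suc 0) = (if s = Sigma_z then -1 else 0)"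
  by (cases s; simp add: mat_of_rows_list_def)+

declare pauli_mat.simps [simp del]

section \<open>The controlled negation as a permutation of index sets\<close>

definition cnot :: "'q \<Rightarrow> 'q \<Rightarrow> 'q set \<Rightarrow> 'q set" where
  "cnot q1 q2 x = (if q1 \<in> x then flip q2 x else x)"

lemma flip_flip [simp]: "flip q (flip q x) = x"
  by (auto simp: flip_def)

lemma flip_subset [simp]: "q \<in> Q \<Longrightarrow> flip q x \<subseteq> Q \<longleftrightarrow> x \<subseteq> Q"
  by (auto simp: flip_def)

lemma mem_flip: "r \<in> flip q x \<longleftrightarrow> (if r = q then r \<notin> x else r \<in> x)"
  by (auto simp: flip_def)

lemma cnot_cnot [simp]: "q1 \<noteq> q2 \<Longrightarrow> cnot q1 q2 (cnot q1 q2 x) = x"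
  by (auto simp: cnot_def mem_flip)

lemma cnot_subset [simp]: "q2 \<in> Q \<Longrightarrow> cnot q1 q2 x \<subseteq> Q \<longleftrightarrow> x \<subseteq> Q"
  by (auto simp: cnot_def)

lemma mem_cnot: "r \<in> cnot q1 q2 x \<longleftrightarrow> (if r = q2 \<and> q1 \<in> x then r \<notin> x else r \<in> x)"
  by (auto simp: cnot_def mem_flip)

lemma CNot_mat_index:
  "i < 4 \<Longrightarrow> j < 4 \<Longrightarrow> CNot_mat $$ (i, j) =
    (if (if i = 2 then 3 else if i = 3 then 2 else i) = j then 1 else 0)"
proof -
  assume "i < 4" "j < 4"
  then have "i \<in> {0, 1, 2, 3}" "j \<in> {0, 1, 2, 3}" by auto
  then show ?thesis
    by (elim insertE emptyE; simp add: CNot_mat_def mat_of_rows_list_def numeral_2_eq_2 numeral_3_eq_3)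
qed

text \<open>Two bits are read as the number \<open>2 * b1 + b2\<close>, so exchanging 2 and 3 means
  flipping the second bit when the first is 1.\<close>

lemma on2_CNot:
  assumes "q1 \<noteq> q2" "q1 \<in> Q" "q2 \<in> Q"
  shows "on2 Q CNot_mat q1 q2 x y = (if x \<subseteq> Q \<and> y = cnot q1 q2 x then 1 else 0)"
proof -
  have cnot_diff: "cnot q1 q2 x - {q1, q2} = x - {q1, q2}"
    by (auto simp: cnot_def flip_def)
  show ?thesis
  proof (cases "x - {q1, q2} = y - {q1, q2}")
    case False
    then have "y \<noteq> cnot q1 q2 x" using cnot_diff by metis
    then show ?thesis using False by (simp add: on2_def)
  next
    case True
    have sub: "y \<subseteq> Q \<longleftrightarrow> x \<subseteq> Q" using True assms by blast
    \<comment> \<open>The two sets agree away from \<open>q1\<close> and \<open>q2\<close>, so two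
      bits decide their equality.\<close>
    have "y = cnot q1 q2 x \<longleftrightarrow> (q1 \<in> y \<longleftrightarrow> q1 \<in> cnot q1 q2 x) \<and> (q2 \<in> y \<longleftrightarrow> q2 \<in> cnot q1 q2 x)"
      using cnot_diff True by blast
    moreover have "q1 \<in> cnot q1 q2 x \<longleftrightarrow> q1 \<in> x" "q2 \<in> cnot q1 q2 x \<longleftrightarrow> (q1 \<in> x) \<noteq> (q2 \<in> x)"
      using assms(1) by (auto simp: cnot_def mem_flip)
    ultimately have eq: "y = cnot q1 q2 x \<longleftrightarrow> (q1 \<in> y \<longleftrightarrow> q1 \<in> x) \<and> (q2 \<in> y \<longleftrightarrow> (q1 \<in> x) \<noteq> (q2 \<in> x))"
      by simp
    have *: "2 * qbit z q1 + qbit z q2 < 4" for z by (simp add: qbit_def)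
    have "on2 Q CNot_mat q1 q2 x y =
        (if x \<subseteq> Q then CNot_mat $$ (2 * qbit x q1 + qbit x q2, 2 * qbit y q1 + qbit y q2) else 0)"
      using True sub by (simp add: on2_def)
    then show ?thesis
      unfolding CNot_mat_index[OF * *] eq by (auto simp: qbit_def)
  qed
qed

lemma sum_on2_CNot:
  assumes "finite Q" "q1 \<noteq> q2" "q1 \<in> Q" "q2 \<in> Q"
  shows "(\<Sum>z\<in>Pow Q. on2 Q CNot_mat q1 q2 x z * f z) = (if x \<subseteq> Q then f (cnot q1 q2 x) else 0)"
proof -
  have "(\<Sum>z\<in>Pow Q. on2 Q CNot_mat q1 q2 x z * f z) =
      (\<Sum>z\<in>Pow Q. if z = cnot q1 q2 x then (if x \<subseteq> Q then f z else 0) else 0)"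
    using assms by (intro sum.cong refl) (simp add: on2_CNot)
  then show ?thesis using assms by (simp add: sum.delta)
qed

lemma conj_by_CNot:
  assumes "finite Q" "q1 \<noteq> q2" "q1 \<in> Q" "q2 \<in> Q"
  shows "conj_by Q (on2 Q CNot_mat q1 q2) \<rho> x y =
    (if x \<subseteq> Q \<and> y \<subseteq> Q then \<rho> (cnot q1 q2 x) (cnot q1 q2 y) else 0)"
proof -
  have "cnj (on2 Q CNot_mat q1 q2 y w) = on2 Q CNot_mat q1 q2 y w" for w
    using assms by (simp add: on2_CNot)
  then have "conj_by Q (on2 Q CNot_mat q1 q2) \<rho> x y =
    (\<Sum>w\<in>Pow Q. on2 Q CNot_mat q1 q2 y w * (\<Sum>z\<in>Pow Q. on2 Q CNot_mat q1 q2 x z * \<rho> z w))"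
    by (simp add: conj_by_eq_sum sum_distrib_left mult_ac)
  then show ?thesis by (simp only: sum_on2_CNot[OF assms]) simp
qed

lemma in_standard_basis_iff:
  assumes "finite Q" "q \<in> Q"
  shows "in_standard_basis Q q \<rho> \<longleftrightarrow> (\<forall>x\<subseteq>Q. \<forall>y\<subseteq>Q. (q \<in> x) \<noteq> (q \<in> y) \<longrightarrow> \<rho> x y = 0)"
  (is "_ \<longleftrightarrow> ?R")
proof -
  have tf: "times_qmat Q (times_qmat Q (on1 Q P_true q) \<rho>) (on1 Q P_false q) x y = 0 \<longleftrightarrow>
      (x \<subseteq> Q \<and> y \<subseteq> Q \<and> q \<notin> x \<and> q \<in> y \<longrightarrow> \<rho> x y = 0)"
    and ft: "times_qmat Q (times_qmat Q (on1 Q P_false q) \<rho>) (on1 Q P_true q) x y = 0 \<longleftrightarrow>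
      (x \<subseteq> Q \<and> y \<subseteq> Q \<and> q \<in> x \<and> q \<notin> y \<longrightarrow> \<rho> x y = 0)" for x y
    using assms by (auto simp: times_on1_left times_on1_right qbit_def insert_absorb)
  show ?thesis
    unfolding in_standard_basis_def zero_qmat_def fun_eq_iff tf ft by blast
qed

text \<open>On a block with rows (a, b) and (c, d), conjugation by H makes the off-diagonal entries
  half of a - b + c - d and of a + b - c - d. Both vanish iff a = d and b = c, as their sum and
  difference show, and this is invariance under the simultaneous flip.\<close>

lemma in_diagonal_basis_iff:
  assumes "finite Q" "q \<in> Q"
  shows "in_diagonal_basis Q q \<rho> \<longleftrightarrow> (\<forall>x\<subseteq>Q. \<forall>y\<subseteq>Q. \<rho> (flip q x) (flip q y) = \<rho> x y)"
    (is "_ \<longleftrightarrow> ?R")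
proof -
  define \<rho>' where "\<rho>' = times_qmat Q (times_qmat Q (on1 Q H_mat q) \<rho>) (on1 Q H_mat q)"
  have \<rho>': "\<rho>' x y = 1 / 2 * (\<rho> (x - {q}) (y - {q})
      + (if q \<in> y then -1 else 1) * \<rho> (x - {q}) (insert q y)
      + (if q \<in> x then -1 else 1) * \<rho> (insert q x) (y - {q})
      + (if (q \<in> x) = (q \<in> y) then 1 else -1) * \<rho> (insert q x) (insert q y))" if "x \<subseteq> Q" "y \<subseteq> Q" for x y
    using assms that by (auto simp: \<rho>'_def times_on1_left times_on1_right qbit_def algebra_simps inv_sqrt2_square[symmetric])
  show ?thesis
  proof
    assume "in_diagonal_basis Q q \<rho>"
    then have z: "\<rho>' x y = 0" if "x \<subseteq> Q" "y \<subseteq> Q" "(q \<in> x) \<noteq> (q \<in> y)" for x y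
      using that unfolding in_diagonal_basis_def \<rho>'_def[symmetric] in_standard_basis_iff[OF assms] by blast
    have key: "\<rho> (insert q x) (insert q y) = \<rho> (x - {q}) (y - {q}) \<and> \<rho> (insert q x) (y - {q}) = \<rho> (x - {q}) (insert q y)"
      if "x \<subseteq> Q" "y \<subseteq> Q" for x y
    proof -
      have sub: "insert q x \<subseteq> Q" "x - {q} \<subseteq> Q" "insert q y \<subseteq> Q" "y - {q} \<subseteq> Q" using that assms by auto
      have e1: "\<rho> (x - {q}) (y - {q}) + \<rho> (x - {q}) (insert q y) - \<rho> (insert q x) (y - {q}) - \<rho> (insert q x) (insert q y) = 0"
        using z[OF sub(1,4)] \<rho>'[OF sub(1,4)] by (simp add: insert_Diff_if)
      have e2: "\<rho> (x - {q}) (y - {q}) - \<rho> (x - {q}) (insert q y) + \<rho> (insert q x) (y - {q}) - \<rho> (insert q x) (insert q y) = 0"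
        using z[OF sub(2,3)] \<rho>'[OF sub(2,3)] by (simp add: insert_Diff_if)
      let ?a = "\<rho> (x - {q}) (y - {q})" let ?b = "\<rho> (x - {q}) (insert q y)"
      let ?c = "\<rho> (insert q x) (y - {q})" let ?d = "\<rho> (insert q x) (insert q y)"
      have "2 * (?a - ?d) = (?a + ?b - ?c - ?d) + (?a - ?b + ?c - ?d)"
        "2 * (?b - ?c) = (?a + ?b - ?c - ?d) - (?a - ?b + ?c - ?d)" by (simp_all add: algebra_simps)
      then have "?a - ?d = 0" "?b - ?c = 0" unfolding e1 e2 by simp_all
      then show ?thesis by simp
    qed
    show ?R
    proof (intro allI impI)
      fix x y assume "x \<subseteq> Q" "y \<subseteq> Q"
      from key[OF this] show "\<rho> (flip q x) (flip q y) = \<rho> x y"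
        by (auto simp: flip_def insert_absorb)
    qed
  next
    assume R: ?R
    have "\<rho>' x y = 0" if "x \<subseteq> Q" "y \<subseteq> Q" "(q \<in> x) \<noteq> (q \<in> y)" for x y
    proof -
      have "\<rho> (flip q x) (flip q y) = \<rho> x y" using R that by blast
      moreover have "\<rho> (flip q x) y = \<rho> x (flip q y)"
        using R[rule_format, of x "flip q y"] that assms(2) by simp
      ultimately show ?thesis
        using that by (auto simp: \<rho>' flip_def insert_absorb)
    qed
    then show "in_diagonal_basis Q q \<rho>"
      unfolding in_diagonal_basis_def \<rho>'_def[symmetric] in_standard_basis_iff[OF assms] by blast
  qed
qed



section \<open>Bases of the qubits under the gates\<close>

definition std :: "'q set \<Rightarrow> 'q \<Rightarrow> 'q qmat \<Rightarrow> bool" where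
  "std Q q \<rho> \<longleftrightarrow> (\<forall>x\<subseteq>Q. \<forall>y\<subseteq>Q. (q \<in> x) \<noteq> (q \<in> y) \<longrightarrow> \<rho> x y = 0)"

definition diag :: "'q set \<Rightarrow> 'q \<Rightarrow> 'q qmat \<Rightarrow> bool" where
  "diag Q q \<rho> \<longleftrightarrow> (\<forall>x\<subseteq>Q. \<forall>y\<subseteq>Q. \<rho> (flip q x) (flip q y) = \<rho> x y)"

lemma stdD: "std Q q \<rho> \<Longrightarrow> x \<subseteq> Q \<Longrightarrow> y \<subseteq> Q \<Longrightarrow> (q \<in> x) \<noteq> (q \<in> y) \<Longrightarrow> \<rho> x y = 0"
  unfolding std_def by blast

lemma diagD: "diag Q q \<rho> \<Longrightarrow> x \<subseteq> Q \<Longrightarrow> y \<subseteq> Q \<Longrightarrow> \<rho> (flip q x) (flip q y) = \<rho> x y"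
  unfolding diag_def by blast

text \<open>The lattice is the powerset of the two demands "standard" and "diagonal" under reversed
  inclusion: the bottom demands both, the top neither.\<close>

lemma beta_le_iff:
  assumes "finite Q" "q \<in> Q"
  shows "\<beta> Q \<rho> q \<le> b \<longleftrightarrow>
    (b = Std \<or> b = Bot_b \<longrightarrow> std Q q \<rho>) \<and> (b = Diag \<or> b = Bot_b \<longrightarrow> diag Q q \<rho>)"
  using in_standard_basis_iff[OF assms, of \<rho>] in_diagonal_basis_iff[OF assms, of \<rho>]
  unfolding std_def[symmetric] diag_def[symmetric]
  by (cases b) (auto simp: \<beta>_def less_eq_basis_def)

lemma std_conj_by_on1_other:
  assumes "finite Q" "q \<in> Q" "r \<noteq> q" "std Q r \<rho>"
  shows "std Q r (conj_by Q (on1 Q M q) \<rho>)"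
  unfolding std_def
proof (intro allI impI)
  fix x y assume xy: "x \<subseteq> Q" "y \<subseteq> Q" "(r \<in> x) \<noteq> (r \<in> y)"
  then have sub: "insert q x \<subseteq> Q" "x - {q} \<subseteq> Q" "insert q y \<subseteq> Q" "y - {q} \<subseteq> Q" using assms by auto
  have "\<rho> (x - {q}) (y - {q}) = 0" "\<rho> (insert q x) (y - {q}) = 0"
    "\<rho> (x - {q}) (insert q y) = 0" "\<rho> (insert q x) (insert q y) = 0"
    using sub xy assms(3) by (auto intro!: stdD[OF assms(4)])
  then show "conj_by Q (on1 Q M q) \<rho> x y = 0"
    by (simp add: conj_by_on1[OF assms(1,2)])
qed

lemma diag_conj_by_on1_other:
  assumes "finite Q" "q \<in> Q" "r \<in> Q" "r \<noteq> q" "diag Q r \<rho>"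
  shows "diag Q r (conj_by Q (on1 Q M q) \<rho>)"
  unfolding diag_def
proof (intro allI impI)
  fix x y assume xy: "x \<subseteq> Q" "y \<subseteq> Q"
  then have sub: "insert q x \<subseteq> Q" "x - {q} \<subseteq> Q" "insert q y \<subseteq> Q" "y - {q} \<subseteq> Q" using assms by auto
  have f: "flip r z - {q} = flip r (z - {q})" "insert q (flip r z) = flip r (insert q z)"
    "qbit (flip r z) q = qbit z q" for z
    using assms(4) by (auto simp: flip_def qbit_def)
  show "conj_by Q (on1 Q M q) \<rho> (flip r x) (flip r y) = conj_by Q (on1 Q M q) \<rho> x y"
    unfolding conj_by_on1[OF assms(1,2)] f
    using xy sub assms(3) by (simp add: diagD[OF assms(5)])
qed

text \<open>The first disjunct covers T and sigma_z, the second sigma_x and sigma_y. In both, an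
  entry whose indices differ at \<open>q\<close> draws only on such entries.\<close>

lemma std_conj_by_on1_diagonal:
  assumes "finite Q" "q \<in> Q" "std Q q \<rho>"
    and "M $$ (0, 1) = 0 \<and> M $$ (1, 0) = 0 \<or> M $$ (0, 0) = 0 \<and> M $$ (1, 1) = 0"
  shows "std Q q (conj_by Q (on1 Q M q) \<rho>)"
  unfolding std_def
proof (intro allI impI)
  fix x y assume xy: "x \<subseteq> Q" "y \<subseteq> Q" "(q \<in> x) \<noteq> (q \<in> y)"
  then have sub: "insert q x \<subseteq> Q" "x - {q} \<subseteq> Q" "insert q y \<subseteq> Q" "y - {q} \<subseteq> Q" using assms by auto
  have "\<rho> (insert q x) (y - {q}) = 0" "\<rho> (x - {q}) (insert q y) = 0"
    using sub xy by (auto intro!: stdD[OF assms(3)])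
  then show "conj_by Q (on1 Q M q) \<rho> x y = 0"
    using assms(4) xy by (auto simp: conj_by_on1[OF assms(1,2)] qbit_def)
qed

lemma std_conj_by_H:
  assumes "finite Q" "q \<in> Q" "diag Q q \<rho>"
  shows "std Q q (conj_by Q (on1 Q H_mat q) \<rho>)"
  unfolding std_def
proof (intro allI impI)
  fix x y assume xy: "x \<subseteq> Q" "y \<subseteq> Q" "(q \<in> x) \<noteq> (q \<in> y)"
  then have sub: "insert q x \<subseteq> Q" "x - {q} \<subseteq> Q" "insert q y \<subseteq> Q" "y - {q} \<subseteq> Q" using assms by auto
  have "\<rho> (insert q x) (insert q y) = \<rho> (x - {q}) (y - {q})"
    using diagD[OF assms(3) sub(2,4)] by (simp add: flip_def)
  moreover have "\<rho> (insert q x) (y - {q}) = \<rho> (x - {q}) (insert q y)"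
    using diagD[OF assms(3) sub(2,3)] by (simp add: flip_def)
  ultimately show "conj_by Q (on1 Q H_mat q) \<rho> x y = 0"
    using xy by (auto simp: conj_by_on1[OF assms(1,2)] qbit_def)
qed

lemma diag_conj_by_H:
  assumes "finite Q" "q \<in> Q" "std Q q \<rho>"
  shows "diag Q q (conj_by Q (on1 Q H_mat q) \<rho>)"
  unfolding diag_def
proof (intro allI impI)
  fix x y assume xy: "x \<subseteq> Q" "y \<subseteq> Q"
  then have sub: "insert q x \<subseteq> Q" "x - {q} \<subseteq> Q" "insert q y \<subseteq> Q" "y - {q} \<subseteq> Q" using assms by auto
  have z: "\<rho> (insert q x) (y - {q}) = 0" "\<rho> (x - {q}) (insert q y) = 0"
    using sub by (auto intro!: stdD[OF assms(3)])
  have f: "flip q z - {q} = z - {q}" "insert q (flip q z) = insert q z" for z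
    by (auto simp: flip_def)
  show "conj_by Q (on1 Q H_mat q) \<rho> (flip q x) (flip q y) = conj_by Q (on1 Q H_mat q) \<rho> x y"
    unfolding conj_by_on1[OF assms(1,2)] f z using assms(2) xy
    by (cases "q \<in> x"; cases "q \<in> y"; simp add: qbit_def mem_flip)
qed

text \<open>A flip-invariant block has rows (a, b) and (b, a); a Pauli conjugation changes at most
  the sign of b.\<close>

lemma diag_conj_by_pauli:
  assumes "finite Q" "q \<in> Q" "diag Q q \<rho>"
  shows "diag Q q (conj_by Q (on1 Q (pauli_mat s) q) \<rho>)"
  unfolding diag_def
proof (intro allI impI)
  fix x y assume xy: "x \<subseteq> Q" "y \<subseteq> Q"
  then have sub: "insert q x \<subseteq> Q" "x - {q} \<subseteq> Q" "insert q y \<subseteq> Q" "y - {q} \<subseteq> Q" using assms by auto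
  have z: "\<rho> (insert q x) (insert q y) = \<rho> (x - {q}) (y - {q})"
    using diagD[OF assms(3) sub(2,4)] by (simp add: flip_def)
  have z': "\<rho> (insert q x) (y - {q}) = \<rho> (x - {q}) (insert q y)"
    using diagD[OF assms(3) sub(2,3)] by (simp add: flip_def)
  have f: "flip q z - {q} = z - {q}" "insert q (flip q z) = insert q z" for z
    by (auto simp: flip_def)
  show "conj_by Q (on1 Q (pauli_mat s) q) \<rho> (flip q x) (flip q y) = conj_by Q (on1 Q (pauli_mat s) q) \<rho> x y"
    unfolding conj_by_on1[OF assms(1,2)] f z z' using assms(2) xy
    by (cases s; cases "q \<in> x"; cases "q \<in> y"; simp add: qbit_def mem_flip)
qed

lemma std_conj_by_projection:
  assumes "finite Q" "q \<in> Q" "M = P_true \<or> M = P_false"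
  shows "std Q q (conj_by Q (on1 Q M q) \<rho>)"
  using assms(3) by (auto simp: std_def conj_by_on1[OF assms(1,2)] qbit_def)

text \<open>Reconciles the plain products in the semantics of the conditional with
  \<open>conj_by\<close>, which has an adjoint on the right.\<close>

lemma adjoint_P:
  assumes "M = P_true \<or> M = P_false"
  shows "adjoint_qmat (on1 Q M q) = on1 Q M q"
proof -
  have "mat 2 2 (\<lambda>(i, j). cnj (M $$ (j, i))) $$ (qbit x q, qbit y q) = M $$ (qbit x q, qbit y q)" for x y
    using assms by (auto simp: qbit_def)
  then show ?thesis unfolding adjoint_on1 unfolding on1_def by (simp only: cong: if_cong)
qed

section \<open>Bases of control, target and other qubits under the controlled negation\<close>

lemma std_conj_by_CNot_control:
  assumes "finite Q" "q1 \<noteq> q2" "q1 \<in> Q" "q2 \<in> Q" "std Q q1 \<rho>"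
  shows "std Q q1 (conj_by Q (on2 Q CNot_mat q1 q2) \<rho>)"
  unfolding std_def conj_by_CNot[OF assms(1-4)] using assms(2,4)
  by (simp add: stdD[OF assms(5)] mem_cnot)

text \<open>The new target bit is the exclusive or of both old bits, so indices that differ in it
  come from indices that differ at the control or at the target.\<close>

lemma std_conj_by_CNot_target:
  assumes "finite Q" "q1 \<noteq> q2" "q1 \<in> Q" "q2 \<in> Q" "std Q q1 \<rho>" "std Q q2 \<rho>"
  shows "std Q q2 (conj_by Q (on2 Q CNot_mat q1 q2) \<rho>)"
  unfolding std_def conj_by_CNot[OF assms(1-4)]
proof (intro allI impI)
  fix x y assume xy: "x \<subseteq> Q" "y \<subseteq> Q" "(q2 \<in> x) \<noteq> (q2 \<in> y)"
  then have sub: "cnot q1 q2 x \<subseteq> Q" "cnot q1 q2 y \<subseteq> Q" using assms(4) by auto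
  have "(q1 \<in> cnot q1 q2 x) \<noteq> (q1 \<in> cnot q1 q2 y) \<or> (q2 \<in> cnot q1 q2 x) \<noteq> (q2 \<in> cnot q1 q2 y)"
    using xy(3) assms(2) by (auto simp: cnot_def mem_flip)
  then have "\<rho> (cnot q1 q2 x) (cnot q1 q2 y) = 0"
    using stdD[OF assms(5) sub] stdD[OF assms(6) sub] by blast
  then show "(if x \<subseteq> Q \<and> y \<subseteq> Q then \<rho> (cnot q1 q2 x) (cnot q1 q2 y) else 0) = 0" by simp
qed

lemma cnot_flip_target: "q1 \<noteq> q2 \<Longrightarrow> cnot q1 q2 (flip q2 x) = flip q2 (cnot q1 q2 x)"
  by (auto simp: cnot_def mem_flip)

text \<open>A negation of the control propagates to the target, which is why keeping the control
  diagonal asks for a diagonal target too.\<close>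

lemma cnot_flip_control: "q1 \<noteq> q2 \<Longrightarrow> cnot q1 q2 (flip q1 x) = flip q2 (flip q1 (cnot q1 q2 x))"
  by (auto simp: cnot_def flip_def)

lemma cnot_flip_other: "r \<noteq> q1 \<Longrightarrow> r \<noteq> q2 \<Longrightarrow> cnot q1 q2 (flip r x) = flip r (cnot q1 q2 x)"
  by (auto simp: cnot_def flip_def)

lemma diag_conj_by_CNot_target:
  assumes "finite Q" "q1 \<noteq> q2" "q1 \<in> Q" "q2 \<in> Q" "diag Q q2 \<rho>"
  shows "diag Q q2 (conj_by Q (on2 Q CNot_mat q1 q2) \<rho>)"
  unfolding diag_def conj_by_CNot[OF assms(1-4)] using assms(2,4)
  by (simp add: cnot_flip_target diagD[OF assms(5)])

lemma diag_conj_by_CNot_control: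
  assumes "finite Q" "q1 \<noteq> q2" "q1 \<in> Q" "q2 \<in> Q" "diag Q q1 \<rho>" "diag Q q2 \<rho>"
  shows "diag Q q1 (conj_by Q (on2 Q CNot_mat q1 q2) \<rho>)"
  unfolding diag_def conj_by_CNot[OF assms(1-4)] using assms(2-4)
  by (simp add: cnot_flip_control diagD[OF assms(5)] diagD[OF assms(6)])

lemma std_conj_by_CNot_other:
  assumes "finite Q" "q1 \<noteq> q2" "q1 \<in> Q" "q2 \<in> Q" "r \<noteq> q1" "r \<noteq> q2" "std Q r \<rho>"
  shows "std Q r (conj_by Q (on2 Q CNot_mat q1 q2) \<rho>)"
  unfolding std_def conj_by_CNot[OF assms(1-4)] using assms(4-6)
  by (simp add: stdD[OF assms(7)] mem_cnot)

lemma diag_conj_by_CNot_other: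
  assumes "finite Q" "q1 \<noteq> q2" "q1 \<in> Q" "q2 \<in> Q" "r \<in> Q" "r \<noteq> q1" "r \<noteq> q2" "diag Q r \<rho>"
  shows "diag Q r (conj_by Q (on2 Q CNot_mat q1 q2) \<rho>)"
  unfolding diag_def conj_by_CNot[OF assms(1-4)] using assms(4-7)
  by (simp add: cnot_flip_other diagD[OF assms(8)])

section \<open>Traces\<close>

lemma sum_Pow_split:
  assumes "finite Q" "q \<in> Q"
  shows "(\<Sum>x\<in>Pow Q. f x) = (\<Sum>x\<in>Pow (Q - {q}). f x + f (insert q x))"
proof -
  have "Pow Q = Pow (Q - {q}) \<union> insert q ` Pow (Q - {q})"
    using assms(2) by (metis Pow_insert insert_Diff)
  moreover have "(\<Sum>x\<in>insert q ` Pow (Q - {q}). f x) = (\<Sum>x\<in>Pow (Q - {q}). f (insert q x))"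
    by (subst sum.reindex) (auto simp: inj_on_def)
  moreover have "Pow (Q - {q}) \<inter> insert q ` Pow (Q - {q}) = {}" by auto
  ultimately show ?thesis
    using assms(1) by (simp add: sum.union_disjoint sum.distrib)
qed

text \<open>The three equations say that the columns of \<open>M\<close> are orthonormal. Pairing
  the diagonal entries at \<open>x\<close> and \<open>insert q x\<close> turns the trace into traces
  of two-by-two blocks.\<close>

lemma trace_conj_by_on1:
  assumes "finite Q" "q \<in> Q"
    and M: "M $$ (0, 0) * cnj (M $$ (0, 0)) + M $$ (1, 0) * cnj (M $$ (1, 0)) = 1"
      "M $$ (0, 1) * cnj (M $$ (0, 1)) + M $$ (1, 1) * cnj (M $$ (1, 1)) = 1"
      "M $$ (0, 0) * cnj (M $$ (0, 1)) + M $$ (1, 0) * cnj (M $$ (1, 1)) = 0"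
  shows "trace_qmat Q (conj_by Q (on1 Q M q) \<rho>) = trace_qmat Q \<rho>"
proof -
  have M': "M $$ (0, 1) * cnj (M $$ (0, 0)) + M $$ (1, 1) * cnj (M $$ (1, 0)) = 0"
    using arg_cong[OF M(3), of cnj] by (simp add: mult.commute)
  have "conj_by Q (on1 Q M q) \<rho> x x + conj_by Q (on1 Q M q) \<rho> (insert q x) (insert q x) =
      \<rho> x x + \<rho> (insert q x) (insert q x)" if "x \<subseteq> Q - {q}" for x
  proof -
    have x: "x \<subseteq> Q" "q \<notin> x" "insert q x \<subseteq> Q" "x - {q} = x" using that assms by auto
    let ?a = "\<rho> x x" let ?b = "\<rho> (insert q x) x" let ?c = "\<rho> x (insert q x)" let ?d = "\<rho> (insert q x) (insert q x)"
    have "conj_by Q (on1 Q M q) \<rho> x x + conj_by Q (on1 Q M q) \<rho> (insert q x) (insert q x) =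
      ?a * (M $$ (0, 0) * cnj (M $$ (0, 0)) + M $$ (1, 0) * cnj (M $$ (1, 0))) +
      ?b * (M $$ (0, 1) * cnj (M $$ (0, 0)) + M $$ (1, 1) * cnj (M $$ (1, 0))) +
      ?c * (M $$ (0, 0) * cnj (M $$ (0, 1)) + M $$ (1, 0) * cnj (M $$ (1, 1))) +
      ?d * (M $$ (0, 1) * cnj (M $$ (0, 1)) + M $$ (1, 1) * cnj (M $$ (1, 1)))"
      using x by (simp add: conj_by_on1[OF assms(1,2)] qbit_def algebra_simps)
    then show ?thesis unfolding M M' by simp
  qed
  then show ?thesis
    unfolding trace_qmat_def sum_Pow_split[OF assms(1,2)] by (intro sum.cong) auto
qed

lemma trace_conj_by_H:
  "finite Q \<Longrightarrow> q \<in> Q \<Longrightarrow> trace_qmat Q (conj_by Q (on1 Q H_mat q) \<rho>) = trace_qmat Q \<rho>"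
  by (rule trace_conj_by_on1) (simp_all add: inv_sqrt2_square)

lemma trace_conj_by_T:
  "finite Q \<Longrightarrow> q \<in> Q \<Longrightarrow> trace_qmat Q (conj_by Q (on1 Q T_mat q) \<rho>) = trace_qmat Q \<rho>"
  by (rule trace_conj_by_on1) (simp_all add: cis_cnj cis_mult)

lemma trace_conj_by_pauli:
  "finite Q \<Longrightarrow> q \<in> Q \<Longrightarrow> trace_qmat Q (conj_by Q (on1 Q (pauli_mat s) q) \<rho>) = trace_qmat Q \<rho>"
  by (rule trace_conj_by_on1; cases s; simp)

lemma trace_conj_by_CNot:
  assumes "finite Q" "q1 \<noteq> q2" "q1 \<in> Q" "q2 \<in> Q"
  shows "trace_qmat Q (conj_by Q (on2 Q CNot_mat q1 q2) \<rho>) = trace_qmat Q \<rho>"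
proof -
  have "bij_betw (cnot q1 q2) (Pow Q) (Pow Q)"
    using assms by (intro bij_betw_byWitness[where f' = "cnot q1 q2"]) (simp_all add: image_subset_iff)
  then have "(\<Sum>x\<in>Pow Q. \<rho> (cnot q1 q2 x) (cnot q1 q2 x)) = (\<Sum>x\<in>Pow Q. \<rho> x x)"
    by (rule sum.reindex_bij_betw)
  then show ?thesis by (simp add: trace_qmat_def conj_by_CNot[OF assms])
qed

text \<open>Each diagonal entry survives exactly one of the two projections.\<close>

lemma trace_projections:
  assumes "finite Q" "q \<in> Q"
  shows "trace_qmat Q (conj_by Q (on1 Q P_true q) \<rho>) + trace_qmat Q (conj_by Q (on1 Q P_false q) \<rho>)
    = trace_qmat Q \<rho>"
  unfolding trace_qmat_def sum.distrib[symmetric]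
  using assms by (intro sum.cong) (auto simp: conj_by_on1 qbit_def insert_absorb)



section \<open>The cone of separable matrices\<close>

text \<open>Only the cone matters: traces of the factors can be shifted into the weights.\<close>

inductive sep_cone :: "'q set \<Rightarrow> 'q set set \<Rightarrow> 'q qmat \<Rightarrow> bool" for Q \<pi> where
  zero: "sep_cone Q \<pi> (\<lambda>x y. 0)"
| add_tensor: "sep_cone Q \<pi> A \<Longrightarrow> 0 \<le> c \<Longrightarrow> (\<And>B. B \<in> \<pi> \<Longrightarrow> r B \<in> psd_mats B) \<Longrightarrow>
    sep_cone Q \<pi> (\<lambda>x y. A x y + complex_of_real c * tensor Q \<pi> r x y)"

lemma sep_cone_tensor:
  assumes "\<And>B. B \<in> \<pi> \<Longrightarrow> r B \<in> psd_mats B"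
  shows "sep_cone Q \<pi> (tensor Q \<pi> r)"
  using sep_cone.add_tensor[OF sep_cone.zero, of 1 \<pi> r Q] assms by simp

lemma sep_cone_add:
  assumes "sep_cone Q \<pi> A" "sep_cone Q \<pi> B"
  shows "sep_cone Q \<pi> (\<lambda>x y. A x y + B x y)"
  using assms(2)
proof induction
  case zero
  then show ?case using assms(1) by simp
next
  case (add_tensor B c r)
  then show ?case
    using sep_cone.add_tensor[of Q \<pi> "\<lambda>x y. A x y + B x y" c r] by (simp add: add.assoc)
qed

lemma sep_cone_scale:
  assumes "sep_cone Q \<pi> A" "0 \<le> c"
  shows "sep_cone Q \<pi> (\<lambda>x y. complex_of_real c * A x y)"
  using assms(1)
proof induction
  case zero
  then show ?case using sep_cone.zero by simp
next
  case (add_tensor A d r)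
  then show ?case
    using sep_cone.add_tensor[of Q \<pi> "\<lambda>x y. complex_of_real c * A x y" "c * d" r] assms(2)
    by (simp add: algebra_simps)
qed

text \<open>A linear map need only be checked on products of blocks. The target partition may
  differ, as it does for measurements and for coarsening.\<close>

lemma sep_cone_map:
  assumes "sep_cone Q \<pi> A"
    and "\<Phi> (\<lambda>x y. 0) = (\<lambda>x y. 0)"
    and "\<And>A B c. \<Phi> (\<lambda>x y. A x y + c * B x y) = (\<lambda>x y. \<Phi> A x y + c * \<Phi> B x y)"
    and "\<And>r. (\<And>B. B \<in> \<pi> \<Longrightarrow> r B \<in> psd_mats B) \<Longrightarrow> sep_cone Q \<pi>' (\<Phi> (tensor Q \<pi> r))"
  shows "sep_cone Q \<pi>' (\<Phi> A)"
  using assms(1)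
proof induction
  case zero
  then show ?case using sep_cone.zero assms(2) by simp
next
  case (add_tensor A c r)
  then show ?case
    unfolding assms(3) using sep_cone_add sep_cone_scale assms(4) by blast
qed

lemma sep_cone_conj_by:
  assumes "sep_cone Q \<pi> A"
    and "\<And>r. (\<And>B. B \<in> \<pi> \<Longrightarrow> r B \<in> psd_mats B) \<Longrightarrow> sep_cone Q \<pi>' (conj_by Q M (tensor Q \<pi> r))"
  shows "sep_cone Q \<pi>' (conj_by Q M A)"
proof (rule sep_cone_map[OF assms(1)])
  show "conj_by Q M (\<lambda>x y. 0) = (\<lambda>x y. 0)" by (simp add: conj_by_eq_sum fun_eq_iff)
  show "conj_by Q M (\<lambda>x y. A x y + c * B x y) = (\<lambda>x y. conj_by Q M A x y + c * conj_by Q M B x y)" for A B c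
    by (simp add: conj_by_eq_sum fun_eq_iff algebra_simps sum.distrib sum_distrib_left)
qed (rule assms(2))

lemma trace_psd_mats:
  assumes "finite B" "A \<in> psd_mats B"
  shows "trace_qmat B A = of_real (Re (trace_qmat B A))" "0 \<le> Re (trace_qmat B A)"
proof -
  have A: "psd_on (Pow B) A" using assms(2) by (simp add: psd_mats_def)
  have "0 \<le> Re (A x x)" "Im (A x x) = 0" if "x \<in> Pow B" for x
    using psd_on_diag[OF A that] assms(1) by auto
  then show "trace_qmat B A = of_real (Re (trace_qmat B A))" "0 \<le> Re (trace_qmat B A)"
    by (auto simp: trace_qmat_def complex_eq_iff intro!: sum_nonneg sum.neutral)
qed

lemma psd_mats_entry_le_trace:
  assumes "finite B" "A \<in> psd_mats B"
  shows "cmod (A x y) \<le> Re (trace_qmat B A)"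
proof (cases "x \<subseteq> B \<and> y \<subseteq> B")
  case True
  then show ?thesis
    using psd_on_entry_le_trace[of "Pow B" A x y] assms by (simp add: psd_mats_def trace_qmat_def)
next
  case False
  then have "A x y = 0" using psd_mats_outside[OF assms(2)] by blast
  then show ?thesis using trace_psd_mats(2)[OF assms] by simp
qed

lemma psd_mats_scale:
  assumes "A \<in> psd_mats B" "c \<ge> 0"
  shows "(\<lambda>x y. complex_of_real c * A x y) \<in> psd_mats B"
  using assms psd_on_scale[of "Pow B" A c] by (auto simp: psd_mats_def qmats_def)

lemma psd_mats_add:
  assumes "A \<in> psd_mats B" "A' \<in> psd_mats B"
  shows "(\<lambda>x y. A x y + A' x y) \<in> psd_mats B"
  using assms psd_on_add[of "Pow B" A A'] by (auto simp: psd_mats_def qmats_def)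

text \<open>The projection onto one basis vector. It serves as a filler of trace one and as the
  state of a measured qubit.\<close>

definition basis_state :: "'q set \<Rightarrow> 'q qmat" where
  "basis_state c = (\<lambda>x y. if x = c \<and> y = c then 1 else 0)"

lemma basis_state_psd: "c \<subseteq> B \<Longrightarrow> basis_state c \<in> psd_mats B"
proof -
  assume "c \<subseteq> B"
  moreover have "basis_state c = (\<lambda>x y. (if x = c then 1 else 0) * cnj (if y = c then 1 else 0))"
    by (auto simp: basis_state_def fun_eq_iff)
  then have "psd_on (Pow B) (basis_state c)" using psd_on_rank_one[of "Pow B" "\<lambda>x. if x = c then 1 else 0"] by simp
  ultimately show ?thesis by (auto simp: psd_mats_def qmats_def basis_state_def)
qed

lemma trace_basis_state: "finite B \<Longrightarrow> c \<subseteq> B \<Longrightarrow> trace_qmat B (basis_state c) = 1"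
  by (simp add: trace_qmat_def basis_state_def)

text \<open>Factors are divided by their traces. A factor of trace 0 vanishes, since its entries are
  bounded by the trace; a filler of trace one replaces it, and the weight becomes 0.\<close>

lemma tensor_normalize:
  assumes "finite Q" "partition_on Q \<pi>" "\<And>B. B \<in> \<pi> \<Longrightarrow> r B \<in> psd_mats B"
  shows "\<exists>c r'. 0 \<le> c \<and> (\<forall>B\<in>\<pi>. r' B \<in> psd_mats B \<and> trace_qmat B (r' B) = 1) \<and>
    (\<forall>x y. tensor Q \<pi> r x y = complex_of_real c * tensor Q \<pi> r' x y)"
proof -
  have fin: "finite B" if "B \<in> \<pi>" for B
    using that assms(1,2) by (metis partition_onD1 Union_upper finite_subset)
  define t where "t B = Re (trace_qmat B (r B))" for B
  define r' where "r' B = (if t B = 0 then basis_state {} else (\<lambda>x y. complex_of_real (1 / t B) * r B x y))" for B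
  have t: "0 \<le> t B" "trace_qmat B (r B) = of_real (t B)" if "B \<in> \<pi>" for B
    using trace_psd_mats[OF fin assms(3)] that by (auto simp: t_def)
  have "r' B \<in> psd_mats B \<and> trace_qmat B (r' B) = 1" if B: "B \<in> \<pi>" for B
  proof (cases "t B = 0")
    case True
    then show ?thesis using basis_state_psd[of "{}" B] trace_basis_state[of B "{}"] fin[OF B] by (simp add: r'_def)
  next
    case False
    moreover have "trace_qmat B (\<lambda>x y. complex_of_real (1 / t B) * r B x y) = of_real (1 / t B) * trace_qmat B (r B)"
      unfolding trace_qmat_def sum_distrib_left ..
    moreover have "(\<lambda>x y. complex_of_real (1 / t B) * r B x y) \<in> psd_mats B"
      using t[OF B] by (intro psd_mats_scale assms(3) B) auto
    ultimately show ?thesis using t[OF B] by (simp add: r'_def)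
  qed
  moreover have rr': "r B x y = of_real (t B) * r' B x y" if B: "B \<in> \<pi>" for B x y
  proof (cases "t B = 0")
    case True
    then have "r B x y = 0"
      using psd_mats_entry_le_trace[OF fin[OF B] assms(3)[OF B], of x y] by (simp add: t_def)
    then show ?thesis using True by simp
  qed (simp add: r'_def)
  have "tensor Q \<pi> r x y = complex_of_real (\<Prod>B\<in>\<pi>. t B) * tensor Q \<pi> r' x y" for x y
    by (simp add: tensor_def rr' prod.distrib cong: prod.cong)
  moreover have "0 \<le> (\<Prod>B\<in>\<pi>. t B)" using t by (intro prod_nonneg) auto
  ultimately show ?thesis by blast
qed

text \<open>Trace exactly one, rather than at most one, is what makes the weights sum to the trace
  of \<open>\<rho>\<close> and hence bounds them.\<close>

definition unit_decomp :: "'q set \<Rightarrow> 'q set set \<Rightarrow> nat set \<Rightarrow> (nat \<Rightarrow> real) \<Rightarrow> (nat \<Rightarrow> 'q set \<Rightarrow> 'q qmat) \<Rightarrow> 'q qmat \<Rightarrow> bool" where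
  "unit_decomp Q \<pi> K p r \<rho> \<longleftrightarrow> finite K \<and>
     (\<forall>k\<in>K. 0 \<le> p k \<and> (\<forall>B\<in>\<pi>. r k B \<in> psd_mats B \<and> trace_qmat B (r k B) = 1)) \<and>
     (\<forall>x y. \<rho> x y = (\<Sum>k\<in>K. complex_of_real (p k) * tensor Q \<pi> (r k) x y))"

lemma sep_cone_unit_decomp:
  assumes "finite Q" "partition_on Q \<pi>" "sep_cone Q \<pi> \<rho>"
  shows "\<exists>n p r. unit_decomp Q \<pi> {..<n} p r \<rho>"
  using assms(3)
proof induction
  case zero
  have "unit_decomp Q \<pi> {..<0} (\<lambda>_. 0) (\<lambda>_ _ _ _. 0) (\<lambda>x y. 0)"
    by (simp add: unit_decomp_def)
  then show ?case by blast
next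
  case (add_tensor A c r)
  then obtain n p s where A: "unit_decomp Q \<pi> {..<n} p s A" by blast
  from tensor_normalize[OF assms(1,2) add_tensor.hyps(3)] obtain d r' where
    d: "0 \<le> d" "\<forall>B\<in>\<pi>. r' B \<in> psd_mats B \<and> trace_qmat B (r' B) = 1"
      "\<forall>x y. tensor Q \<pi> r x y = complex_of_real d * tensor Q \<pi> r' x y" by blast
  have "unit_decomp Q \<pi> {..<Suc n} (p(n := c * d)) (s(n := r')) (\<lambda>x y. A x y + complex_of_real c * tensor Q \<pi> r x y)"
    using A d add_tensor.hyps(2) unfolding unit_decomp_def by (auto simp: less_Suc_eq)
  then show ?case by blast
qed

lemma sep_cone_sum:
  assumes "finite K" "\<And>k. k \<in> K \<Longrightarrow> 0 \<le> p k" "\<And>k B. k \<in> K \<Longrightarrow> B \<in> \<pi> \<Longrightarrow> r k B \<in> psd_mats B"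
  shows "sep_cone Q \<pi> (\<lambda>x y. \<Sum>k\<in>K. complex_of_real (p k) * tensor Q \<pi> (r k) x y)"
  using assms
proof (induction K rule: finite_induct)
  case empty
  then show ?case using sep_cone.zero by simp
next
  case (insert k K)
  then show ?case
    using sep_cone.add_tensor[of Q \<pi> "\<lambda>x y. \<Sum>k\<in>K. complex_of_real (p k) * tensor Q \<pi> (r k) x y" "p k" "r k"]
    by (simp add: add.commute)
qed

lemma separable_iff:
  assumes "finite Q" "partition_on Q \<pi>"
  shows "separable Q \<pi> \<rho> \<longleftrightarrow> sep_cone Q \<pi> \<rho>"
proof
  assume "separable Q \<pi> \<rho>"
  then show "sep_cone Q \<pi> \<rho>"
    unfolding separable_def states_iff using sep_cone_sum by blast
next
  assume "sep_cone Q \<pi> \<rho>"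
  from sep_cone_unit_decomp[OF assms this] obtain n p r where u: "unit_decomp Q \<pi> {..<n} p r \<rho>" by blast
  then have "\<rho> = (\<lambda>x y. \<Sum>k\<in>{..<n}. complex_of_real (p k) * tensor Q \<pi> (r k) x y)"
    by (simp add: unit_decomp_def fun_eq_iff)
  moreover have "finite {..<n} \<and> (\<forall>k\<in>{..<n}. 0 \<le> p k \<and> (\<forall>B\<in>\<pi>. r k B \<in> states B))"
    using u by (simp add: unit_decomp_def states_iff)
  ultimately show "separable Q \<pi> \<rho>" unfolding separable_def by blast
qed

section \<open>Local operations and coarsening\<close>

lemma tensor_split:
  assumes "finite \<pi>" "B \<in> \<pi>"
  shows "tensor Q \<pi> r x y = (if x \<subseteq> Q \<and> y \<subseteq> Q then
    r B (x \<inter> B) (y \<inter> B) * (\<Prod>B'\<in>\<pi> - {B}. r B' (x \<inter> B') (y \<inter> B')) else 0)"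
  using assms by (simp add: tensor_def prod.remove)

lemma partition_block_unique:
  "partition_on Q \<pi> \<Longrightarrow> B \<in> \<pi> \<Longrightarrow> B' \<in> \<pi> \<Longrightarrow> q \<in> B \<Longrightarrow> q \<in> B' \<Longrightarrow> B' = B"
  by (metis partition_onD2 disjointD IntI empty_iff)

lemma partition_block:
  assumes "partition_on Q \<pi>" "q \<in> Q"
  obtains B where "B \<in> \<pi>" "q \<in> B" "B \<subseteq> Q"
  using assms unfolding partition_on_def by blast

text \<open>Blocks are disjoint, so \<open>q\<close> belongs to \<open>B\<close> only and every
  other factor is blind to it.\<close>

lemma conj_by_on1_tensor:
  assumes "finite Q" "partition_on Q \<pi>" "B \<in> \<pi>" "q \<in> B"
  shows "conj_by Q (on1 Q M q) (tensor Q \<pi> r) = tensor Q \<pi> (r(B := conj_by B (on1 B M q) (r B)))"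
proof (intro ext)
  fix x y
  have B: "B \<subseteq> Q" using assms(2,3) partition_onD1 by blast
  have fin: "finite \<pi>" "finite B" "q \<in> Q"
    using assms B finite_elements finite_subset by blast+
  have i: "(z - {q}) \<inter> B = z \<inter> B - {q}" "(insert q z) \<inter> B = insert q (z \<inter> B)" "qbit (z \<inter> B) q = qbit z q" for z
    using assms(4) by (auto simp: qbit_def)
  have o: "(z - {q}) \<inter> B' = z \<inter> B'" "(insert q z) \<inter> B' = z \<inter> B'" if "B' \<in> \<pi> - {B}" for z B'
    using that partition_block_unique[OF assms(2,3) _ assms(4), of B'] by auto
  \<comment> \<open>At all four index pairs read by the conjugation formula, the product of the
    other factors is the same and can be pulled out.\<close>
  have T: "tensor Q \<pi> r u v = r B (u \<inter> B) (v \<inter> B) * (\<Prod>B'\<in>\<pi> - {B}. r B' (x \<inter> B') (y \<inter> B'))"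
    if "u \<in> {x - {q}, insert q x}" "v \<in> {y - {q}, insert q y}" "x \<subseteq> Q" "y \<subseteq> Q" for u v
  proof -
    have "u \<subseteq> Q" "v \<subseteq> Q" using that fin by auto
    moreover have "(\<Prod>B'\<in>\<pi> - {B}. r B' (u \<inter> B') (v \<inter> B')) = (\<Prod>B'\<in>\<pi> - {B}. r B' (x \<inter> B') (y \<inter> B'))"
    proof (rule prod.cong[OF refl])
      fix B' assume B': "B' \<in> \<pi> - {B}"
      have "u \<inter> B' = x \<inter> B'" using that(1) by (elim insertE) (simp_all add: o[OF B'])
      moreover have "v \<inter> B' = y \<inter> B'" using that(2) by (elim insertE) (simp_all add: o[OF B'])
      ultimately show "r B' (u \<inter> B') (v \<inter> B') = r B' (x \<inter> B') (y \<inter> B')" by simp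
    qed
    ultimately show ?thesis by (simp add: tensor_split[OF fin(1) assms(3)])
  qed
  show "conj_by Q (on1 Q M q) (tensor Q \<pi> r) x y = tensor Q \<pi> (r(B := conj_by B (on1 B M q) (r B))) x y"
  proof (cases "x \<subseteq> Q \<and> y \<subseteq> Q")
    case True
    have "tensor Q \<pi> (r(B := conj_by B (on1 B M q) (r B))) x y =
      conj_by B (on1 B M q) (r B) (x \<inter> B) (y \<inter> B) * (\<Prod>B'\<in>\<pi> - {B}. r B' (x \<inter> B') (y \<inter> B'))"
      using True by (simp add: tensor_split[OF fin(1) assms(3)])
    then show ?thesis
      using True by (simp add: conj_by_on1[OF assms(1) fin(3)] conj_by_on1[OF fin(2) assms(4)] T i algebra_simps)
  next
    case False
    then show ?thesis by (simp only: conj_by_on1[OF assms(1) fin(3)] tensor_def if_False)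
  qed
qed

lemma sep_cone_conj_by_on1:
  assumes "finite Q" "partition_on Q \<pi>" "q \<in> Q" "sep_cone Q \<pi> \<rho>"
  shows "sep_cone Q \<pi> (conj_by Q (on1 Q M q) \<rho>)"
proof (rule sep_cone_conj_by[OF assms(4)])
  fix r :: "'a set \<Rightarrow> 'a qmat" assume r: "\<And>B. B \<in> \<pi> \<Longrightarrow> r B \<in> psd_mats B"
  obtain B where B: "B \<in> \<pi>" "q \<in> B" "B \<subseteq> Q" using partition_block[OF assms(2,3)] .
  have "finite B" using B assms(1) finite_subset by blast
  then have "conj_by B (on1 B M q) (r B) \<in> psd_mats B"
    by (rule conj_by_psd[OF _ on1_qmats r[OF B(1)]])
  then show "sep_cone Q \<pi> (conj_by Q (on1 Q M q) (tensor Q \<pi> r))"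
    unfolding conj_by_on1_tensor[OF assms(1,2) B(1,2)]
    using r by (intro sep_cone_tensor) auto
qed

lemma conj_by_CNot_tensor:
  assumes "finite Q" "partition_on Q \<pi>" "B \<in> \<pi>" "q1 \<in> B" "q2 \<in> B" "q1 \<noteq> q2"
  shows "conj_by Q (on2 Q CNot_mat q1 q2) (tensor Q \<pi> r) =
    tensor Q \<pi> (r(B := conj_by B (on2 B CNot_mat q1 q2) (r B)))"
proof (intro ext)
  fix x y
  have B: "B \<subseteq> Q" using assms(2,3) partition_onD1 by blast
  have fin: "finite \<pi>" "finite B" "q1 \<in> Q" "q2 \<in> Q"
    using assms B finite_elements finite_subset by blast+
  have i: "cnot q1 q2 z \<inter> B = cnot q1 q2 (z \<inter> B)" for z
    using assms(4,5) by (auto simp: mem_cnot split: if_splits)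
  have o: "cnot q1 q2 z \<inter> B' = z \<inter> B'" if "B' \<in> \<pi> - {B}" for z B'
    using that partition_block_unique[OF assms(2,3) _ assms(5), of B'] by (auto simp: mem_cnot split: if_splits)
  show "conj_by Q (on2 Q CNot_mat q1 q2) (tensor Q \<pi> r) x y =
    tensor Q \<pi> (r(B := conj_by B (on2 B CNot_mat q1 q2) (r B))) x y"
  proof (cases "x \<subseteq> Q \<and> y \<subseteq> Q")
    case True
    have "(\<Prod>B'\<in>\<pi> - {B}. r B' (cnot q1 q2 x \<inter> B') (cnot q1 q2 y \<inter> B')) =
        (\<Prod>B'\<in>\<pi> - {B}. (r(B := conj_by B (on2 B CNot_mat q1 q2) (r B))) B' (x \<inter> B') (y \<inter> B'))"
      by (rule prod.cong[OF refl]) (auto simp: o)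
    then show ?thesis
      using True fin by (simp add: conj_by_CNot[OF assms(1,6) fin(3,4)] conj_by_CNot[OF fin(2) assms(6,4,5)]
          tensor_split[OF fin(1) assms(3)] i)
  next
    case False
    then show ?thesis by (simp only: conj_by_CNot[OF assms(1,6) fin(3,4)] tensor_def if_False)
  qed
qed

lemma sep_cone_conj_by_CNot_same_block:
  assumes "finite Q" "partition_on Q \<pi>" "B \<in> \<pi>" "q1 \<in> B" "q2 \<in> B" "q1 \<noteq> q2" "sep_cone Q \<pi> \<rho>"
  shows "sep_cone Q \<pi> (conj_by Q (on2 Q CNot_mat q1 q2) \<rho>)"
proof (rule sep_cone_conj_by[OF assms(7)])
  fix r :: "'a set \<Rightarrow> 'a qmat" assume r: "\<And>B. B \<in> \<pi> \<Longrightarrow> r B \<in> psd_mats B"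
  have "B \<subseteq> Q" using partition_onD1[OF assms(2)] assms(3) by blast
  then have "finite B" using assms(1) by (rule finite_subset)
  then have "conj_by B (on2 B CNot_mat q1 q2) (r B) \<in> psd_mats B"
    by (rule conj_by_psd[OF _ on2_qmats r[OF assms(3)]])
  then show "sep_cone Q \<pi> (conj_by Q (on2 Q CNot_mat q1 q2) (tensor Q \<pi> r))"
    unfolding conj_by_CNot_tensor[OF assms(1-6)]
    using r by (intro sep_cone_tensor) auto
qed

text \<open>Each factor is pulled back along \<open>x \<inter> B\<close>; the tensor is the
  entrywise product of these kernels.\<close>

lemma tensor_psd:
  assumes "finite Q" "\<And>B. B \<in> \<sigma> \<Longrightarrow> B \<subseteq> Q" "\<And>B. B \<in> \<sigma> \<Longrightarrow> r B \<in> psd_mats B"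
  shows "tensor Q \<sigma> r \<in> psd_mats Q"
proof -
  have "psd_on (Pow Q) (\<lambda>x y. r B (x \<inter> B) (y \<inter> B))" if B: "B \<in> \<sigma>" for B
    by (rule psd_on_pullback[where T = "Pow B" and f = "\<lambda>x. x \<inter> B"])
      (use assms(3)[OF B] finite_subset[OF assms(2)[OF B] assms(1)] in \<open>auto simp: psd_mats_def\<close>)
  then have "psd_on (Pow Q) (\<lambda>x y. \<Prod>B\<in>\<sigma>. r B (x \<inter> B) (y \<inter> B))"
    using assms(1) by (intro psd_on_prod[where A = "\<lambda>B x y. r B (x \<inter> B) (y \<inter> B)"]) simp_all
  then have "psd_on (Pow Q) (tensor Q \<sigma> r)"
    by (subst psd_on_cong[where B = "\<lambda>x y. \<Prod>B\<in>\<sigma>. r B (x \<inter> B) (y \<inter> B)"]) (auto simp: tensor_def)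
  then show ?thesis by (simp add: psd_mats_def qmats_def tensor_def)
qed

text \<open>The factors lying inside one coarse block are multiplied into a single factor on that
  block.\<close>

lemma sep_cone_refines:
  assumes "finite Q" "refines Q \<pi> \<pi>'" "sep_cone Q \<pi> \<rho>"
  shows "sep_cone Q \<pi>' \<rho>"
proof (rule sep_cone_map[OF assms(3), where \<Phi> = "\<lambda>A. A"])
  fix r :: "'a set \<Rightarrow> 'a qmat" assume r: "\<And>B. B \<in> \<pi> \<Longrightarrow> r B \<in> psd_mats B"
  have part: "partition_on Q \<pi>" "partition_on Q \<pi>'" and ref: "\<And>B. B \<in> \<pi> \<Longrightarrow> \<exists>B'\<in>\<pi>'. B \<subseteq> B'"
    using assms(2) by (auto simp: refines_def)
  have fin: "finite \<pi>" "finite \<pi>'" using part assms(1) finite_elements by blast+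
  define blocks where "blocks B' = {B \<in> \<pi>. B \<subseteq> B'}" for B'
  define r' where "r' B' = tensor B' (blocks B') r" for B'
  have sub: "B' \<subseteq> Q" if "B' \<in> \<pi>'" for B' using that part(2) partition_onD1 by blast
  have r': "r' B' \<in> psd_mats B'" if "B' \<in> \<pi>'" for B'
    unfolding r'_def using r finite_subset[OF sub[OF that] assms(1)]
    by (intro tensor_psd) (auto simp: blocks_def)
  have "tensor Q \<pi> r x y = tensor Q \<pi>' r' x y" for x y
  proof (cases "x \<subseteq> Q \<and> y \<subseteq> Q")
    case True
    \<comment> \<open>Without this an empty block would be counted in every group; a nonempty one
      has a qubit, which pins down the coarse block.\<close>
    have ne: "B \<noteq> {}" if "B \<in> \<pi>" for B using that part(1) by (auto simp: partition_on_def)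
    have "\<pi> = (\<Union>B'\<in>\<pi>'. blocks B')" using ref by (auto simp: blocks_def)
    then have "(\<Prod>B\<in>\<pi>. r B (x \<inter> B) (y \<inter> B)) = (\<Prod>B\<in>(\<Union>B'\<in>\<pi>'. blocks B'). r B (x \<inter> B) (y \<inter> B))" by simp
    also have "\<dots> = (\<Prod>B'\<in>\<pi>'. \<Prod>B\<in>blocks B'. r B (x \<inter> B) (y \<inter> B))"
    proof (rule prod.UNION_disjoint)
      show "\<forall>B1\<in>\<pi>'. \<forall>B2\<in>\<pi>'. B1 \<noteq> B2 \<longrightarrow> blocks B1 \<inter> blocks B2 = {}"
      proof (intro ballI impI, rule ccontr)
        fix B1 B2 assume *: "B1 \<in> \<pi>'" "B2 \<in> \<pi>'" "B1 \<noteq> B2" "blocks B1 \<inter> blocks B2 \<noteq> {}"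
        then obtain B where B: "B \<in> \<pi>" "B \<subseteq> B1" "B \<subseteq> B2" unfolding blocks_def by blast
        then obtain q where "q \<in> B" using ne by blast
        then show False using B partition_block_unique[OF part(2) *(1,2), of q] *(3) by blast
      qed
    qed (use fin in \<open>auto simp: blocks_def\<close>)
    also have "\<dots> = (\<Prod>B'\<in>\<pi>'. r' B' (x \<inter> B') (y \<inter> B'))"
    proof (rule prod.cong[OF refl])
      fix B' assume "B' \<in> \<pi>'"
      have "x \<inter> B' \<inter> B = x \<inter> B" "y \<inter> B' \<inter> B = y \<inter> B" if "B \<in> blocks B'" for B
        using that by (auto simp: blocks_def)
      then show "(\<Prod>B\<in>blocks B'. r B (x \<inter> B) (y \<inter> B)) = r' B' (x \<inter> B') (y \<inter> B')"
        by (simp add: r'_def tensor_def)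
    qed
    finally show ?thesis using True by (simp add: tensor_def)
  next
    case False
    then show ?thesis by (auto simp: tensor_def)
  qed
  then have "tensor Q \<pi> r = tensor Q \<pi>' r'" by (intro ext)
  then show "sep_cone Q \<pi>' (tensor Q \<pi> r)"
    using sep_cone_tensor[of \<pi>' r' Q] r' by simp
qed simp_all



section \<open>Separability after measurements and controlled negations\<close>

text \<open>Both outcomes are treated at once: \<open>c\<close> is the measured value of
  \<open>q\<close> as an index set, empty for true and \<open>{q}\<close> for false.\<close>

lemma conj_by_projection:
  assumes "finite Q" "q \<in> Q" "M = P_true \<and> c = {} \<or> M = P_false \<and> c = {q}"
  shows "conj_by Q (on1 Q M q) \<rho> x y =
    (if x \<subseteq> Q \<and> y \<subseteq> Q \<and> x \<inter> {q} = c \<and> y \<inter> {q} = c then \<rho> x y else 0)"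
  using assms(3) by (auto simp: conj_by_on1[OF assms(1,2)] qbit_def insert_absorb)

text \<open>Only the block of \<open>q\<close> changes; the last difference drops its remainder when
  that block is \<open>{q}\<close>.\<close>

lemma part_minus_eq:
  assumes "partition_on Q \<pi>" "B \<in> \<pi>" "q \<in> B"
  shows "part_minus \<pi> q = (\<pi> - {B}) \<union> {{q}} \<union> ({B - {q}} - {{}})"
proof -
  have ne: "{} \<notin> \<pi>" using assms(1) by (simp add: partition_on_def)
  have "B' - {q} = B'" if "B' \<in> \<pi> - {B}" for B'
    using that partition_block_unique[OF assms(1,2) _ assms(3), of B'] by auto
  then have "(\<lambda>B. B - {q}) ` \<pi> = insert (B - {q}) (\<pi> - {B})"
    using assms(2) by (auto simp: image_iff) (metis DiffI singletonD)+
  then show ?thesis using ne by (auto simp: part_minus_def)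
qed

lemma partition_on_part_minus:
  assumes "partition_on Q \<pi>" "q \<in> Q"
  shows "partition_on Q (part_minus \<pi> q)"
proof -
  obtain B where B: "B \<in> \<pi>" "q \<in> B" "B \<subseteq> Q" using partition_block[OF assms] .
  have un: "B' = B''" if "B' \<in> \<pi>" "B'' \<in> \<pi>" "z \<in> B'" "z \<in> B''" for B' B'' z
    using partition_block_unique[OF assms(1) that(2,1,4,3)] .
  show ?thesis
    unfolding partition_on_def disjoint_def
  proof (intro conjI ballI impI)
    show "\<Union> (part_minus \<pi> q) = Q"
      using partition_onD1[OF assms(1)] assms(2) by (auto simp: part_minus_def)
    show "{} \<notin> part_minus \<pi> q" by (simp add: part_minus_def)
    show "B1 \<inter> B2 = {}" if "B1 \<in> part_minus \<pi> q" "B2 \<in> part_minus \<pi> q" "B1 \<noteq> B2" for B1 B2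
      using that unfolding part_minus_def by (auto dest: un)
  qed
qed

text \<open>After the measurement the factor of the block of \<open>q\<close> is supported where
  both indices have value \<open>c\<close> at \<open>q\<close>, so it splits into
  \<open>basis_state c\<close> and a factor on the remaining qubits.\<close>

lemma sep_cone_projection:
  assumes "finite Q" "partition_on Q \<pi>" "q \<in> Q" "M = P_true \<or> M = P_false" "sep_cone Q \<pi> \<rho>"
  shows "sep_cone Q (part_minus \<pi> q) (conj_by Q (on1 Q M q) \<rho>)"
proof (rule sep_cone_conj_by[OF assms(5)])
  fix r :: "'a set \<Rightarrow> 'a qmat" assume r: "\<And>B. B \<in> \<pi> \<Longrightarrow> r B \<in> psd_mats B"
  obtain B where B: "B \<in> \<pi>" "q \<in> B" "B \<subseteq> Q" using partition_block[OF assms(2,3)] .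
  have finB: "finite B" using B(3) assms(1) by (rule finite_subset)
  have fin: "finite \<pi>" using assms(1,2) finite_elements by blast
  obtain c where c: "M = P_true \<and> c = {} \<or> M = P_false \<and> c = {q}" using assms(4) by blast
  then have cq: "c \<subseteq> {q}" by auto
  define s where "s = conj_by B (on1 B M q) (r B)"
  have s: "s \<in> psd_mats B"
    unfolding s_def by (rule conj_by_psd[OF finB on1_qmats r[OF B(1)]])
  have T: "conj_by Q (on1 Q M q) (tensor Q \<pi> r) = tensor Q \<pi> (r(B := s))"
    unfolding s_def by (rule conj_by_on1_tensor[OF assms(1,2) B(1,2)])
  show "sep_cone Q (part_minus \<pi> q) (conj_by Q (on1 Q M q) (tensor Q \<pi> r))"
  \<comment> \<open>In this case the partition stays as it is, and there is no remainder to carry a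
    second factor.\<close>
  proof (cases "B = {q}")
    case True
    then have pm: "part_minus \<pi> q = \<pi>" using B(1) by (auto simp: part_minus_eq[OF assms(2) B(1,2)])
    show ?thesis unfolding T pm by (rule sep_cone_tensor) (use r s in auto)
  next
    case False
    then have ne: "B - {q} \<noteq> {}" using B(2) by blast
    \<comment> \<open>The remaining factor is read off by inserting the measured value into both
      indices.\<close>
    define s' where "s' x y = (if x \<subseteq> B - {q} \<and> y \<subseteq> B - {q} then s (x \<union> c) (y \<union> c) else 0)" for x y
    define r' where "r' B' = (if B' = {q} then basis_state c else if B' = B - {q} then s' else r B')" for B'
    \<comment> \<open>Ensures that the cases in \<open>r'\<close> do not collide with the untouched
      blocks.\<close>
    have out: "B' \<noteq> {q}" "B' \<noteq> B - {q}" if "B' \<in> \<pi> - {B}" for B'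
    proof -
      have "B' \<inter> B = {}" using that B(1) partition_onD2[OF assms(2)] by (auto simp: disjoint_def)
      moreover have "B' \<noteq> {}" using that assms(2) by (auto simp: partition_on_def)
      ultimately show "B' \<noteq> {q}" "B' \<noteq> B - {q}" using B(2) by auto
    qed
    have "psd_on (Pow (B - {q})) (\<lambda>x y. s (x \<union> c) (y \<union> c))"
      by (rule psd_on_pullback[where T = "Pow B" and f = "\<lambda>x. x \<union> c"])
        (use s finB cq B(2) in \<open>auto simp: psd_mats_def\<close>)
    then have "psd_on (Pow (B - {q})) s'"
      by (subst psd_on_cong[where B = "\<lambda>x y. s (x \<union> c) (y \<union> c)"]) (auto simp: s'_def)
    then have "s' \<in> psd_mats (B - {q})" by (simp add: psd_mats_def qmats_def s'_def)
    then have r': "r' B' \<in> psd_mats B'" if "B' \<in> part_minus \<pi> q" for B'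
      using that r basis_state_psd[OF cq] unfolding part_minus_eq[OF assms(2) B(1,2)] r'_def by auto
    have pm: "part_minus \<pi> q = insert {q} (insert (B - {q}) (\<pi> - {B}))"
      using ne by (auto simp: part_minus_eq[OF assms(2) B(1,2)])
    have "tensor Q \<pi> (r(B := s)) x y = tensor Q (part_minus \<pi> q) r' x y" for x y
    proof (cases "x \<subseteq> Q \<and> y \<subseteq> Q")
      case xy: True
      have entry: "s (x \<inter> B) (y \<inter> B) = r' {q} (x \<inter> {q}) (y \<inter> {q}) * r' (B - {q}) (x \<inter> (B - {q})) (y \<inter> (B - {q}))"
      proof (cases "x \<inter> {q} = c \<and> y \<inter> {q} = c")
        case True
        then have "x \<inter> (B - {q}) \<union> c = x \<inter> B" "y \<inter> (B - {q}) \<union> c = y \<inter> B" using B(2) by auto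
        then show ?thesis using True False B(2) by (auto simp: r'_def s'_def basis_state_def)
      next
        case cF: False
        have "x \<inter> B \<inter> {q} = x \<inter> {q}" "y \<inter> B \<inter> {q} = y \<inter> {q}" using B(2) by auto
        then have "s (x \<inter> B) (y \<inter> B) = 0"
          unfolding s_def conj_by_projection[OF finB B(2) c] using cF by presburger
        moreover have "basis_state c (x \<inter> {q}) (y \<inter> {q}) = 0"
          by (simp only: basis_state_def cF if_False)
        ultimately show ?thesis by (simp only: r'_def refl if_True mult_zero_left)
      qed
      have "(\<Prod>B'\<in>part_minus \<pi> q. r' B' (x \<inter> B') (y \<inter> B')) =
        r' {q} (x \<inter> {q}) (y \<inter> {q}) * (r' (B - {q}) (x \<inter> (B - {q})) (y \<inter> (B - {q})) *
        (\<Prod>B'\<in>\<pi> - {B}. r' B' (x \<inter> B') (y \<inter> B')))"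
      proof -
        have "{q} \<notin> insert (B - {q}) (\<pi> - {B})" "B - {q} \<notin> \<pi> - {B}" using out by auto
        then show ?thesis unfolding pm using fin by (simp only: prod.insert finite_insert finite_Diff simp_thms)
      qed
      also have "(\<Prod>B'\<in>\<pi> - {B}. r' B' (x \<inter> B') (y \<inter> B')) = (\<Prod>B'\<in>\<pi> - {B}. (r(B := s)) B' (x \<inter> B') (y \<inter> B'))"
        using out by (intro prod.cong) (auto simp: r'_def)
      finally show ?thesis
        using xy by (simp only: tensor_split[OF fin B(1)] tensor_def[of Q "part_minus \<pi> q"] entry fun_upd_same mult.assoc)
    next
      case False
      then show ?thesis by (simp only: tensor_def if_False)
    qed
    then have "tensor Q \<pi> (r(B := s)) = tensor Q (part_minus \<pi> q) r'" by (intro ext)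
    then show ?thesis unfolding T using sep_cone_tensor[of "part_minus \<pi> q" r' Q] r' by simp
  qed
qed

text \<open>The gate is \<open>P_true\<close> on the control plus the product of
  \<open>P_false\<close> on the control and a negation of the target. The cross terms of the
  conjugation read entries whose indices differ at the control, and these vanish.\<close>

lemma sep_cone_CNot_std_control:
  assumes "finite Q" "partition_on Q \<pi>" "q1 \<noteq> q2" "q1 \<in> Q" "q2 \<in> Q" "std Q q1 \<rho>" "sep_cone Q \<pi> \<rho>"
  shows "sep_cone Q \<pi> (conj_by Q (on2 Q CNot_mat q1 q2) \<rho>)"
proof -
  define \<rho>1 where "\<rho>1 = conj_by Q (on1 Q P_true q1) \<rho>"
  define \<rho>2 where "\<rho>2 = conj_by Q (on1 Q (pauli_mat Sigma_x) q2) (conj_by Q (on1 Q P_false q1) \<rho>)"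
  have "sep_cone Q \<pi> \<rho>1" "sep_cone Q \<pi> \<rho>2"
    unfolding \<rho>1_def \<rho>2_def using assms by (auto intro!: sep_cone_conj_by_on1)
  moreover have "conj_by Q (on2 Q CNot_mat q1 q2) \<rho> x y = \<rho>1 x y + \<rho>2 x y" for x y
  proof (cases "x \<subseteq> Q \<and> y \<subseteq> Q")
    case True
    then have sub: "flip q2 x \<subseteq> Q" "flip q2 y \<subseteq> Q" using assms(5) by auto
    have X: "conj_by Q (on1 Q (pauli_mat Sigma_x) q2) \<rho>' x y = \<rho>' (flip q2 x) (flip q2 y)" for \<rho>'
      using True by (auto simp: conj_by_on1[OF assms(1,5)] qbit_def flip_def)
    have "conj_by Q (on1 Q P_true q1) \<rho> x y = (if q1 \<notin> x \<and> q1 \<notin> y then \<rho> x y else 0)"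
      using True by (auto simp: conj_by_on1[OF assms(1,4)] qbit_def)
    moreover have "conj_by Q (on1 Q P_false q1) \<rho> (flip q2 x) (flip q2 y) =
        (if q1 \<in> x \<and> q1 \<in> y then \<rho> (flip q2 x) (flip q2 y) else 0)"
      using sub assms(3) by (auto simp: conj_by_on1[OF assms(1,4)] qbit_def insert_absorb mem_flip)
    moreover have "\<rho> (cnot q1 q2 x) (cnot q1 q2 y) = 0" if "(q1 \<in> x) \<noteq> (q1 \<in> y)"
      using stdD[OF assms(6), of "cnot q1 q2 x" "cnot q1 q2 y"] that True assms(3,5) by (simp add: mem_cnot)
    ultimately show ?thesis
      unfolding \<rho>1_def \<rho>2_def conj_by_CNot[OF assms(1,3-5)] X
      using True by (auto simp: cnot_def)
  next
    case False
    then show ?thesis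
      by (simp only: \<rho>1_def \<rho>2_def conj_by_CNot[OF assms(1,3-5)] conj_by_on1[OF assms(1,4)] conj_by_on1[OF assms(1,5)]) simp
  qed
  then have "conj_by Q (on2 Q CNot_mat q1 q2) \<rho> = (\<lambda>x y. \<rho>1 x y + \<rho>2 x y)" by (intro ext)
  ultimately show ?thesis using sep_cone_add by simp
qed

text \<open>The gate splits along the eigenspaces of the negation of the target, with a phase flip of the
  control on the second one.\<close>

lemma sep_cone_CNot_diag_target:
  assumes "finite Q" "partition_on Q \<pi>" "q1 \<noteq> q2" "q1 \<in> Q" "q2 \<in> Q" "diag Q q2 \<rho>" "sep_cone Q \<pi> \<rho>"
  shows "sep_cone Q \<pi> (conj_by Q (on2 Q CNot_mat q1 q2) \<rho>)"
proof -
  \<comment> \<open>For \<open>e\<close> equal to 1 and -1 these are the projections onto the two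
    eigenspaces of sigma_x.\<close>
  define P :: "complex \<Rightarrow> complex mat" where "P e = mat 2 2 (\<lambda>(i, j). if i = j then 1 / 2 else e / 2)" for e
  define \<rho>1 where "\<rho>1 = conj_by Q (on1 Q (P 1) q2) \<rho>"
  define \<rho>2 where "\<rho>2 = conj_by Q (on1 Q (pauli_mat Sigma_z) q1) (conj_by Q (on1 Q (P (-1)) q2) \<rho>)"
  have "sep_cone Q \<pi> \<rho>1" "sep_cone Q \<pi> \<rho>2"
    unfolding \<rho>1_def \<rho>2_def using assms by (auto intro!: sep_cone_conj_by_on1)
  moreover have "conj_by Q (on2 Q CNot_mat q1 q2) \<rho> x y = \<rho>1 x y + \<rho>2 x y" for x y
  proof (cases "x \<subseteq> Q \<and> y \<subseteq> Q")
    case True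
    have fxy: "\<rho> (flip q2 x) (flip q2 y) = \<rho> x y" using diagD[OF assms(6)] True by blast
    have fx: "\<rho> x (flip q2 y) = \<rho> (flip q2 x) y"
      using diagD[OF assms(6), of "flip q2 x" y] True assms(5) by simp
    \<comment> \<open>Flip invariance means that \<open>\<rho>\<close> commutes with the negation of
      the target, so projecting from both sides is the same as projecting from one side.\<close>
    have P: "conj_by Q (on1 Q (P e) q2) \<rho> x y = (\<rho> x y + e * \<rho> (flip q2 x) y) / 2" if "e = 1 \<or> e = -1" for e
      using that True fxy fx
      by (auto simp: conj_by_on1[OF assms(1,5)] qbit_def P_def flip_def insert_absorb field_simps split: if_splits)
    have Z: "conj_by Q (on1 Q (pauli_mat Sigma_z) q1) \<rho>' x y = (if (q1 \<in> x) = (q1 \<in> y) then \<rho>' x y else - \<rho>' x y)" for \<rho>'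
      using True by (auto simp: conj_by_on1[OF assms(1,4)] qbit_def insert_absorb)
    have "\<rho>1 x y + \<rho>2 x y = (if (q1 \<in> x) = (q1 \<in> y) then \<rho> x y else \<rho> (flip q2 x) y)"
      unfolding \<rho>1_def \<rho>2_def Z by (simp add: P field_simps)
    then show ?thesis
      unfolding conj_by_CNot[OF assms(1,3-5)] using True fx fxy by (auto simp: cnot_def)
  next
    case False
    then show ?thesis
      by (simp only: \<rho>1_def \<rho>2_def conj_by_CNot[OF assms(1,3-5)] conj_by_on1[OF assms(1,4)] conj_by_on1[OF assms(1,5)]) simp
  qed
  then have "conj_by Q (on2 Q CNot_mat q1 q2) \<rho> = (\<lambda>x y. \<rho>1 x y + \<rho>2 x y)" by (intro ext)
  ultimately show ?thesis using sep_cone_add by simp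
qed



section \<open>Closedness of the separable cone\<close>

text \<open>More vectors than coordinates are dependent, by Gaussian elimination of one coordinate
  at a time.\<close>

lemma real_linear_dependency:
  fixes f :: "'k \<Rightarrow> 'i \<Rightarrow> real"
  assumes "finite I" "finite K" "card I < card K"
  shows "\<exists>c. (\<exists>k\<in>K. c k \<noteq> 0) \<and> (\<forall>i\<in>I. (\<Sum>k\<in>K. c k * f k i) = 0)"
  using assms
proof (induction I arbitrary: K f rule: finite_induct)
  case empty
  then have "K \<noteq> {}" by auto
  then show ?case by (intro exI[of _ "\<lambda>_. 1"]) auto
next
  case (insert i I)
  show ?case
  proof (cases "\<forall>k\<in>K. f k i = 0")
    case True
    obtain c where "\<exists>k\<in>K. c k \<noteq> 0" "\<forall>i\<in>I. (\<Sum>k\<in>K. c k * f k i) = 0"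
      using insert.IH[of K f] insert.prems insert.hyps by auto
    then show ?thesis using True by (intro exI[of _ c]) auto
  next
    case False
    then obtain k0 where k0: "k0 \<in> K" "f k0 i \<noteq> 0" by blast
    define K' where "K' = K - {k0}"
    have K': "finite K'" "k0 \<notin> K'" "K = insert k0 K'" "card I < card K'"
      using insert.prems insert.hyps k0 by (auto simp: K'_def)
    \<comment> \<open>The pivot \<open>k0\<close> clears coordinate \<open>i\<close> from the other
      vectors; \<open>d\<close> below restores the pivot's own coefficient.\<close>
    define g where "g k j = f k j - f k i / f k0 i * f k0 j" for k j
    obtain c where c: "\<exists>k\<in>K'. c k \<noteq> 0" "\<forall>j\<in>I. (\<Sum>k\<in>K'. c k * g k j) = 0"
      using insert.IH[of K' g] K' by auto
    define d where "d = (\<Sum>k\<in>K'. c k * f k i) / f k0 i"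
    define c' where "c' k = (if k = k0 then - d else c k)" for k
    have s: "(\<Sum>k\<in>K. c' k * f k j) = - d * f k0 j + (\<Sum>k\<in>K'. c k * f k j)" for j
    proof -
      have "(\<Sum>k\<in>K'. c' k * f k j) = (\<Sum>k\<in>K'. c k * f k j)"
        using K'(2) by (intro sum.cong) (auto simp: c'_def)
      then show ?thesis unfolding K'(3) using K'(1,2) by (simp add: c'_def)
    qed
    have "(\<Sum>k\<in>K. c' k * f k j) = (\<Sum>k\<in>K'. c k * g k j)" for j
      unfolding s d_def g_def
      by (simp add: right_diff_distrib sum_subtractf sum_divide_distrib sum_distrib_right mult.assoc)
    moreover have "(\<Sum>k\<in>K. c' k * f k i) = 0" unfolding s d_def using k0 by simp
    moreover have "\<exists>k\<in>K. c' k \<noteq> 0" using c(1) K' by (auto simp: c'_def)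
    ultimately show ?thesis using c(2) by (intro exI[of _ c']) auto
  qed
qed

text \<open>While there are too many terms, a multiple of a linear dependency is subtracted from the
  weights until one of them vanishes. Weights of a cone need no fixed sum, so the bound is the
  number of coordinates itself.\<close>

lemma conic_caratheodory:
  fixes f :: "'k \<Rightarrow> 'i \<Rightarrow> real"
  assumes "finite I" "finite K" "\<forall>k\<in>K. 0 \<le> p k"
  shows "\<exists>K' p'. K' \<subseteq> K \<and> card K' \<le> card I \<and> (\<forall>k\<in>K'. 0 \<le> p' k) \<and>
    (\<forall>i\<in>I. (\<Sum>k\<in>K'. p' k * f k i) = (\<Sum>k\<in>K. p k * f k i))"
  using assms(2,3)
proof (induction "card K" arbitrary: K p rule: less_induct)
  case less
  show ?case
  proof (cases "card K \<le> card I")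
    case True
    then show ?thesis using less.prems by blast
  next
    case False
    then obtain c where "\<exists>k\<in>K. c k \<noteq> 0" and c: "\<forall>i\<in>I. (\<Sum>k\<in>K. c k * f k i) = 0"
      using real_linear_dependency[OF assms(1) less.prems(1), of f] by auto
    then obtain k1 where k1: "k1 \<in> K" "c k1 \<noteq> 0" by blast
    \<comment> \<open>The sign is chosen so that some coefficient is positive, hence some weight
      decreases.\<close>
    define d where "d k = (if c k1 > 0 then c k else - c k)" for k
    have d1: "d k1 > 0" using k1 by (auto simp: d_def)
    have d: "(\<Sum>k\<in>K. d k * f k i) = 0" if "i \<in> I" for i
      using c that by (cases "c k1 > 0") (auto simp: d_def sum_negf)
    define P where "P = {k \<in> K. d k > 0}"
    have P: "finite P" "P \<noteq> {}" using less.prems(1) k1 d1 by (auto simp: P_def)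
    \<comment> \<open>The largest step that keeps all weights nonnegative; the weight at a minimiser
      \<open>k0\<close> drops to 0.\<close>
    define t where "t = Min ((\<lambda>k. p k / d k) ` P)"
    have "t \<in> (\<lambda>k. p k / d k) ` P" unfolding t_def using P by (intro Min_in) auto
    then obtain k0 where k0: "k0 \<in> P" "t = p k0 / d k0" by blast
    have tle: "t \<le> p k / d k" if "k \<in> P" for k
      using that P unfolding t_def by (intro Min_le) auto
    have k0K: "k0 \<in> K" "d k0 > 0" using k0 by (auto simp: P_def)
    have t0: "0 \<le> t" using k0(2) k0K less.prems(2) by simp
    define p' where "p' k = p k - t * d k" for k
    have p'0: "0 \<le> p' k" if "k \<in> K" for k
    proof (cases "d k > 0")
      case True
      then show ?thesis using tle[of k] that by (simp add: p'_def P_def field_simps)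
    next
      case False
      then have "t * d k \<le> 0" using t0 by (simp add: mult_nonneg_nonpos)
      moreover have "0 \<le> p k" using less.prems(2) that by blast
      ultimately show ?thesis by (simp add: p'_def)
    qed
    have "p' k0 = 0" using k0(2) k0K by (simp add: p'_def)
    then have e: "(\<Sum>k\<in>K - {k0}. p' k * f k i) = (\<Sum>k\<in>K. p k * f k i)" if "i \<in> I" for i
    proof -
      have "(\<Sum>k\<in>K - {k0}. p' k * f k i) = (\<Sum>k\<in>K. p' k * f k i)"
        using less.prems(1) k0K \<open>p' k0 = 0\<close> by (simp add: sum.remove[of K k0])
      also have "\<dots> = (\<Sum>k\<in>K. p k * f k i) - t * (\<Sum>k\<in>K. d k * f k i)"
        by (simp add: p'_def left_diff_distrib sum_subtractf sum_distrib_left mult.assoc)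
      finally show ?thesis using d[OF that] by simp
    qed
    have "card (K - {k0}) < card K" using less.prems(1) k0K by (intro psubset_card_mono) auto
    have "\<forall>k\<in>K - {k0}. 0 \<le> p' k" using p'0 by blast
    from less.hyps[OF \<open>card (K - {k0}) < card K\<close> finite_Diff[OF less.prems(1)] this] obtain K'' p'' where
      "K'' \<subseteq> K - {k0}" "card K'' \<le> card I" "\<forall>k\<in>K''. 0 \<le> p'' k"
      "\<forall>i\<in>I. (\<Sum>k\<in>K''. p'' k * f k i) = (\<Sum>k\<in>K - {k0}. p' k * f k i)"
      by blast
    then show ?thesis using e by (intro exI[of _ K''] exI[of _ p'']) auto
  qed
qed

section \<open>Convergent subsequences of bounded finite families\<close>

lemma bounded_real_subseq:
  fixes f :: "nat \<Rightarrow> real"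
  assumes "\<And>n. \<bar>f n\<bar> \<le> b"
  shows "\<exists>s l. strict_mono (s :: nat \<Rightarrow> nat) \<and> (\<lambda>n. f (s n)) \<longlonglongrightarrow> l"
proof -
  obtain s :: "nat \<Rightarrow> nat" where s: "strict_mono s" "monoseq (\<lambda>n. f (s n))"
    using seq_monosub[of f] by blast
  have "Bseq (\<lambda>n. f (s n))" using assms by (intro BseqI'[of _ b]) simp
  then have "convergent (\<lambda>n. f (s n))" using s(2) by (rule Bseq_monoseq_convergent)
  then show ?thesis using s(1) by (auto simp: convergent_def)
qed

lemma bounded_complex_subseq:
  fixes f :: "nat \<Rightarrow> complex"
  assumes "\<And>n. cmod (f n) \<le> b"
  shows "\<exists>s l. strict_mono (s :: nat \<Rightarrow> nat) \<and> (\<lambda>n. f (s n)) \<longlonglongrightarrow> l"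
proof -
  have "\<bar>Re (f n)\<bar> \<le> b" "\<bar>Im (f n)\<bar> \<le> b" for n
    using assms[of n] abs_Re_le_cmod[of "f n"] abs_Im_le_cmod[of "f n"] by linarith+
  note bounds = this
  obtain s l where s: "strict_mono (s :: nat \<Rightarrow> nat)" "(\<lambda>n. Re (f (s n))) \<longlonglongrightarrow> l"
    using bounded_real_subseq[of "\<lambda>n. Re (f n)" b] bounds by auto
  obtain s' l' where s': "strict_mono (s' :: nat \<Rightarrow> nat)" "(\<lambda>n. Im (f (s (s' n)))) \<longlonglongrightarrow> l'"
    using bounded_real_subseq[of "\<lambda>n. Im (f (s n))" b] bounds by auto
  have "(\<lambda>n. Re (f (s (s' n)))) \<longlonglongrightarrow> l"
    using LIMSEQ_subseq_LIMSEQ[OF s(2) s'(1)] by (simp add: o_def)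
  then have "(\<lambda>n. f (s (s' n))) \<longlonglongrightarrow> Complex l l'"
    using s'(2) by (simp add: tendsto_complex_iff)
  moreover have "strict_mono (\<lambda>n. s (s' n))" using s(1) s'(1) by (simp add: strict_mono_def)
  ultimately show ?thesis by (intro exI[of _ "\<lambda>n. s (s' n)"] exI[of _ "Complex l l'"]) simp
qed

text \<open>Subsequences are extracted one index after another; thinning out keeps the limits
  already obtained.\<close>

lemma bounded_family_subseq:
  fixes f :: "nat \<Rightarrow> 'j \<Rightarrow> complex"
  assumes "finite J" "\<And>n j. j \<in> J \<Longrightarrow> cmod (f n j) \<le> b"
  shows "\<exists>s l. strict_mono (s :: nat \<Rightarrow> nat) \<and> (\<forall>j\<in>J. (\<lambda>n. f (s n) j) \<longlonglongrightarrow> l j)"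
  using assms
proof (induction J rule: finite_induct)
  case empty
  then show ?case by (intro exI[of _ "\<lambda>n. n"]) (auto simp: strict_mono_def)
next
  case (insert i J)
  then obtain s l where s: "strict_mono (s :: nat \<Rightarrow> nat)" "\<forall>j\<in>J. (\<lambda>n. f (s n) j) \<longlonglongrightarrow> l j" by auto
  obtain s' m where s': "strict_mono (s' :: nat \<Rightarrow> nat)" "(\<lambda>n. f (s (s' n)) i) \<longlonglongrightarrow> m"
    using bounded_complex_subseq[of "\<lambda>n. f (s n) i" b] insert.prems by auto
  have "(\<lambda>n. f (s (s' n)) j) \<longlonglongrightarrow> l j" if "j \<in> J" for j
    using LIMSEQ_subseq_LIMSEQ[OF s(2)[rule_format, OF that] s'(1)] by (simp add: o_def)
  then have "\<forall>j\<in>insert i J. (\<lambda>n. f (s (s' n)) j) \<longlonglongrightarrow> (l(i := m)) j"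
    using s'(2) insert.hyps by auto
  moreover have "strict_mono (\<lambda>n. s (s' n))" using s(1) s'(1) by (simp add: strict_mono_def)
  ultimately show ?case by blast
qed

text \<open>A matrix is viewed as a real vector, the boolean in the index set selecting real or
  imaginary part, and its decomposition is thinned to at most as many terms as there are
  coordinates.\<close>

lemma unit_decomp_card:
  assumes "finite Q" "partition_on Q \<pi>" "unit_decomp Q \<pi> K p r \<rho>"
  shows "\<exists>p' r'. unit_decomp Q \<pi> {..<card (Pow Q \<times> Pow Q \<times> (UNIV :: bool set))} p' r' \<rho>"
proof -
  define I where "I = Pow Q \<times> Pow Q \<times> (UNIV :: bool set)"
  define f where "f k = (\<lambda>(x, y, b). if b then Re (tensor Q \<pi> (r k) x y) else Im (tensor Q \<pi> (r k) x y))" for k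
  have K: "finite K" "\<forall>k\<in>K. 0 \<le> p k"
    and r: "\<And>k B. k \<in> K \<Longrightarrow> B \<in> \<pi> \<Longrightarrow> r k B \<in> psd_mats B \<and> trace_qmat B (r k B) = 1"
    and \<rho>: "\<And>x y. \<rho> x y = (\<Sum>k\<in>K. complex_of_real (p k) * tensor Q \<pi> (r k) x y)"
    using assms(3) by (auto simp: unit_decomp_def)
  have "finite I" using assms(1) by (simp add: I_def)
  from conic_caratheodory[OF this K, of f] obtain K' p' where
    K': "K' \<subseteq> K" "card K' \<le> card I" "\<forall>k\<in>K'. 0 \<le> p' k"
      "\<forall>i\<in>I. (\<Sum>k\<in>K'. p' k * f k i) = (\<Sum>k\<in>K. p k * f k i)" by blast
  have \<rho>': "\<rho> x y = (\<Sum>k\<in>K'. complex_of_real (p' k) * tensor Q \<pi> (r k) x y)" for x y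
  proof (cases "x \<subseteq> Q \<and> y \<subseteq> Q")
    case True
    then have "(x, y, b) \<in> I" for b by (simp add: I_def)
    then have "(\<Sum>k\<in>K'. p' k * f k (x, y, b)) = (\<Sum>k\<in>K. p k * f k (x, y, b))" for b
      using K'(4) by blast
    from this[of True] this[of False] show ?thesis
      by (simp add: \<rho> complex_eq_iff f_def)
  next
    case False
    then have "tensor Q \<pi> (r k) x y = 0" for k by (simp only: tensor_def if_False)
    then show ?thesis by (simp add: \<rho>)
  qed
  have "finite K'" using K'(1) K(1) finite_subset by blast
  then obtain h where h: "bij_betw h {0..<card K'} K'" using ex_bij_betw_nat_finite by blast
  have hK: "h k \<in> K'" if "k < card K'" for k using h that by (auto simp: bij_betw_def)
  \<comment> \<open>Padding with terms of weight 0 gives all decompositions literally the same index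
    set.\<close>
  define q where "q k = (if k < card K' then p' (h k) else 0)" for k
  define s where "s k = (if k < card K' then r (h k) else (\<lambda>B. basis_state {}))" for k
  have fin: "finite B" if "B \<in> \<pi>" for B
    using that partition_onD1[OF assms(2)] finite_subset[OF _ assms(1), of B] by blast
  have unit: "0 \<le> q k \<and> (\<forall>B\<in>\<pi>. s k B \<in> psd_mats B \<and> trace_qmat B (s k B) = 1)" for k
  proof (cases "k < card K'")
    case True
    then have "h k \<in> K" using hK K'(1) by blast
    then show ?thesis using True r K'(3) hK[OF True] by (simp add: q_def s_def)
  next
    case False
    then show ?thesis
      by (auto simp: q_def s_def intro!: basis_state_psd trace_basis_state fin)
  qed
  have "\<rho> x y = (\<Sum>k<card I. complex_of_real (q k) * tensor Q \<pi> (s k) x y)" for x y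
  proof -
    have "(\<Sum>k<card I. complex_of_real (q k) * tensor Q \<pi> (s k) x y) =
        (\<Sum>k\<in>{0..<card K'}. complex_of_real (q k) * tensor Q \<pi> (s k) x y)"
      using K'(2) by (intro sum.mono_neutral_right) (auto simp: q_def)
    also have "\<dots> = (\<Sum>k\<in>{0..<card K'}. complex_of_real (p' (h k)) * tensor Q \<pi> (r (h k)) x y)"
      by (intro sum.cong) (auto simp: q_def s_def)
    also have "\<dots> = \<rho> x y"
      unfolding \<rho>' by (rule sum.reindex_bij_betw[OF h])
    finally show ?thesis ..
  qed
  then have "unit_decomp Q \<pi> {..<card I} q s \<rho>"
    using unit unfolding unit_decomp_def by blast
  then show ?thesis unfolding I_def by blast
qed

text \<open>A subset of \<open>Q\<close> amounts to a choice of a subset of every block, so the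
  distributive law turns the sum of products into a product of sums.\<close>

lemma trace_tensor:
  assumes "finite Q" "partition_on Q \<pi>"
  shows "trace_qmat Q (tensor Q \<pi> r) = (\<Prod>B\<in>\<pi>. trace_qmat B (r B))"
proof -
  have fin: "finite \<pi>" using assms finite_elements by blast
  have sub: "B \<subseteq> Q" if "B \<in> \<pi>" for B using that partition_onD1[OF assms(2)] by blast
  have finB: "finite (Pow B)" if "B \<in> \<pi>" for B using finite_subset[OF sub[OF that] assms(1)] by simp
  define h where "h x = restrict (\<lambda>B. x \<inter> B) \<pi>" for x
  have "bij_betw h (Pow Q) (PiE \<pi> Pow)"
  proof (rule bij_betw_byWitness[where f' = "\<lambda>g. \<Union>B\<in>\<pi>. g B"])
    show "\<forall>x\<in>Pow Q. (\<Union>B\<in>\<pi>. h x B) = x"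
      using partition_onD1[OF assms(2)] by (auto simp: h_def)
    show "\<forall>g\<in>PiE \<pi> Pow. h (\<Union>B\<in>\<pi>. g B) = g"
    proof (intro ballI ext)
      fix g B assume g: "g \<in> PiE \<pi> Pow"
      show "h (\<Union>B\<in>\<pi>. g B) B = g B"
      proof (cases "B \<in> \<pi>")
        case True
        have "g B' \<subseteq> B'" if "B' \<in> \<pi>" for B' using g that by (auto dest: PiE_mem)
        then have "(\<Union>B'\<in>\<pi>. g B') \<inter> B = g B"
          using partition_block_unique[OF assms(2) True] True by blast
        then show ?thesis using True by (simp add: h_def)
      next
        case False
        then show ?thesis by (simp add: h_def PiE_arb[OF g False])
      qed
    qed
    show "h ` Pow Q \<subseteq> PiE \<pi> Pow"
      by (intro image_subsetI PiE_I) (simp_all add: h_def)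
    show "(\<lambda>g. \<Union>B\<in>\<pi>. g B) ` PiE \<pi> Pow \<subseteq> Pow Q"
    proof (intro image_subsetI PowI UN_least)
      fix g B assume "g \<in> PiE \<pi> Pow" "B \<in> \<pi>"
      then show "g B \<subseteq> Q" using PiE_mem[of g \<pi> Pow B] sub[of B] by simp
    qed
  qed
  then have "(\<Sum>g\<in>PiE \<pi> Pow. \<Prod>B\<in>\<pi>. r B (g B) (g B)) = (\<Sum>x\<in>Pow Q. \<Prod>B\<in>\<pi>. r B (h x B) (h x B))"
    by (rule sum.reindex_bij_betw[symmetric])
  also have "\<dots> = trace_qmat Q (tensor Q \<pi> r)"
    by (auto simp: trace_qmat_def tensor_def h_def intro!: sum.cong prod.cong)
  finally show ?thesis
    unfolding trace_qmat_def using prod_sum_PiE[OF fin finB, where f = "\<lambda>B x. r B x x"] by simp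
qed

text \<open>Products of factors of trace one have trace one, so the trace of \<open>\<rho>\<close>
  is the sum of nonnegative weights.\<close>

lemma unit_decomp_weight_le_trace:
  assumes "finite Q" "partition_on Q \<pi>" "unit_decomp Q \<pi> K p r \<rho>" "k \<in> K"
  shows "p k \<le> Re (trace_qmat Q \<rho>)"
proof -
  have K: "finite K" "\<And>k. k \<in> K \<Longrightarrow> 0 \<le> p k"
    and r: "\<And>k B. k \<in> K \<Longrightarrow> B \<in> \<pi> \<Longrightarrow> trace_qmat B (r k B) = 1"
    and \<rho>: "\<And>x y. \<rho> x y = (\<Sum>k\<in>K. complex_of_real (p k) * tensor Q \<pi> (r k) x y)"
    using assms(3) by (auto simp: unit_decomp_def)
  have "trace_qmat Q \<rho> = (\<Sum>k\<in>K. complex_of_real (p k) * trace_qmat Q (tensor Q \<pi> (r k)))"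
    unfolding trace_qmat_def \<rho> sum_distrib_left by (rule sum.swap)
  also have "\<dots> = (\<Sum>k\<in>K. complex_of_real (p k))"
    using r by (intro sum.cong) (auto simp: trace_tensor[OF assms(1,2)])
  finally have "Re (trace_qmat Q \<rho>) = (\<Sum>k\<in>K. p k)" by simp
  moreover have "p k \<le> (\<Sum>k\<in>K. p k)"
    by (rule member_le_sum) (use K assms(4) in auto)
  ultimately show ?thesis by simp
qed

lemma psd_mats_limit:
  assumes "\<And>n. A n \<in> psd_mats B" "\<And>x y. (\<lambda>n. A n x y) \<longlonglongrightarrow> A' x y"
  shows "A' \<in> psd_mats B"
proof -
  have psd: "psd_on (Pow B) (A n)" for n using assms(1)[of n] by (simp add: psd_mats_def)
  have out: "A' x y = 0" if "\<not> (x \<subseteq> B \<and> y \<subseteq> B)" for x y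
    using assms(2)[of x y] psd_mats_outside[OF assms(1) that] by (simp add: LIMSEQ_const_iff)
  have herm: "A' y x = cnj (A' x y)" if "x \<in> Pow B" "y \<in> Pow B" for x y
  proof -
    have "A n y x = cnj (A n x y)" for n
      by (rule psd_on_herm[OF psd that])
    then have "(\<lambda>n. cnj (A n x y)) \<longlonglongrightarrow> A' y x" using assms(2)[of y x] by simp
    moreover have "(\<lambda>n. cnj (A n x y)) \<longlonglongrightarrow> cnj (A' x y)" using assms(2) by (intro tendsto_cnj)
    ultimately show ?thesis by (rule LIMSEQ_unique)
  qed
  have form: "0 \<le> Re (\<Sum>x\<in>Pow B. \<Sum>y\<in>Pow B. cnj (v x) * A' x y * v y)" for v
  proof (rule LIMSEQ_le_const)
    show "(\<lambda>n. Re (\<Sum>x\<in>Pow B. \<Sum>y\<in>Pow B. cnj (v x) * A n x y * v y)) \<longlonglongrightarrow>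
        Re (\<Sum>x\<in>Pow B. \<Sum>y\<in>Pow B. cnj (v x) * A' x y * v y)"
      by (intro tendsto_Re tendsto_sum tendsto_mult tendsto_const assms(2))
    have "0 \<le> Re (\<Sum>x\<in>Pow B. \<Sum>y\<in>Pow B. cnj (v x) * A n x y * v y)" for n
      by (rule psd_on_form[OF psd])
    then show "\<exists>N. \<forall>n\<ge>N. 0 \<le> Re (\<Sum>x\<in>Pow B. \<Sum>y\<in>Pow B. cnj (v x) * A n x y * v y)" by blast
  qed
  have "psd_on (Pow B) A'" unfolding psd_on_def by (intro conjI ballI allI herm form)
  moreover have "A' \<in> qmats B" unfolding qmats_def mem_Collect_eq by (intro allI impI out)
  ultimately show ?thesis by (simp add: psd_mats_def)
qed

lemma sep_cone_limit:
  assumes "finite Q" "partition_on Q \<pi>" "\<And>n. sep_cone Q \<pi> (A n)" "\<And>x y. (\<lambda>n. A n x y) \<longlonglongrightarrow> A' x y"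
  shows "sep_cone Q \<pi> A'"
proof -
  define N where "N = card (Pow Q \<times> Pow Q \<times> (UNIV :: bool set))"
  have fin: "finite \<pi>" using assms(1,2) finite_elements by blast
  have finB: "finite B" if "B \<in> \<pi>" for B
    using that partition_onD1[OF assms(2)] finite_subset[OF _ assms(1), of B] by blast
  have "\<exists>p r. unit_decomp Q \<pi> {..<N} p r (A n)" for n
    using sep_cone_unit_decomp[OF assms(1-3)] unit_decomp_card[OF assms(1,2)] unfolding N_def by blast
  then obtain p r where u: "\<And>n. unit_decomp Q \<pi> {..<N} (p n) (r n) (A n)" by metis
  have p0: "0 \<le> p n k" and r: "B \<in> \<pi> \<Longrightarrow> r n k B \<in> psd_mats B" "B \<in> \<pi> \<Longrightarrow> trace_qmat B (r n k B) = 1"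
    if "k < N" for n k B
    using u[of n] that by (auto simp: unit_decomp_def)
  have A: "A n x y = (\<Sum>k<N. complex_of_real (p n k) * tensor Q \<pi> (r n k) x y)" for n x y
    using u[of n] by (simp add: unit_decomp_def)
  \<comment> \<open>Convergent traces are bounded, which bounds the weights uniformly in
    \<open>n\<close>.\<close>
  have "(\<lambda>n. trace_qmat Q (A n)) \<longlonglongrightarrow> trace_qmat Q A'"
    unfolding trace_qmat_def by (intro tendsto_sum assms(4))
  then have "Bseq (\<lambda>n. trace_qmat Q (A n))" by (intro convergent_imp_Bseq convergentI)
  then obtain b where b: "\<And>n. cmod (trace_qmat Q (A n)) \<le> b" by (auto simp: Bseq_def)
  have pb: "cmod (complex_of_real (p n k)) \<le> b" if "k \<in> {..<N}" for n k
    using unit_decomp_weight_le_trace[OF assms(1,2) u that, of n] p0[of k n] that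
      complex_Re_le_cmod[of "trace_qmat Q (A n)"] b[of n] by simp
  obtain s p' where s: "strict_mono (s :: nat \<Rightarrow> nat)"
    and p': "\<forall>k\<in>{..<N}. (\<lambda>n. complex_of_real (p (s n) k)) \<longlonglongrightarrow> p' k"
    using bounded_family_subseq[of "{..<N}" "\<lambda>n k. complex_of_real (p n k)" b] pb by auto
  \<comment> \<open>All entries of all factors of all terms form one finite family, so a single
    subsequence serves them all.\<close>
  define J where "J = {..<N} \<times> \<pi> \<times> Pow Q \<times> Pow Q"
  define f where "f n = (\<lambda>(k, B, x, y). r (s n) k B x y)" for n
  have "finite J" using fin assms(1) by (simp add: J_def)
  moreover have "cmod (f n j) \<le> 1" if "j \<in> J" for n j
    using that psd_mats_entry_le_trace[OF finB r(1)] r(2) by (force simp: J_def f_def)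
  ultimately obtain s' l where s': "strict_mono (s' :: nat \<Rightarrow> nat)" "\<forall>j\<in>J. (\<lambda>n. f (s' n) j) \<longlonglongrightarrow> l j"
    using bounded_family_subseq[of J f 1] by blast
  define t where "t n = s (s' n)" for n
  have t: "strict_mono t" using s s'(1) by (simp add: strict_mono_def t_def)
  have pt: "(\<lambda>n. complex_of_real (p (t n) k)) \<longlonglongrightarrow> p' k" if "k < N" for k
    using LIMSEQ_subseq_LIMSEQ[OF p'[rule_format] s'(1)] that by (simp add: o_def t_def)
  \<comment> \<open>Entries outside the block are zero throughout the sequence; there the limit is
    set directly.\<close>
  define r' where "r' k B x y = (if x \<subseteq> B \<and> y \<subseteq> B then l (k, B, x, y) else 0)" for k B x y
  have rt: "(\<lambda>n. r (t n) k B x y) \<longlonglongrightarrow> r' k B x y" if "k < N" "B \<in> \<pi>" for k B x y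
  proof (cases "x \<subseteq> B \<and> y \<subseteq> B")
    case True
    have "B \<subseteq> Q" using that(2) partition_onD1[OF assms(2)] by blast
    then have "(k, B, x, y) \<in> J" using True that by (auto simp: J_def)
    from s'(2)[rule_format, OF this] show ?thesis using True by (simp add: f_def t_def r'_def)
  next
    case False
    then show ?thesis using psd_mats_outside[OF r(1)[OF that] False] by (simp only: r'_def if_False) simp
  qed
  have r': "r' k B \<in> psd_mats B" if "k < N" "B \<in> \<pi>" for k B
    by (rule psd_mats_limit[of "\<lambda>n. r (t n) k B"]) (use r(1) rt that in auto)
  \<comment> \<open>The weights were treated as complex numbers to reuse the subsequence lemma;
    their limits are real again.\<close>
  define q where "q k = Re (p' k)" for k
  have q: "0 \<le> q k" "p' k = complex_of_real (q k)" if "k < N" for k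
  proof -
    have "(\<lambda>n. p (t n) k) \<longlonglongrightarrow> q k" using tendsto_Re[OF pt[OF that]] by (simp add: q_def)
    then show "0 \<le> q k" using p0[OF that] by (intro LIMSEQ_le_const) auto
    have "(\<lambda>n. 0) \<longlonglongrightarrow> Im (p' k)" using tendsto_Im[OF pt[OF that]] by simp
    then show "p' k = complex_of_real (q k)" by (simp add: q_def LIMSEQ_const_iff complex_eq_iff)
  qed
  have "A' x y = (\<Sum>k\<in>{..<N}. complex_of_real (q k) * tensor Q \<pi> (r' k) x y)" for x y
  proof (rule LIMSEQ_unique)
    show "(\<lambda>n. A (t n) x y) \<longlonglongrightarrow> A' x y"
      using LIMSEQ_subseq_LIMSEQ[OF assms(4) t] by (simp add: o_def)
    have "(\<lambda>n. tensor Q \<pi> (r (t n) k) x y) \<longlonglongrightarrow> tensor Q \<pi> (r' k) x y" if "k < N" for k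
    proof (cases "x \<subseteq> Q \<and> y \<subseteq> Q")
      case True
      have "(\<lambda>n. \<Prod>B\<in>\<pi>. r (t n) k B (x \<inter> B) (y \<inter> B)) \<longlonglongrightarrow> (\<Prod>B\<in>\<pi>. r' k B (x \<inter> B) (y \<inter> B))"
        by (intro tendsto_prod rt that)
      then show ?thesis using True by (simp add: tensor_def)
    next
      case False
      then show ?thesis by (simp only: tensor_def if_False tendsto_const)
    qed
    then show "(\<lambda>n. A (t n) x y) \<longlonglongrightarrow> (\<Sum>k\<in>{..<N}. complex_of_real (q k) * tensor Q \<pi> (r' k) x y)"
      unfolding A using pt q(2) by (intro tendsto_sum tendsto_mult) auto
  qed
  then have "A' = (\<lambda>x y. \<Sum>k\<in>{..<N}. complex_of_real (q k) * tensor Q \<pi> (r' k) x y)" by (intro ext)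
  then show ?thesis using sep_cone_sum[of "{..<N}" q \<pi> r' Q] q(1) r' by simp
qed



section \<open>Soundness\<close>

definition basis_ok :: "'q set \<Rightarrow> 'q qmat \<Rightarrow> 'q \<Rightarrow> basis \<Rightarrow> bool" where
  "basis_ok Q \<rho> q b \<longleftrightarrow>
    (b = Std \<or> b = Bot_b \<longrightarrow> std Q q \<rho>) \<and> (b = Diag \<or> b = Bot_b \<longrightarrow> diag Q q \<rho>)"

lemma soundness_iff:
  assumes "finite Q"
  shows "(\<rho>, (b, \<pi>)) \<in> soundness Q \<longleftrightarrow>
    \<rho> \<in> states Q \<and> partition_on Q \<pi> \<and> sep_cone Q \<pi> \<rho> \<and> (\<forall>q\<in>Q. basis_ok Q \<rho> q (b q))"
  unfolding soundness_def astates_def basis_ok_def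
  using beta_le_iff[OF assms] separable_iff[OF assms] by auto

text \<open>A larger lattice element makes fewer demands on its qubit, and a product over fine
  blocks is one over coarser blocks.\<close>

lemma soundness_weaken:
  assumes "finite Q" "(\<rho>, (b, \<pi>)) \<in> soundness Q" "\<And>q. b q \<le> b' q" "refines Q \<pi> \<pi>'"
  shows "(\<rho>, (b', \<pi>')) \<in> soundness Q"
proof -
  have s: "\<rho> \<in> states Q" "partition_on Q \<pi>" "sep_cone Q \<pi> \<rho>" "\<forall>q\<in>Q. basis_ok Q \<rho> q (b q)"
    using assms(2) by (auto simp: soundness_iff[OF assms(1)])
  have "basis_ok Q \<rho> q (b' q)" if "q \<in> Q" for q
    using s(4) that assms(3)[of q] by (auto simp: basis_ok_def less_eq_basis_def)
  moreover have "partition_on Q \<pi>'" using assms(4) by (simp add: refines_def)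
  ultimately show ?thesis
    using s sep_cone_refines[OF assms(1,4) s(3)] by (simp add: soundness_iff[OF assms(1)])
qed

lemma trace_qmat_add:
  "trace_qmat Q (\<lambda>x y. A x y + B x y) = trace_qmat Q A + trace_qmat Q B"
  by (simp add: trace_qmat_def sum.distrib)

text \<open>\<open>std\<close> and \<open>diag\<close> are linear conditions on entries and
  separability is conic; only the trace needs an assumption of its own.\<close>

lemma soundness_add:
  assumes "finite Q" "(A, a) \<in> soundness Q" "(B, a) \<in> soundness Q"
    "Re (trace_qmat Q A) + Re (trace_qmat Q B) \<le> 1"
  shows "((\<lambda>x y. A x y + B x y), a) \<in> soundness Q"
proof -
  obtain b \<pi> where a: "a = (b, \<pi>)" by fastforce
  have "(\<lambda>x y. A x y + B x y) \<in> states Q"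
    using assms psd_mats_add[of A Q B]
    unfolding a soundness_iff[OF assms(1)] states_iff trace_qmat_add by simp
  moreover have "basis_ok Q (\<lambda>x y. A x y + B x y) q l" if "basis_ok Q A q l" "basis_ok Q B q l" for q l
    using that by (auto simp: basis_ok_def std_def diag_def)
  ultimately show ?thesis
    using assms(2,3) sep_cone_add unfolding a soundness_iff[OF assms(1)] by blast
qed

lemma soundness_zero:
  assumes "finite Q" "a \<in> astates Q"
  shows "((\<lambda>x y. 0), a) \<in> soundness Q"
proof -
  obtain b \<pi> where a: "a = (b, \<pi>)" by fastforce
  have "(\<lambda>x y. 0) \<in> states Q"
    by (simp add: states_iff psd_mats_def qmats_def psd_on_def trace_qmat_def)
  then show ?thesis
    using assms(2) sep_cone.zero
    by (auto simp: a soundness_iff[OF assms(1)] astates_def basis_ok_def std_def diag_def)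
qed

lemma soundness_limit:
  assumes "finite Q" "\<And>n. (A n, a) \<in> soundness Q" "\<And>x y. (\<lambda>n. A n x y) \<longlonglongrightarrow> A' x y"
  shows "(A', a) \<in> soundness Q"
proof -
  obtain b \<pi> where a: "a = (b, \<pi>)" by fastforce
  have s: "A n \<in> psd_mats Q" "Re (trace_qmat Q (A n)) \<le> 1" "partition_on Q \<pi>" "sep_cone Q \<pi> (A n)"
    "q \<in> Q \<Longrightarrow> basis_ok Q (A n) q (b q)" for n q
    using assms(2)[of n] unfolding a soundness_iff[OF assms(1)] states_iff by auto
  have "(\<lambda>n. Re (trace_qmat Q (A n))) \<longlonglongrightarrow> Re (trace_qmat Q A')"
    unfolding trace_qmat_def by (intro tendsto_Re tendsto_sum assms(3))
  then have "Re (trace_qmat Q A') \<le> 1" using s(2) by (intro LIMSEQ_le_const2) auto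
  moreover have "A' \<in> psd_mats Q" by (rule psd_mats_limit[OF s(1) assms(3)])
  moreover have "sep_cone Q \<pi> A'" by (rule sep_cone_limit[OF assms(1) s(3,4) assms(3)])
  moreover have "basis_ok Q A' q (b q)" if "q \<in> Q" for q
    unfolding basis_ok_def std_def diag_def
  proof (intro conjI impI allI)
    fix x y assume b: "b q = Std \<or> b q = Bot_b" and xy: "x \<subseteq> Q" "y \<subseteq> Q" "(q \<in> x) \<noteq> (q \<in> y)"
    have "A n x y = 0" for n
      using s(5)[OF that, of n] b stdD[OF _ xy, of "A n"] unfolding basis_ok_def by blast
    then show "A' x y = 0" using assms(3)[of x y] by (simp add: LIMSEQ_const_iff)
  next
    fix x y assume b: "b q = Diag \<or> b q = Bot_b" and xy: "x \<subseteq> Q" "y \<subseteq> Q"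
    have "A n (flip q x) (flip q y) = A n x y" for n
      using s(5)[OF that, of n] b diagD[OF _ xy, of q "A n"] unfolding basis_ok_def by blast
    then have "(\<lambda>n. A n x y) \<longlonglongrightarrow> A' (flip q x) (flip q y)" using assms(3)[of "flip q x" "flip q y"] by simp
    then show "A' (flip q x) (flip q y) = A' x y" using assms(3)[of x y] by (rule LIMSEQ_unique)
  qed
  ultimately show ?thesis using s(3) by (simp add: a soundness_iff[OF assms(1)] states_iff)
qed

lemma part_Join_props:
  assumes "\<And>\<tau>. \<tau> \<in> S \<Longrightarrow> partition_on Q \<tau>"
  shows "partition_on Q (part_Join Q S)" "\<tau> \<in> S \<Longrightarrow> refines Q \<tau> (part_Join Q S)"
  using theI'[OF part_Join_unique_existence[OF assms]] unfolding part_Join_def by blast+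

lemma soundness_astates: "(\<rho>, a) \<in> soundness Q \<Longrightarrow> a \<in> astates Q"
  by (auto simp: soundness_def)

text \<open>Lets the outcomes of different branches or rounds be compared with one abstract value,
  at which they can be added.\<close>

lemma soundness_aJoin:
  assumes "finite Q" "(\<rho>, a) \<in> soundness Q" "a \<in> X" "X \<subseteq> astates Q"
  shows "(\<rho>, aJoin Q X) \<in> soundness Q"
proof -
  obtain b \<pi> where a: "a = (b, \<pi>)" by fastforce
  have part: "partition_on Q \<tau>" if "\<tau> \<in> snd ` X" for \<tau> using that assms(4) by (force simp: astates_def)
  have "refines Q \<pi> (part_Join Q (snd ` X))"
    using part_Join_props(2)[of "snd ` X" Q \<pi>] part assms(3) unfolding a by force
  moreover have "b \<le> (SUP a\<in>X. fst a)"
    using SUP_upper[OF assms(3), of fst] by (simp add: a)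
  ultimately show ?thesis
    using soundness_weaken[OF assms(1), of \<rho> b \<pi> "SUP a\<in>X. fst a"] assms(2)
    by (simp add: a aJoin_def le_fun_def)
qed

lemma basis_ok_conj_by_on1_other:
  assumes "finite Q" "q \<in> Q" "r \<in> Q" "r \<noteq> q" "basis_ok Q \<rho> r l"
  shows "basis_ok Q (conj_by Q (on1 Q M q) \<rho>) r l"
  using assms std_conj_by_on1_other[OF assms(1,2,4)] diag_conj_by_on1_other[OF assms(1-4)]
  unfolding basis_ok_def by blast

lemma soundness_on1:
  assumes "finite Q" "q \<in> Q" "(\<rho>, (b, \<pi>)) \<in> soundness Q"
    and "trace_qmat Q (conj_by Q (on1 Q M q) \<rho>) = trace_qmat Q \<rho>"
    and "basis_ok Q (conj_by Q (on1 Q M q) \<rho>) q l"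
  shows "(conj_by Q (on1 Q M q) \<rho>, (b(q := l), \<pi>)) \<in> soundness Q"
proof -
  have s: "\<rho> \<in> psd_mats Q" "Re (trace_qmat Q \<rho>) \<le> 1" "partition_on Q \<pi>" "sep_cone Q \<pi> \<rho>"
    "\<And>q. q \<in> Q \<Longrightarrow> basis_ok Q \<rho> q (b q)"
    using assms(3) unfolding soundness_iff[OF assms(1)] states_iff by auto
  have "conj_by Q (on1 Q M q) \<rho> \<in> states Q"
    using s(2) assms(4) conj_by_psd[OF assms(1) on1_qmats s(1)] by (simp add: states_iff)
  moreover have "basis_ok Q (conj_by Q (on1 Q M q) \<rho>) r ((b(q := l)) r)" if "r \<in> Q" for r
    using basis_ok_conj_by_on1_other[OF assms(1,2) that _ s(5)[OF that]] assms(5) by (cases "r = q") auto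
  ultimately show ?thesis
    using s(3) sep_cone_conj_by_on1[OF assms(1) s(3) assms(2) s(4)]
    by (simp add: soundness_iff[OF assms(1)])
qed

lemma soundness_basis_ok:
  "finite Q \<Longrightarrow> (\<rho>, (b, \<pi>)) \<in> soundness Q \<Longrightarrow> q \<in> Q \<Longrightarrow> basis_ok Q \<rho> q (b q)"
  by (simp add: soundness_iff)

lemma soundness_H:
  assumes "finite Q" "q \<in> Q" "(\<rho>, a) \<in> soundness Q"
  shows "(conj_by Q (on1 Q H_mat q) \<rho>, aH q a) \<in> soundness Q"
proof -
  obtain b \<pi> where a: "a = (b, \<pi>)" by fastforce
  \<comment> \<open>Expresses all cases of \<open>aH\<close> as one update at \<open>q\<close>,
    which is trivial in the last case.\<close>
  define l where "l = (if b q = Std then Diag else if b q = Diag then Std else b q)"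
  have "basis_ok Q (conj_by Q (on1 Q H_mat q) \<rho>) q l"
    using soundness_basis_ok[OF assms(1) assms(3)[unfolded a] assms(2)]
      std_conj_by_H[OF assms(1,2)] diag_conj_by_H[OF assms(1,2)]
    by (cases "b q") (auto simp: basis_ok_def l_def)
  from soundness_on1[OF assms(1,2) assms(3)[unfolded a] trace_conj_by_H[OF assms(1,2)] this]
  show ?thesis by (cases "b q") (simp_all add: a l_def fun_upd_idem)
qed

lemma soundness_T:
  assumes "finite Q" "q \<in> Q" "(\<rho>, a) \<in> soundness Q"
  shows "(conj_by Q (on1 Q T_mat q) \<rho>, aT q a) \<in> soundness Q"
proof -
  obtain b \<pi> where a: "a = (b, \<pi>)" by fastforce
  define l where "l = (if b q = Diag then Top_b else if b q = Bot_b then Std else b q)"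
  have "basis_ok Q (conj_by Q (on1 Q T_mat q) \<rho>) q l"
    using soundness_basis_ok[OF assms(1) assms(3)[unfolded a] assms(2)]
      std_conj_by_on1_diagonal[OF assms(1,2), of \<rho> T_mat]
    by (cases "b q") (auto simp: basis_ok_def l_def)
  from soundness_on1[OF assms(1,2) assms(3)[unfolded a] trace_conj_by_T[OF assms(1,2)] this]
  show ?thesis by (cases "b q") (simp_all add: a l_def fun_upd_idem)
qed

lemma soundness_pauli:
  assumes "finite Q" "q \<in> Q" "(\<rho>, a) \<in> soundness Q"
  shows "(conj_by Q (on1 Q (pauli_mat s) q) \<rho>, a) \<in> soundness Q"
proof -
  obtain b \<pi> where a: "a = (b, \<pi>)" by fastforce
  have "std Q q \<rho> \<Longrightarrow> std Q q (conj_by Q (on1 Q (pauli_mat s) q) \<rho>)"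
    by (rule std_conj_by_on1_diagonal[OF assms(1,2)]) (cases s; simp)+
  then have "basis_ok Q (conj_by Q (on1 Q (pauli_mat s) q) \<rho>) q (b q)"
    using soundness_basis_ok[OF assms(1) assms(3)[unfolded a] assms(2)]
      diag_conj_by_pauli[OF assms(1,2), of \<rho> s]
    by (auto simp: basis_ok_def)
  from soundness_on1[OF assms(1,2) assms(3)[unfolded a] trace_conj_by_pauli[OF assms(1,2)] this]
  show ?thesis by (simp add: a)
qed

lemma partition_on_part_pair:
  assumes "q1 \<in> Q" "q2 \<in> Q"
  shows "partition_on Q (part_pair Q q1 q2)"
  using assms by (auto simp: partition_on_def part_pair_def disjoint_def)

lemma soundness_CNot:
  assumes "finite Q" "q1 \<in> Q" "q2 \<in> Q" "q1 \<noteq> q2" "(\<rho>, a) \<in> soundness Q"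
  shows "(conj_by Q (on2 Q CNot_mat q1 q2) \<rho>, aCNot Q q1 q2 a) \<in> soundness Q"
proof -
  obtain b \<pi> where a: "a = (b, \<pi>)" by fastforce
  obtain b' \<pi>' where a': "aCNot Q q1 q2 (b, \<pi>) = (b', \<pi>')" by fastforce
  define \<sigma> where "\<sigma> = conj_by Q (on2 Q CNot_mat q1 q2) \<rho>"
  have s: "\<rho> \<in> psd_mats Q" "Re (trace_qmat Q \<rho>) \<le> 1" "partition_on Q \<pi>" "sep_cone Q \<pi> \<rho>"
    "\<And>q. q \<in> Q \<Longrightarrow> basis_ok Q \<rho> q (b q)"
    using assms(5) unfolding a soundness_iff[OF assms(1)] states_iff by auto
  note fq = assms(1,4,2,3)
  have "\<sigma> \<in> states Q"
    using s(2) trace_conj_by_CNot[OF fq] conj_by_psd[OF assms(1) on2_qmats s(1)]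
    by (simp add: states_iff \<sigma>_def)
  moreover have "partition_on Q \<pi>' \<and> sep_cone Q \<pi>' \<sigma>"
  \<comment> \<open>All cases of \<open>aCNot\<close> except the last: they leave the partition
    alone, and each guarantees a standard control or a diagonal target.\<close>
  proof (cases "b q1 = Std \<or> b q1 = Bot_b \<or> b q2 = Diag \<or> b q2 = Bot_b")
    case True
    have "\<pi>' = \<pi>" using a' True by (auto simp: less_basis_def less_eq_basis_def split: if_splits)
    moreover have "std Q q1 \<rho> \<or> diag Q q2 \<rho>"
      using True s(5)[OF assms(2)] s(5)[OF assms(3)] by (auto simp: basis_ok_def)
    ultimately show ?thesis
      using s(3) sep_cone_CNot_std_control[OF assms(1) s(3) assms(4,2,3) _ s(4)]
        sep_cone_CNot_diag_target[OF assms(1) s(3) assms(4,2,3) _ s(4)] by (auto simp: \<sigma>_def)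
  next
    case False
    then have \<pi>': "\<pi>' = part_Join Q {\<pi>, part_pair Q q1 q2}" using a' by auto
    have parts: "partition_on Q \<tau>" if "\<tau> \<in> {\<pi>, part_pair Q q1 q2}" for \<tau>
      using that s(3) partition_on_part_pair[OF assms(2,3)] by blast
    have part: "partition_on Q \<pi>'" unfolding \<pi>' using part_Join_props(1)[OF parts] by blast
    have "refines Q \<pi> \<pi>'" "refines Q (part_pair Q q1 q2) \<pi>'"
      unfolding \<pi>' by (rule part_Join_props(2); use parts in blast)+
    \<comment> \<open>The pair is a block of \<open>part_pair\<close>, so the join has a block
      containing both qubits.\<close>
    then obtain B where B: "B \<in> \<pi>'" "{q1, q2} \<subseteq> B" unfolding refines_def part_pair_def by blast
    have "sep_cone Q \<pi>' \<rho>" using sep_cone_refines[OF assms(1) \<open>refines Q \<pi> \<pi>'\<close> s(4)] .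
    then have "sep_cone Q \<pi>' \<sigma>"
      unfolding \<sigma>_def using B by (intro sep_cone_conj_by_CNot_same_block[OF assms(1) part B(1) _ _ assms(4)]) auto
    then show ?thesis using part by blast
  qed
  moreover have "basis_ok Q \<sigma> r (b' r)" if r: "r \<in> Q" for r
  proof -
    consider "r = q1" | "r = q2" | "r \<noteq> q1" "r \<noteq> q2" by blast
    then show ?thesis
    proof cases
      case 1
      have "basis_ok Q \<sigma> q1 (b' q1)"
        using a' s(5)[OF assms(2)] s(5)[OF assms(3)] assms(4)
          std_conj_by_CNot_control[OF fq, of \<rho>] diag_conj_by_CNot_control[OF fq, of \<rho>]
        by (cases "b q1"; cases "b q2")
          (auto simp: \<sigma>_def basis_ok_def less_basis_def less_eq_basis_def split: if_splits)
      then show ?thesis using 1 by simp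
    next
      case 2
      have "basis_ok Q \<sigma> q2 (b' q2)"
        using a' s(5)[OF assms(2)] s(5)[OF assms(3)] assms(4)
          std_conj_by_CNot_target[OF fq, of \<rho>] diag_conj_by_CNot_target[OF fq, of \<rho>]
        by (cases "b q1"; cases "b q2")
          (auto simp: \<sigma>_def basis_ok_def less_basis_def less_eq_basis_def split: if_splits)
      then show ?thesis using 2 by simp
    next
      case 3
      then have "b' r = b r" using a' by (auto split: if_splits)
      then show ?thesis
        using s(5)[OF r] std_conj_by_CNot_other[OF fq 3, of \<rho>] diag_conj_by_CNot_other[OF fq r 3, of \<rho>]
        by (auto simp: \<sigma>_def basis_ok_def)
    qed
  qed
  ultimately show ?thesis
    unfolding a a' \<sigma>_def[symmetric] by (simp add: soundness_iff[OF assms(1)])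
qed

text \<open>The two projections share the trace, and the share of the other one is
  nonnegative.\<close>

lemma trace_projection_le:
  assumes "finite Q" "q \<in> Q" "\<rho> \<in> psd_mats Q" "M = P_true \<or> M = P_false"
  shows "Re (trace_qmat Q (conj_by Q (on1 Q M q) \<rho>)) \<le> Re (trace_qmat Q \<rho>)"
  using arg_cong[OF trace_projections[OF assms(1,2), of \<rho>], of Re] assms(4)
    trace_psd_mats(2)[OF assms(1) conj_by_psd[OF assms(1) on1_qmats assms(3)], of P_true q]
    trace_psd_mats(2)[OF assms(1) conj_by_psd[OF assms(1) on1_qmats assms(3)], of P_false q]
  by auto

lemma soundness_projection:
  assumes "finite Q" "q \<in> Q" "(\<rho>, a) \<in> soundness Q" "M = P_true \<or> M = P_false"
  shows "(conj_by Q (on1 Q M q) \<rho>, aF q a) \<in> soundness Q"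
proof -
  obtain b \<pi> where a: "a = (b, \<pi>)" by fastforce
  have s: "\<rho> \<in> psd_mats Q" "Re (trace_qmat Q \<rho>) \<le> 1" "partition_on Q \<pi>" "sep_cone Q \<pi> \<rho>"
    "\<And>q. q \<in> Q \<Longrightarrow> basis_ok Q \<rho> q (b q)"
    using assms(3) unfolding a soundness_iff[OF assms(1)] states_iff by auto
  have "conj_by Q (on1 Q M q) \<rho> \<in> states Q"
    using s(2) trace_projection_le[OF assms(1,2) s(1) assms(4)] conj_by_psd[OF assms(1) on1_qmats s(1)]
    by (simp add: states_iff)
  moreover have "basis_ok Q (conj_by Q (on1 Q M q) \<rho>) r ((b(q := Std)) r)" if "r \<in> Q" for r
    using basis_ok_conj_by_on1_other[OF assms(1,2) that _ s(5)[OF that]]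
      std_conj_by_projection[OF assms(1,2,4)] by (cases "r = q") (auto simp: basis_ok_def)
  ultimately show ?thesis
    using sep_cone_projection[OF assms(1) s(3) assms(2,4) s(4)] partition_on_part_minus[OF s(3) assms(2)]
    by (simp add: a soundness_iff[OF assms(1)])
qed

lemma soundness_psd: "(\<rho>, a) \<in> soundness Q \<Longrightarrow> \<rho> \<in> psd_mats Q"
  by (auto simp: soundness_def states_iff)

lemma soundness_trace: "(\<rho>, a) \<in> soundness Q \<Longrightarrow> Re (trace_qmat Q \<rho>) \<le> 1"
  by (auto simp: soundness_def states_iff)

text \<open>The bound \<open>t\<close> keeps the partial sums among the states, makes the series
  converge, and passes to the limit, where it supplies the trace estimate for a loop.\<close>

lemma soundness_suminf:
  assumes "finite Q" "\<And>n. (A n, a) \<in> soundness Q" "\<And>N. (\<Sum>n<N. Re (trace_qmat Q (A n))) \<le> t" "t \<le> 1"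
  shows "((\<lambda>x y. \<Sum>n. A n x y), a) \<in> soundness Q \<and> Re (trace_qmat Q (\<lambda>x y. \<Sum>n. A n x y)) \<le> t"
proof -
  define S where "S N = (\<lambda>x y. \<Sum>n<N. A n x y)" for N
  have trS: "Re (trace_qmat Q (S N)) = (\<Sum>n<N. Re (trace_qmat Q (A n)))" for N
    unfolding S_def trace_qmat_def by (subst sum.swap) (simp add: Re_sum)
  have S: "(S N, a) \<in> soundness Q" for N
  proof (induction N)
    case 0
    then show ?case using soundness_zero[OF assms(1) soundness_astates[OF assms(2)]] by (simp add: S_def)
  next
    case (Suc N)
    have "Re (trace_qmat Q (S N)) + Re (trace_qmat Q (A N)) \<le> 1"
      using assms(3)[of "Suc N"] assms(4) by (simp add: trS)
    from soundness_add[OF assms(1) Suc assms(2) this] show ?case by (simp add: S_def)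
  qed
  have "summable (\<lambda>n. Re (trace_qmat Q (A n)))"
    using trace_psd_mats(2)[OF assms(1) soundness_psd[OF assms(2)]] assms(3)
    by (intro summableI_nonneg_bounded)
  then have "summable (\<lambda>n. A n x y)" for x y
    by (rule summable_comparison_test'[where N = 0])
      (rule psd_mats_entry_le_trace[OF assms(1) soundness_psd[OF assms(2)]])
  then have lim: "(\<lambda>N. S N x y) \<longlonglongrightarrow> (\<Sum>n. A n x y)" for x y
    unfolding S_def by (rule summable_LIMSEQ)
  have "(\<lambda>N. Re (trace_qmat Q (S N))) \<longlonglongrightarrow> Re (trace_qmat Q (\<lambda>x y. \<Sum>n. A n x y))"
    unfolding trace_qmat_def by (intro tendsto_Re tendsto_sum lim)
  then have "Re (trace_qmat Q (\<lambda>x y. \<Sum>n. A n x y)) \<le> t"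
    using assms(3) by (intro LIMSEQ_le_const2) (auto simp: trS)
  then show ?thesis using soundness_limit[OF assms(1) S lim] by blast
qed

text \<open>The trace estimate is part of the induction because branches are added: the projections
  divide the trace of \<open>\<rho>\<close>, and the subprograms must not enlarge the
  shares.\<close>

lemma sem_sound:
  assumes "finite Q" "is_program C Q" "(\<rho>, a) \<in> soundness Q"
  shows "(sem Q C \<rho>, asem Q C a) \<in> soundness Q \<and> Re (trace_qmat Q (sem Q C \<rho>)) \<le> Re (trace_qmat Q \<rho>)"
  using assms(2,3)
proof (induction C arbitrary: \<rho> a)
  case Skip
  then show ?case by simp
next
  case (Seq C1 C2)
  have 1: "(sem Q C1 \<rho>, asem Q C1 a) \<in> soundness Q \<and> Re (trace_qmat Q (sem Q C1 \<rho>)) \<le> Re (trace_qmat Q \<rho>)"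
    using Seq.IH(1)[OF _ Seq.prems(2)] Seq.prems(1) by simp
  then show ?case
    using Seq.IH(2)[OF _ conjunct1[OF 1]] Seq.prems(1) by force
next
  case (Cond q C1 C2)
  have q: "q \<in> Q" and p: "is_program C1 Q" "is_program C2 Q" using Cond.prems(1) by auto
  define A where "A = sem Q C1 (conj_by Q (on1 Q P_true q) \<rho>)"
  define B where "B = sem Q C2 (conj_by Q (on1 Q P_false q) \<rho>)"
  define X where "X = {asem Q C1 (aF q a), asem Q C2 (aF q a)}"
  have sem: "sem Q (Cond q C1 C2) \<rho> = (\<lambda>x y. A x y + B x y)"
    by (simp add: A_def B_def conj_by_def adjoint_P)
  have A: "(A, asem Q C1 (aF q a)) \<in> soundness Q"
      "Re (trace_qmat Q A) \<le> Re (trace_qmat Q (conj_by Q (on1 Q P_true q) \<rho>))"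
    using Cond.IH(1)[OF p(1) soundness_projection[OF assms(1) q Cond.prems(2)]] by (auto simp: A_def)
  have B: "(B, asem Q C2 (aF q a)) \<in> soundness Q"
      "Re (trace_qmat Q B) \<le> Re (trace_qmat Q (conj_by Q (on1 Q P_false q) \<rho>))"
    using Cond.IH(2)[OF p(2) soundness_projection[OF assms(1) q Cond.prems(2)]] by (auto simp: B_def)
  have X: "X \<subseteq> astates Q" using soundness_astates[OF A(1)] soundness_astates[OF B(1)] by (simp add: X_def)
  have tr: "Re (trace_qmat Q A) + Re (trace_qmat Q B) \<le> Re (trace_qmat Q \<rho>)"
    using A(2) B(2) arg_cong[OF trace_projections[OF assms(1) q, of \<rho>], of Re] by simp
  have "(\<lambda>x y. A x y + B x y, aJoin Q X) \<in> soundness Q"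
    using soundness_aJoin[OF assms(1) A(1) _ X] soundness_aJoin[OF assms(1) B(1) _ X]
      tr soundness_trace[OF Cond.prems(2)]
    by (intro soundness_add[OF assms(1)]) (auto simp: X_def)
  then show ?case using tr by (simp only: sem asem.simps X_def trace_qmat_add plus_complex.sel)
next
  case (While q C)
  have q: "q \<in> Q" and p: "is_program C Q" using While.prems(1) by auto
  define r where "r n = ((sem Q C \<circ> conj_by Q (on1 Q P_true q)) ^^ n) \<rho>" for n
  define e where "e n = ((asem Q C \<circ> aF q) ^^ n) a" for n
  define A where "A n = conj_by Q (on1 Q P_false q) (r n)" for n
  define X where "X = range (\<lambda>n. aF q (e n))"
  have r_Suc: "r (Suc n) = sem Q C (conj_by Q (on1 Q P_true q) (r n))" for n by (simp add: r_def)
  have e_Suc: "e (Suc n) = asem Q C (aF q (e n))" for n by (simp add: e_def)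
  have r: "(r n, e n) \<in> soundness Q" for n
  proof (induction n)
    case 0
    then show ?case using While.prems(2) by (simp add: r_def e_def)
  next
    case (Suc n)
    show ?case
      using While.IH[OF p soundness_projection[OF assms(1) q Suc]] by (simp add: r_Suc e_Suc)
  qed
  have A: "(A n, aF q (e n)) \<in> soundness Q" for n
    unfolding A_def by (rule soundness_projection[OF assms(1) q r]) simp
  \<comment> \<open>Balance of one round: what leaves at the test and what enters the next round
    together do not exceed what was present.\<close>
  have tr_step: "Re (trace_qmat Q (A n)) + Re (trace_qmat Q (r (Suc n))) \<le> Re (trace_qmat Q (r n))" for n
    using While.IH[OF p soundness_projection[OF assms(1) q r, of P_true n]]
      arg_cong[OF trace_projections[OF assms(1) q, of "r n"], of Re]
    by (simp add: r_Suc A_def)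
  have "(\<Sum>n<N. Re (trace_qmat Q (A n))) + Re (trace_qmat Q (r N)) \<le> Re (trace_qmat Q \<rho>)" for N
  proof (induction N)
    case 0
    then show ?case by (simp add: r_def)
  next
    case (Suc N)
    then show ?case using tr_step[of N] by simp
  qed
  moreover have "0 \<le> Re (trace_qmat Q (r N))" for N
    by (rule trace_psd_mats(2)[OF assms(1) soundness_psd[OF r]])
  ultimately have tr: "(\<Sum>n<N. Re (trace_qmat Q (A n))) \<le> Re (trace_qmat Q \<rho>)" for N
    by (meson add_increasing2 order.trans order.refl)
  have X: "X \<subseteq> astates Q" using soundness_astates[OF A] by (auto simp: X_def)
  have "(A n, aJoin Q X) \<in> soundness Q" for n
    by (rule soundness_aJoin[OF assms(1) A _ X]) (simp add: X_def)
  from soundness_suminf[OF assms(1) this tr soundness_trace[OF While.prems(2)]]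
  show ?case by (simp add: A_def r_def X_def e_def)
next
  case (HGate q)
  then show ?case using soundness_H[OF assms(1)] trace_conj_by_H[OF assms(1)] by simp
next
  case (TGate q)
  then show ?case using soundness_T[OF assms(1)] trace_conj_by_T[OF assms(1)] by simp
next
  case (Pauli s q)
  then show ?case using soundness_pauli[OF assms(1)] trace_conj_by_pauli[OF assms(1)] by simp
next
  case (CNot q1 q2)
  then show ?case using soundness_CNot[OF assms(1)] trace_conj_by_CNot[OF assms(1)] by simp
qed

theorem mainTheorem3:
  fixes Q :: "'q set" and C :: "'q com" and \<rho> :: "'q qmat" and a :: "'q astate"
  assumes "finite Q" and "is_program C Q"
    and "\<rho> \<in> states Q" and "a \<in> astates Q"
    and "(\<rho>, a) \<in> soundness Q"
  shows "(sem Q C \<rho>, asem Q C a) \<in> soundness Q"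
  using sem_sound[OF assms(1,2,5)] by blast

end
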